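(* Let $1\le k\le m\le n$ and let $\theta=\|\cdot\|_{(k)}$ be the Ky Fan $k$-norm on $\mathbb{R}^{m\times n}$. Let $\overline X,\overline S\in\mathbb{R}^{m\times n}$ satisfy $\overline S\in\partial\theta(\overline X)$, let $X=\overline X+\overline S$ have the singular value decomposition $X=\overline U[\Sigma(X)\ \ 0]\overline V^T$ with $\overline U\in\mathcal{O}^m$, $\overline V\in\mathcal{O}^n$, and put $\overline\sigma=\sigma(\overline X)$, $\overline u=\sigma(\overline S)$. Let $H\in\mathbb{R}^{m\times n}$ belong to the critical cone $\mathcal{C}(X;\partial\theta(\overline X))=\{H\mid\theta'(\overline X;H)\le\langle\overline S,H\rangle\}$, and let $$\mathcal{T}^2(H)=\Big\{(W,\eta)\in\mathbb{R}^{m\times n}\times\mathbb{R}\ \Big|\ \sum_{i=1}^k\sigma_i''(\overline X;H,W)\le\eta\Big\}.$$ Then the support function value $\delta^*_{\mathcal{T}^2(H)}(\overline S,-1)=\sup\{\langle\overline S,W\rangle-\eta\mid(W,\eta)\in\mathcal{T}^2(H)\}$ is given as follows (with the index sets and the matrices $\Omega$ defined in the context). (i) If $\overline\sigma_k>0$, then $$\delta^*_{\mathcal{T}^2(H)}(\overline S,-1)=\sum_{l=1}^{r_0}\mathrm{tr}\big(2\Omega_{a_l}(\overline X,H)\big)+\big\langle\mathrm{Diag}(\overline u_\beta),2\Omega_\beta(\overline X,H)\big\rangle.$$ (ii) If $\overline\sigma_k=0$, then $$\delta^*_{\mathcal{T}^2(H)}(\overline S,-1)=\sum_{l=1}^{r_0}\mathrm{tr}\big(2\Omega_{a_l}(\overline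 X,H)\big)+\big\langle\mathrm{Diag}(\overline u_\beta),2\overline U_\beta^TH\,\overline X^\dagger\,H\overline V_\beta\big\rangle.$$
   Context: Inner product: $\langle Y,Z\rangle=\mathrm{Tr}(Y^TZ)$. For $Z\in\mathbb{R}^{m\times n}$, $\sigma_1(Z)\ge\dots\ge\sigma_m(Z)$ are the singular values, $\Sigma(Z)=\mathrm{diag}(\sigma(Z))$, $\|Z\|_{(k)}=\sum_{i=1}^k\sigma_i(Z)$. $\mathcal{O}^p$ is the set of $p\times p$ orthogonal matrices; $Z^\dagger$ is the Moore–Penrose pseudoinverse. $\theta'(\overline X;H)$ is the directional derivative; $\partial\theta$ is the convex subdifferential. The (parabolic) second order directional derivative of a directionally differentiable $\Phi$ at $x$ along $h,w$ is $\Phi''(x;h,w)=\lim_{t\downarrow0}\frac{\Phi(x+th+\frac12t^2w)-\Phi(x)-t\Phi'(x;h)}{\frac12t^2}$; it exists for every singular value function $\sigma_i$. For square $Z$: $\mathrm{sym}(Z)=\frac12(Z+Z^T)$, $\mathrm{skew}(Z)=\frac12(Z-Z^T)$. $Z_J$ is the submatrix of columns of $Z$ indexed by $J$. Write $\overline V=[\overline V_1\ \overline V_2]$ with $\overline V_1\in\mathbb{R}^{n\times m}$, $\overline V_2\in\mathbb{R}^{n\times(n-m)}$. Index sets: if $\overline\sigma_k>0$, let $0\le k_0\le k-1$ and $k\le k_1\le m$ be the integers with $\overline\sigma_1\ge\dots\ge\overline\sigma_{k_0}>\overline\sigma_{k_0+1}=\dots=\overline\sigma_k=\dots=\overline\sigma_{k_1}>\overline\sigma_{k_1+1}\ge\dots\ge\overline\sigma_m\ge0$,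 and $\alpha=\{1,\dots,k_0\}$, $\beta=\{k_0+1,\dots,k_1\}$. If $\overline\sigma_k=0$, let $0\le k_0\le k-1$ be the integer with $\overline\sigma_{k_0}>\overline\sigma_{k_0+1}=\dots=\overline\sigma_m=0$, and $\alpha=\{1,\dots,k_0\}$, $\beta=\{k_0+1,\dots,m\}$. Let $a_1,a_2,\dots$ be the sets of indices $i$ on which $\sigma_i(X)$ takes its distinct nonzero values, in decreasing order of value; then $\alpha=\bigcup_{l=1}^{r_0}a_l$ for some $r_0\ge0$, and $\overline\sigma$ is constant on each $a_l$, $l\le r_0$, with common value $\overline\nu_l>0$ ($a_l=\{i:\overline\sigma_i=\overline\nu_l\}$). The matrices $\Omega$: one has $\overline X=\overline U[\mathrm{Diag}(\overline\sigma)\ \ 0]\overline V^T$. For an index set $a=\{i:\overline\sigma_i=\nu\}$ with $\nu>0$, $\Omega_a(\overline X,H)\in\mathcal{S}^{|a|}$ (symmetric matrices) is $$\Omega_a(\overline X,H)=\big(\mathrm{sym}(\overline U^TH\overline V_1)_a\big)^T(\Sigma(\overline X)-\nu I_m)^\dagger\,\mathrm{sym}(\overline U^TH\overline V_1)_a+\big(\mathrm{skew}(\overline U^TH\overline V_1)_a\big)^T(-\Sigma(\overline X)-\nu I_m)^\dagger\,\mathrm{skew}(\overline U^TH\overline V_1)_a-\frac1{2\nu}\overline U_a^TH\overline V_2\overline V_2^TH^T\overline U_a .$$ It is used with $a=a_l$, $\nu=\overline\nu_l$ ($l\le r_0$) and, when $\overline\sigma_k>0$, with $a=\beta$, $\nu=\overline\sigma_k$.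 *)

theory Defs
  imports
    "Jordan_Normal_Form.Char_Poly"
    "Jordan_Normal_Form.DL_Submatrix"
    "HOL-Library.Extended_Real"
begin

text \<open>
  Matrices are the carrier-based ones of \<open>Jordan_Normal_Form\<close>, so rows, columns and singular
  values are numbered from 0: the paper's \<open>\<sigma>_i\<close> is \<open>sing_val _ (i - 1)\<close> and its index set
  \<open>{p+1, ..., q}\<close> is \<open>{p..<q}\<close>.
\<close>

definition mat_tr :: "real mat \<Rightarrow> real" where
  "mat_tr A = (\<Sum>i<dim_row A. A $$ (i, i))"

definition mat_inner :: "real mat \<Rightarrow> real mat \<Rightarrow> real" where
  "mat_inner Y Z = mat_tr (transpose_mat Y * Z)"

text \<open>The library predicate \<open>orthogonal_mat\<close> does not normalise the columns, hence:\<close>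

definition orth_group :: "nat \<Rightarrow> real mat set" where
  "orth_group p = {Q \<in> carrier_mat p p. transpose_mat Q * Q = 1\<^sub>m p}"

definition sym_part :: "real mat \<Rightarrow> real mat" where
  "sym_part Z = (1/2) \<cdot>\<^sub>m (Z + transpose_mat Z)"

definition skew_part :: "real mat \<Rightarrow> real mat" where
  "skew_part Z = (1/2) \<cdot>\<^sub>m (Z - transpose_mat Z)"

definition cols_sub :: "real mat \<Rightarrow> nat set \<Rightarrow> real mat" where
  "cols_sub Z J = submatrix Z UNIV J"

text \<open>The Moore-Penrose inverse, determined by the four Penrose equations.\<close>

definition pinv :: "real mat \<Rightarrow> real mat" where
  "pinv A = (THE B. B \<in> carrier_mat (dim_col A) (dim_row A)
      \<and> A * B * A = A \<and> B * A * B = B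
      \<and> transpose_mat (A * B) = A * B \<and> transpose_mat (B * A) = B * A)"

text \<open>
  Singular values of an \<open>m \<times> n\<close> matrix with \<open>m \<le> n\<close>: the square roots of the \<open>m\<close> eigenvalues of
  \<open>Z Z\<^sup>T\<close>, counted with multiplicity, in decreasing order.
\<close>

definition sing_vals :: "real mat \<Rightarrow> real list" where
  "sing_vals Z = rev (sorted_list_of_multiset
      (image_mset sqrt (proots (char_poly (Z * transpose_mat Z)))))"

definition sing_val :: "real mat \<Rightarrow> nat \<Rightarrow> real" where
  "sing_val Z i = sing_vals Z ! i"

definition Sigma_mat :: "real mat \<Rightarrow> real mat" where
  "Sigma_mat Z = mat_diag (dim_row Z) (sing_val Z)"

text \<open>The \<open>m \<times> n\<close> matrix \<open>[\<Sigma>(Z)  0]\<close>.\<close>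

definition Sigma_zero_mat :: "real mat \<Rightarrow> real mat" where
  "Sigma_zero_mat Z = mat (dim_row Z) (dim_col Z) (\<lambda>(i, j). if i = j then sing_val Z i else 0)"

definition is_svd :: "real mat \<Rightarrow> real mat \<Rightarrow> real mat \<Rightarrow> bool" where
  "is_svd U Z V \<longleftrightarrow> U \<in> orth_group (dim_row Z) \<and> V \<in> orth_group (dim_col Z)
      \<and> Z = U * Sigma_zero_mat Z * transpose_mat V"

definition ky_fan :: "nat \<Rightarrow> real mat \<Rightarrow> real" where
  "ky_fan k Z = (\<Sum>i<k. sing_val Z i)"

definition subdifferential :: "(real mat \<Rightarrow> real) \<Rightarrow> real mat \<Rightarrow> real mat set" where
  "subdifferential \<theta> X = {S \<in> carrier_mat (dim_row X) (dim_col X).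
      \<forall>Z \<in> carrier_mat (dim_row X) (dim_col X). \<theta> X + mat_inner S (Z - X) \<le> \<theta> Z}"

text \<open>
  \<open>Lim\<close> is meaningful only when the limit exists. The functions used below are the Ky Fan norm,
  which is convex, and the singular value functions \<open>\<sigma>_i\<close>, for which both limits always exist.
\<close>

definition dir_deriv :: "(real mat \<Rightarrow> real) \<Rightarrow> real mat \<Rightarrow> real mat \<Rightarrow> real" where
  "dir_deriv \<Phi> x h = Lim (at_right 0) (\<lambda>t::real. (\<Phi> (x + t \<cdot>\<^sub>m h) - \<Phi> x) / t)"

definition dir_deriv2 :: "(real mat \<Rightarrow> real) \<Rightarrow> real mat \<Rightarrow> real mat \<Rightarrow> real mat \<Rightarrow> real" where
  "dir_deriv2 \<Phi> x h w = Lim (at_right 0) (\<lambda>t::real.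
      (\<Phi> (x + t \<cdot>\<^sub>m h + (1/2 * t\<^sup>2) \<cdot>\<^sub>m w) - \<Phi> x - t * dir_deriv \<Phi> x h) / (1/2 * t\<^sup>2))"

text \<open>The critical cone \<open>C(Xb + Sb; \<partial>\<theta>(Xb))\<close>.\<close>

definition critical_cone :: "(real mat \<Rightarrow> real) \<Rightarrow> real mat \<Rightarrow> real mat \<Rightarrow> real mat set" where
  "critical_cone \<theta> Xb Sb = {H \<in> carrier_mat (dim_row Xb) (dim_col Xb).
      dir_deriv \<theta> Xb H \<le> mat_inner Sb H}"

definition T2 :: "nat \<Rightarrow> real mat \<Rightarrow> real mat \<Rightarrow> (real mat \<times> real) set" where
  "T2 k Xb H = {(W, \<eta>). W \<in> carrier_mat (dim_row Xb) (dim_col Xb)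
      \<and> (\<Sum>i<k. dir_deriv2 (\<lambda>Z. sing_val Z i) Xb H W) \<le> \<eta>}"

definition support_fun :: "(real mat \<times> real) set \<Rightarrow> real mat \<times> real \<Rightarrow> ereal" where
  "support_fun C p = (SUP q \<in> C. ereal (mat_inner (fst p) (fst q) + snd p * snd q))"

text \<open>
  The index bounds \<open>k0\<close>, \<open>k1\<close> in the two cases. Only the comparisons at the ends of the block are
  spelled out, since the singular values \<open>s\<close> are decreasing.
\<close>

definition index_bounds_pos :: "(nat \<Rightarrow> real) \<Rightarrow> nat \<Rightarrow> nat \<Rightarrow> nat \<Rightarrow> nat \<Rightarrow> bool" where
  "index_bounds_pos s m k k0 k1 \<longleftrightarrow> k0 \<le> k - 1 \<and> k \<le> k1 \<and> k1 \<le> m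
      \<and> (0 < k0 \<longrightarrow> s k0 < s (k0 - 1))
      \<and> (\<forall>i \<in> {k0..<k1}. s i = s (k - 1))
      \<and> (k1 < m \<longrightarrow> s k1 < s (k1 - 1))"

definition index_bounds_zero :: "(nat \<Rightarrow> real) \<Rightarrow> nat \<Rightarrow> nat \<Rightarrow> nat \<Rightarrow> bool" where
  "index_bounds_zero s m k k0 \<longleftrightarrow> k0 \<le> k - 1
      \<and> (0 < k0 \<longrightarrow> s k0 < s (k0 - 1))
      \<and> (\<forall>i \<in> {k0..<m}. s i = 0)"

text \<open>\<open>sv_block X l\<close> is the paper's \<open>a_{l+1}\<close>.\<close>

definition nonzero_values :: "real mat \<Rightarrow> real list" where
  "nonzero_values X = rev (sorted_list_of_set (sing_val X ` {..<dim_row X} - {0}))"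

definition sv_block :: "real mat \<Rightarrow> nat \<Rightarrow> nat set" where
  "sv_block X l = {i. i < dim_row X \<and> sing_val X i = nonzero_values X ! l}"

text \<open>
  The number \<open>r_0\<close> with \<open>\<alpha> = a_1 \<union> ... \<union> a_{r_0}\<close>, and the common value of the singular values of
  \<open>Xb\<close> on the block \<open>a\<close>.
\<close>

definition block_count :: "real mat \<Rightarrow> nat set \<Rightarrow> nat" where
  "block_count X \<alpha> = (THE r. r \<le> length (nonzero_values X) \<and> \<alpha> = (\<Union>l<r. sv_block X l))"

definition common_value :: "real mat \<Rightarrow> nat set \<Rightarrow> real" where
  "common_value Xb a = (THE \<nu>. \<forall>i \<in> a. sing_val Xb i = \<nu>)"

definition Omega :: "real mat \<Rightarrow> real mat \<Rightarrow> real mat \<Rightarrow> real mat \<Rightarrow> nat set \<Rightarrow> real \<Rightarrow> real mat" where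
  "Omega U V Xb H a \<nu> =
    (let m = dim_row Xb; n = dim_col Xb;
         V1 = cols_sub V {..<m}; V2 = cols_sub V {m..<n};
         P = cols_sub (sym_part (transpose_mat U * H * V1)) a;
         Q = cols_sub (skew_part (transpose_mat U * H * V1)) a;
         Ua = cols_sub U a
     in transpose_mat P * pinv (Sigma_mat Xb - \<nu> \<cdot>\<^sub>m 1\<^sub>m m) * P
        + transpose_mat Q * pinv (- Sigma_mat Xb - \<nu> \<cdot>\<^sub>m 1\<^sub>m m) * Q
        - (1 / (2 * \<nu>)) \<cdot>\<^sub>m
            (transpose_mat Ua * H * V2 * transpose_mat V2 * transpose_mat H * Ua))"

text \<open>The sum \<open>\<Sum>_{l \<le> r_0} tr(2 \<Omega>_{a_l})\<close> shared by both cases.\<close>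

definition Omega_trace_sum ::
  "real mat \<Rightarrow> real mat \<Rightarrow> real mat \<Rightarrow> real mat \<Rightarrow> real mat \<Rightarrow> nat set \<Rightarrow> real" where
  "Omega_trace_sum X U V Xb H \<alpha> = (\<Sum>l<block_count X \<alpha>.
      mat_tr (2 \<cdot>\<^sub>m Omega U V Xb H (sv_block X l) (common_value Xb (sv_block X l))))"

end

theory Submission
  imports Defs "Jordan_Normal_Form.Spectral_Radius"
begin

text \<open>
  The proof reduces everything to diagonal matrices and then exhibits the maximiser of
  \<open>\<langle>S, W\<rangle> - \<eta>\<close> over the second order set explicitly.

  A subgradient \<open>S\<close> of the Ky Fan norm \<open>F\<close> at \<open>X\<close> has the same singular vectors as \<open>X\<close>, and any
  singular value decomposition of \<open>X + S\<close> is simultaneously one of \<open>X\<close> and of \<open>S\<close>: the splitting of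
  \<open>X + S\<close> into \<open>X\<close> and a subgradient at \<open>X\<close> is unique because the subdifferential is monotone, so it
  inherits every symmetry of the diagonal form of \<open>X + S\<close> (\<open>simultaneous_svd\<close>). After rotating,
  \<open>X = D = Diag(\<sigma>)\<close>, \<open>S = Diag(u)\<close> and \<open>H\<close> becomes \<open>h = U\<^sup>T H V\<close>.

  Infinitesimal rotations of the rows and columns of \<open>D\<close> change it by \<open>K D + D G\<close> with \<open>K\<close>, \<open>G\<close> skew.
  They can be chosen so that \<open>h = B + K D + D G\<close> where \<open>B\<close> couples only equal singular values of \<open>D\<close>
  and is symmetric on the blocks with a positive value (\<open>block_rotation\<close>). For such \<open>B\<close> the singular
  values of \<open>D + t B\<close> are exactly affine in \<open>t\<close> for small \<open>t \<ge> 0\<close>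
  (\<open>sing_val_affine_along_block_direction\<close>). Orthogonal curves \<open>Q(t) = I + t K + t\<^sup>2 K\<^sup>2 / 2 + o(t\<^sup>2)\<close>
  and \<open>R(t)\<close>, similarly for \<open>G\<close>, turn \<open>D + t B\<close> into
  \<open>Q(t) (D + t B) R(t) = D + t h + t\<^sup>2 W0 / 2 + o(t\<^sup>2)\<close> without changing singular values.

  Two consequences determine the support function (\<open>ky_fan_second_derivative_bounds\<close>). Along
  \<open>W0\<close> the second derivative of \<open>F\<close> is zero. For every other \<open>W\<close>, pairing \<open>D + t h + t\<^sup>2 W / 2\<close> with
  the rotated subgradient \<open>Q(t) S R(t)\<close> shows that the second derivative is at least
  \<open>\<langle>S, W - W0\<rangle>\<close>; criticality of \<open>H\<close> makes the first order terms agree. Hence the supremum is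
  \<open>\<langle>S, W0\<rangle>\<close>, attained at \<open>(W0, 0)\<close>. Only the diagonal of \<open>W0\<close> enters, and a computation for one pair
  of indices at a time (\<open>rotation_pair_contribution\<close>) identifies it with twice the diagonals of the
  matrices \<open>\<Omega>\<close>, or, where \<open>\<sigma> = 0\<close>, of a product through the pseudoinverse of \<open>X\<close>. The weights \<open>u\<close> are 1
  above the block of the \<open>k\<close>-th singular value and 0 below it (\<open>subgradient_weights\<close>), so the
  entries above that block enter through traces, those in it with weights, and the others not at all.

  The second order set is defined by separate limits for the individual singular values, so these
  limits must exist. The difference quotients are bounded by the preceding expansion. They cannot
  oscillate either: a level \<open>c\<close> is hit where a polynomial in \<open>t\<close>, built from a characteristic
  polynomial, vanishes, so all but finitely many levels are hit only finitely often
  (\<open>second_order_limit_exists\<close>).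

  The definitions rest on characteristic polynomials; the bridge to matrix decompositions is the
  uniqueness and existence of singular value decompositions (\<open>sing_vals_unique\<close>, \<open>svd_exists\<close>),
  derived from the real spectral theorem.
\<close>

section \<open>Orthogonal matrices and the real spectral theorem\<close>

lemma mat_mult_sum:
  fixes A B :: "real mat"
  assumes "A \<in> carrier_mat p q" "B \<in> carrier_mat q r" "i < p" "j < r"
  shows "(A * B) $$ (i,j) = (\<Sum>k<q. A $$ (i,k) * B $$ (k,j))"
  using assms by (simp add: scalar_prod_def lessThan_atLeast0)

lemma orth_groupD:
  assumes "Q \<in> orth_group p"
  shows "Q \<in> carrier_mat p p" "transpose_mat Q * Q = 1\<^sub>m p" "Q * transpose_mat Q = 1\<^sub>m p"
proof -
  show 1: "Q \<in> carrier_mat p p" "transpose_mat Q * Q = 1\<^sub>m p"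
    using assms by (auto simp: orth_group_def)
  show "Q * transpose_mat Q = 1\<^sub>m p"
    by (rule mat_mult_left_right_inverse[OF _ 1(1) 1(2)]) (use 1 in auto)
qed

lemma orth_group_transpose:
  assumes "Q \<in> orth_group p"
  shows "transpose_mat Q \<in> orth_group p"
  using orth_groupD(1,3)[OF assms] by (simp add: orth_group_def)

lemma orth_group_mult:
  assumes "P \<in> orth_group p" "Q \<in> orth_group p"
  shows "P * Q \<in> orth_group p"
proof -
  note P = orth_groupD[OF assms(1)] and Q = orth_groupD[OF assms(2)]
  have "transpose_mat (P * Q) * (P * Q) = transpose_mat Q * transpose_mat P * (P * Q)"
    using P Q by (simp add: transpose_mult)
  also have "\<dots> = transpose_mat Q * (transpose_mat P * (P * Q))"
    using P(1) Q(1) by (intro assoc_mult_mat) auto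
  also have "transpose_mat P * (P * Q) = transpose_mat P * P * Q"
    using P(1) Q(1) by (intro assoc_mult_mat[symmetric]) auto
  finally show ?thesis using P Q by (simp add: orth_group_def)
qed

lemma orth_cancel:
  assumes "Q \<in> orth_group p" "A \<in> carrier_mat p q"
  shows "transpose_mat Q * (Q * A) = A" "Q * (transpose_mat Q * A) = A"
proof -
  note Q = orth_groupD[OF assms(1)]
  have "transpose_mat Q * (Q * A) = transpose_mat Q * Q * A"
    by (rule assoc_mult_mat[symmetric]) (use Q assms in auto)
  then show "transpose_mat Q * (Q * A) = A" using Q assms by simp
  have "Q * (transpose_mat Q * A) = Q * transpose_mat Q * A"
    by (rule assoc_mult_mat[symmetric]) (use Q assms in auto)
  then show "Q * (transpose_mat Q * A) = A" using Q assms by simp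
qed

lemma orth_cancel_right:
  assumes "Q \<in> orth_group p" "A \<in> carrier_mat q p"
  shows "A * transpose_mat Q * Q = A" "A * Q * transpose_mat Q = A"
  using assms orth_groupD[OF assms(1)] by (simp_all add: assoc_mult_mat[of A q p _ p _ p])

lemma orth_group_entries:
  "Q \<in> orth_group p \<longleftrightarrow> Q \<in> carrier_mat p p \<and>
     (\<forall>i<p. \<forall>j<p. (\<Sum>k<p. Q $$ (k,i) * Q $$ (k,j)) = (if i = j then 1 else 0))"
proof -
  have "transpose_mat Q * Q = 1\<^sub>m p \<longleftrightarrow>
     (\<forall>i<p. \<forall>j<p. (\<Sum>k<p. Q $$ (k,i) * Q $$ (k,j)) = (if i = j then 1 else 0))"
    if "Q \<in> carrier_mat p p"
    using that by (auto simp: mat_eq_iff scalar_prod_def lessThan_atLeast0)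
  then show ?thesis by (auto simp: orth_group_def)
qed

lemma orth_group_rows:
  assumes "Q \<in> orth_group p" "i < p" "j < p"
  shows "(\<Sum>k<p. Q $$ (i,k) * Q $$ (j,k)) = (if i = j then 1 else 0)"
  using orth_group_transpose[OF assms(1)] assms orth_groupD(1)[OF assms(1)]
  by (auto simp: orth_group_entries)

lemma exists_unit_multiple:
  fixes w :: "real vec"
  assumes w: "w \<in> carrier_vec p" "w \<noteq> 0\<^sub>v p"
  shows "\<exists>c. (c \<cdot>\<^sub>v w) \<bullet> (c \<cdot>\<^sub>v w) = 1"
proof -
  obtain i where i: "i < p" "w $ i \<noteq> 0"
  proof (rule ccontr)
    assume "\<not> thesis"
    then have "\<And>i. i < p \<Longrightarrow> w $ i = 0" using that by blast
    then have "w = 0\<^sub>v p" using w(1) by (intro eq_vecI) auto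
    then show False using w(2) by simp
  qed
  have "(\<Sum>j<p. w $ j * w $ j) > 0"
    by (rule sum_pos2[of _ i]) (use i in \<open>auto simp: zero_less_mult_iff\<close>)
  then have pos: "w \<bullet> w > 0" using w(1) by (simp add: scalar_prod_def lessThan_atLeast0)
  let ?c = "1 / sqrt (w \<bullet> w)"
  have "(?c \<cdot>\<^sub>v w) \<bullet> (?c \<cdot>\<^sub>v w) = ?c * (?c * (w \<bullet> w))"
    using w(1) by simp
  also have "\<dots> = (w \<bullet> w) / (sqrt (w \<bullet> w) * sqrt (w \<bullet> w))" by simp
  also have "sqrt (w \<bullet> w) * sqrt (w \<bullet> w) = w \<bullet> w"
    using pos by (intro real_sqrt_mult_self[THEN trans]) simp
  finally have "(?c \<cdot>\<^sub>v w) \<bullet> (?c \<cdot>\<^sub>v w) = 1" using pos by simp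
  then show ?thesis by blast
qed

text \<open>
  Stacking fewer than \<open>p\<close> vectors as the rows of a square matrix leaves a zero row, so this matrix is
  singular and its kernel contains the desired direction.
\<close>

lemma exists_orthogonal_vec:
  fixes f :: "nat \<Rightarrow> real vec"
  assumes "r < p" "\<And>l. l < r \<Longrightarrow> f l \<in> carrier_vec p"
  shows "\<exists>x \<in> carrier_vec p. x \<bullet> x = 1 \<and> (\<forall>l<r. f l \<bullet> x = 0)"
proof -
  define M where "M = mat p p (\<lambda>(i,j). if i < r then f i $ j else 0)"
  have M: "M \<in> carrier_mat p p" by (simp add: M_def)
  have "transpose_mat M *\<^sub>v unit_vec p r = 0\<^sub>v p"
    by (rule eq_vecI) (use assms(1) in \<open>auto simp: M_def scalar_prod_def unit_vec_def if_distrib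
      intro!: sum.neutral\<close>)
  then have "det (transpose_mat M) = 0"
    using M assms(1) by (subst det_0_iff_vec_prod_zero[of _ p]) (auto intro!: exI[of _ "unit_vec p r"])
  then have "det M = 0" using M by (simp add: det_transpose)
  then obtain x where x: "x \<in> carrier_vec p" "x \<noteq> 0\<^sub>v p" "M *\<^sub>v x = 0\<^sub>v p"
    using M by (auto simp: det_0_iff_vec_prod_zero)
  have orth: "f l \<bullet> x = 0" if "l < r" for l
  proof -
    have "row M l = f l"
      using that assms(1) carrier_vecD[OF assms(2)[OF that]] by (intro eq_vecI) (auto simp: M_def)
    moreover have "(M *\<^sub>v x) $ l = 0" using x that assms by simp
    ultimately show ?thesis using M that assms by simp
  qed
  obtain c where c: "(c \<cdot>\<^sub>v x) \<bullet> (c \<cdot>\<^sub>v x) = 1" using exists_unit_multiple[OF x(1,2)] by blast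
  show ?thesis
  proof (rule bexI[of _ "c \<cdot>\<^sub>v x"], intro conjI allI impI)
    show "f l \<bullet> (c \<cdot>\<^sub>v x) = 0" if "l < r" for l
      using assms(2)[OF that] x orth[OF that] by simp
  qed (use x c in simp_all)
qed

lemma orthonormal_extend:
  fixes f :: "nat \<Rightarrow> real vec"
  assumes "r \<le> p" "\<And>l. l < r \<Longrightarrow> f l \<in> carrier_vec p"
    and "\<And>i j. i < r \<Longrightarrow> j < r \<Longrightarrow> f i \<bullet> f j = (if i = j then 1 else 0)"
  shows "\<exists>Q \<in> orth_group p. \<forall>l<r. col Q l = f l"
  using assms
proof (induction "p - r" arbitrary: r f)
  case 0
  then have r: "r = p" by simp
  let ?Q = "mat p p (\<lambda>(i,j). f j $ i)"
  have "(\<Sum>k<p. f i $ k * f j $ k) = (if i = j then 1 else 0)" if "i < p" "j < p" for i j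
    using 0(4)[of i j] 0(3)[of j] that r by (simp add: scalar_prod_def lessThan_atLeast0)
  then have "?Q \<in> orth_group p" by (simp add: orth_group_entries)
  moreover have "col ?Q l = f l" if "l < r" for l
    using that r carrier_vecD[OF 0(3)[OF that]] by (intro eq_vecI) auto
  ultimately show ?case by blast
next
  case (Suc d)
  then have "r < p" by simp
  then obtain x where x: "x \<in> carrier_vec p" "x \<bullet> x = 1" "\<And>l. l < r \<Longrightarrow> f l \<bullet> x = 0"
    using exists_orthogonal_vec[of r p f] Suc(4) by blast
  let ?g = "f(r := x)"
  have "\<exists>Q \<in> orth_group p. \<forall>l<Suc r. col Q l = ?g l"
  proof (rule Suc(1))
    show "d = p - Suc r" "Suc r \<le> p" using Suc(2) \<open>r < p\<close> by auto
    show "?g l \<in> carrier_vec p" if "l < Suc r" for l using x Suc(4) that by (auto simp: less_Suc_eq)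
    have "x \<bullet> f l = 0" if "l < r" for l
      using x(3)[OF that] comm_scalar_prod[OF x(1) Suc(4)[OF that]] by simp
    then show "?g i \<bullet> ?g j = (if i = j then 1 else 0)" if "i < Suc r" "j < Suc r" for i j
      using x Suc(5) that by (auto simp: less_Suc_eq)
  qed
  then show ?case by (metis fun_upd_other less_SucI less_irrefl_nat)
qed

text \<open>
  A complex eigenvector \<open>x + i y\<close> exists because the spectrum is nonempty. Comparing \<open>\<langle>y, A x\<rangle>\<close> with
  \<open>\<langle>x, A y\<rangle>\<close> forces the imaginary part of the eigenvalue to vanish, and then \<open>x\<close> and \<open>y\<close> both satisfy
  the eigenvalue equation over the reals.
\<close>

lemma symmetric_real_eigenvector:
  fixes A :: "real mat"
  assumes A: "A \<in> carrier_mat n n" and sym: "transpose_mat A = A" and n: "n > 0"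
  shows "\<exists>x \<in> carrier_vec n. \<exists>a. x \<noteq> 0\<^sub>v n \<and> A *\<^sub>v x = a \<cdot>\<^sub>v x"
proof -
  let ?C = "map_mat complex_of_real A"
  have C: "?C \<in> carrier_mat n n" using A by simp
  from spectrum_non_empty[OF C n] obtain z where "eigenvalue ?C z"
    by (auto simp: spectrum_def)
  then obtain v where v: "v \<in> carrier_vec n" "v \<noteq> 0\<^sub>v n" "?C *\<^sub>v v = z \<cdot>\<^sub>v v"
    using A by (auto simp: eigenvalue_def eigenvector_def)
  define a b where "a = Re z" and "b = Im z"
  define x y where "x i = Re (v $ i)" and "y i = Im (v $ i)" for i
  have ev: "(\<Sum>j<n. complex_of_real (A $$ (i,j)) * v $ j) = z * v $ i" if "i < n" for i
  proof -
    have "(?C *\<^sub>v v) $ i = z * v $ i" using v(1) that unfolding v(3) by simp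
    then show ?thesis using A v(1) that by (simp add: scalar_prod_def lessThan_atLeast0)
  qed
  have Ax: "(\<Sum>j<n. A $$ (i,j) * x j) = a * x i - b * y i" if "i < n" for i
    using arg_cong[OF ev[OF that], of Re] by (simp add: x_def y_def a_def b_def)
  have Ay: "(\<Sum>j<n. A $$ (i,j) * y j) = b * x i + a * y i" if "i < n" for i
    using arg_cong[OF ev[OF that], of Im] by (simp add: x_def y_def a_def b_def)
  have symE: "A $$ (i,j) = A $$ (j,i)" if "i < n" "j < n" for i j
    using arg_cong[OF sym, of "\<lambda>M. M $$ (i,j)"] that A by simp
  have "(\<Sum>i<n. y i * (\<Sum>j<n. A $$ (i,j) * x j)) = (\<Sum>i<n. \<Sum>j<n. y i * (A $$ (i,j) * x j))"
    by (simp add: sum_distrib_left)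
  also have "\<dots> = (\<Sum>j<n. \<Sum>i<n. y i * (A $$ (i,j) * x j))" by (rule sum.swap)
  also have "\<dots> = (\<Sum>j<n. x j * (\<Sum>i<n. A $$ (j,i) * y i))"
    using symE by (simp add: sum_distrib_left mult_ac)
  finally have "(\<Sum>i<n. y i * (a * x i - b * y i)) = (\<Sum>i<n. x i * (b * x i + a * y i))"
    by (simp add: Ax Ay)
  then have "(\<Sum>i<n. x i * (b * x i + a * y i) - y i * (a * x i - b * y i)) = 0"
    by (simp add: sum_subtractf)
  also have "(\<Sum>i<n. x i * (b * x i + a * y i) - y i * (a * x i - b * y i))
     = b * (\<Sum>i<n. x i * x i + y i * y i)"
    by (simp add: sum_distrib_left algebra_simps)
  finally have bz: "b * (\<Sum>i<n. x i * x i + y i * y i) = 0" .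
  obtain i where i: "i < n" "v $ i \<noteq> 0"
  proof (rule ccontr)
    assume "\<not> thesis"
    then have "\<And>i. i < n \<Longrightarrow> v $ i = 0" using that by blast
    then have "v = 0\<^sub>v n" using v(1) by (intro eq_vecI) auto
    then show False using v by simp
  qed
  then have xy: "x i \<noteq> 0 \<or> y i \<noteq> 0" by (auto simp: x_def y_def complex_eq_iff)
  then have "x i * x i + y i * y i > 0" using sum_squares_gt_zero_iff by blast
  then have "(\<Sum>i<n. x i * x i + y i * y i) > 0"
    using i(1) by (intro sum_pos2[of _ i]) auto
  then have b: "b = 0" using bz by simp
  have *: "\<exists>x \<in> carrier_vec n. \<exists>a. x \<noteq> 0\<^sub>v n \<and> A *\<^sub>v x = a \<cdot>\<^sub>v x"
    if "\<And>i. i < n \<Longrightarrow> (\<Sum>j<n. A $$ (i,j) * w j) = a * w i" "w i \<noteq> 0" for w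
  proof (intro bexI[of _ "vec n w"] exI conjI)
    show "vec n w \<noteq> 0\<^sub>v n" using that(2) i(1) by (metis index_vec index_zero_vec(1))
    show "A *\<^sub>v vec n w = a \<cdot>\<^sub>v vec n w"
      using A that(1) by (intro eq_vecI) (auto simp: scalar_prod_def lessThan_atLeast0)
  qed simp
  show ?thesis using xy *[of x] *[of y] Ax Ay b by auto
qed

text \<open>
  Deflation: an orthogonal matrix whose first column is a unit eigenvector splits off a \<open>1 \<times> 1\<close> block,
  and symmetry makes the coupling to the remaining block vanish.
\<close>

lemma real_spectral_theorem:
  fixes A :: "real mat"
  assumes "A \<in> carrier_mat n n" "transpose_mat A = A"
  shows "\<exists>Q \<in> orth_group n. \<exists>d. transpose_mat Q * A * Q = mat_diag n d"
  using assms
proof (induction n arbitrary: A)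
  case 0
  then show ?case
    by (intro bexI[of _ "1\<^sub>m 0"] exI[of _ "\<lambda>_. 0"] eq_matI) (auto simp: orth_group_def mat_diag_def)
next
  case (Suc n)
  note A = Suc(2) and sym = Suc(3)
  obtain w a where w: "w \<in> carrier_vec (Suc n)" "w \<noteq> 0\<^sub>v (Suc n)" "A *\<^sub>v w = a \<cdot>\<^sub>v w"
    using symmetric_real_eigenvector[OF A sym] by auto
  obtain c where c: "(c \<cdot>\<^sub>v w) \<bullet> (c \<cdot>\<^sub>v w) = 1" using exists_unit_multiple[OF w(1,2)] by blast
  define x where "x = c \<cdot>\<^sub>v w"
  have x: "x \<in> carrier_vec (Suc n)" using w(1) by (simp add: x_def)
  have x1: "x \<bullet> x = 1" using c by (simp add: x_def)
  have Ax: "A *\<^sub>v x = a \<cdot>\<^sub>v x"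
    using A w(1) unfolding x_def
    by (subst mult_mat_vec[of _ "Suc n" "Suc n"]) (auto simp: w(3) smult_smult_assoc mult.commute)
  obtain P where P: "P \<in> orth_group (Suc n)" "col P 0 = x"
    using orthonormal_extend[of 1 "Suc n" "\<lambda>_. x"] x x1 by auto
  note P' = orth_groupD[OF P(1)]
  define B where "B = transpose_mat P * A * P"
  have B: "B \<in> carrier_mat (Suc n) (Suc n)" using P' A by (simp add: B_def)
  have symB: "transpose_mat B = B"
    using P' A sym by (simp add: B_def transpose_mult[of _ "Suc n" "Suc n" _ "Suc n"]
        assoc_mult_mat[of _ "Suc n" "Suc n" _ "Suc n" _ "Suc n"])
  have symBE: "B $$ (i,j) = B $$ (j,i)" if "i < Suc n" "j < Suc n" for i j
    using arg_cong[OF symB, of "\<lambda>M. M $$ (i,j)"] that B by simp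
  have Bcol: "B $$ (i,0) = (if i = 0 then a else 0)" if "i < Suc n" for i
  proof -
    have "B $$ (i,0) = (transpose_mat P * (A * P)) $$ (i,0)"
      using P' A by (simp add: B_def assoc_mult_mat[of _ "Suc n" "Suc n" _ "Suc n" _ "Suc n"])
    also have "\<dots> = col P i \<bullet> col (A * P) 0"
      using P' A that by simp
    also have "col (A * P) 0 = A *\<^sub>v col P 0"
      using P' A by (intro col_mult2) auto
    also have "\<dots> = a \<cdot>\<^sub>v col P 0" by (simp add: P Ax)
    also have "col P i \<bullet> (a \<cdot>\<^sub>v col P 0) = a * (col P i \<bullet> col P 0)"
      using P' that by (intro scalar_prod_smult_right) auto
    also have "col P i \<bullet> col P 0 = (transpose_mat P * P) $$ (i,0)"
      using P'(1) that by simp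
    finally show ?thesis unfolding P'(2) using that by simp
  qed
  define C where "C = mat n n (\<lambda>(i,j). B $$ (Suc i, Suc j))"
  have C: "C \<in> carrier_mat n n" by (simp add: C_def)
  have "transpose_mat C = C" by (rule eq_matI) (auto simp: C_def symBE)
  then obtain Q d where Q: "Q \<in> orth_group n" "transpose_mat Q * C * Q = mat_diag n d"
    using Suc(1)[OF C] by blast
  note Q' = orth_groupD[OF Q(1)]
  define R where "R = four_block_mat (1\<^sub>m 1) (0\<^sub>m 1 n) (0\<^sub>m n 1) Q"
  have Rt: "transpose_mat R = four_block_mat (1\<^sub>m 1) (0\<^sub>m 1 n) (0\<^sub>m n 1) (transpose_mat Q)"
    unfolding R_def using Q'(1) by (subst transpose_four_block_mat) auto
  have R: "R \<in> orth_group (Suc n)"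
  proof -
    have "transpose_mat R * R = four_block_mat (1\<^sub>m 1) (0\<^sub>m 1 n) (0\<^sub>m n 1) (1\<^sub>m n)"
      unfolding Rt unfolding R_def using Q'
      by (subst mult_four_block_mat[of _ 1 1 _ n _ n _ _ 1 _ n]) auto
    also have "\<dots> = 1\<^sub>m (Suc n)" by (subst four_block_one_mat) simp
    finally have "transpose_mat R * R = 1\<^sub>m (Suc n)" .
    moreover have "R \<in> carrier_mat (1 + n) (1 + n)"
      unfolding R_def using Q'(1) by (intro four_block_carrier_mat) auto
    ultimately show ?thesis by (simp add: orth_group_def)
  qed
  have Bblock: "B = four_block_mat (a \<cdot>\<^sub>m 1\<^sub>m 1) (0\<^sub>m 1 n) (0\<^sub>m n 1) C"
    using B C Bcol symBE[of 0] by (intro eq_matI) (auto simp: C_def)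
  have "transpose_mat R * B * R = four_block_mat (a \<cdot>\<^sub>m 1\<^sub>m 1) (0\<^sub>m 1 n) (0\<^sub>m n 1) (mat_diag n d)"
    unfolding Rt Bblock unfolding R_def
    using Q'(1) C
    by (subst mult_four_block_mat[of _ 1 1 _ n _ n _ _ 1 _ n] |
        simp add: Q(2) left_add_zero_mat[of _ 1 1])+
  also have "\<dots> = mat_diag (Suc n) (\<lambda>i. if i = 0 then a else d (i - 1))"
    by (rule eq_matI) (auto simp: mat_diag_def)
  finally have D: "transpose_mat R * B * R = mat_diag (Suc n) (\<lambda>i. if i = 0 then a else d (i - 1))" .
  have "transpose_mat (P * R) * A * (P * R) = transpose_mat R * B * R"
    using P' orth_groupD[OF R] A unfolding B_def
    by (simp add: transpose_mult[of _ "Suc n" "Suc n" _ "Suc n"]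
        assoc_mult_mat[of _ "Suc n" "Suc n" _ "Suc n" _ "Suc n"])
  then show ?case using D orth_group_mult[OF P(1) R] by auto
qed

lemma exists_decreasing_permutation:
  fixes d :: "nat \<Rightarrow> real"
  shows "\<exists>p. bij_betw p {..<n} {..<n} \<and> (\<forall>i j. i \<le> j \<longrightarrow> j < n \<longrightarrow> d (p j) \<le> d (p i))"
proof -
  define xs where "xs = sort_key (\<lambda>i. - d i) [0..<n]"
  have xs: "distinct xs" "set xs = {..<n}" "length xs = n" by (auto simp: xs_def)
  have "sorted (map (\<lambda>i. - d i) xs)" unfolding xs_def by simp
  then have "d (xs ! j) \<le> d (xs ! i)" if "i \<le> j" "j < n" for i j
    using sorted_nth_mono[of "map (\<lambda>i. - d i) xs" i j] that xs(3) by auto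
  moreover have "bij_betw ((!) xs) {..<n} {..<n}"
    by (rule bij_betw_nth[OF xs(1)]) (simp_all only: xs(2,3))
  ultimately show ?thesis by blast
qed

lemma decreasing_spectral_theorem:
  fixes A :: "real mat"
  assumes A: "A \<in> carrier_mat n n" and sym: "transpose_mat A = A"
  shows "\<exists>Q \<in> orth_group n. \<exists>d. transpose_mat Q * A * Q = mat_diag n d
    \<and> (\<forall>i j. i \<le> j \<longrightarrow> j < n \<longrightarrow> d j \<le> d i)"
proof -
  obtain Q d where Q: "Q \<in> orth_group n" "transpose_mat Q * A * Q = mat_diag n d"
    using real_spectral_theorem[OF assms] by blast
  note Q' = orth_groupD[OF Q(1)]
  obtain p where p: "bij_betw p {..<n} {..<n}" "\<And>i j. i \<le> j \<Longrightarrow> j < n \<Longrightarrow> d (p j) \<le> d (p i)"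
    using exists_decreasing_permutation[of n d] by blast
  have pn: "p i < n" if "i < n" for i using p(1) that by (auto simp: bij_betw_def)
  have inj: "p i = p j \<longleftrightarrow> i = j" if "i < n" "j < n" for i j
    using p(1) that by (auto simp: bij_betw_def inj_on_def)
  define R where "R = mat n n (\<lambda>(i,j). Q $$ (i, p j))"
  have R: "R \<in> orth_group n"
    using Q(1) pn inj by (auto simp: orth_group_entries R_def)
  have "col R j = col Q (p j)" if "j < n" for j
    using that pn Q' by (intro eq_vecI) (auto simp: R_def)
  then have "(transpose_mat R * A * R) $$ (i,j) = (transpose_mat Q * A * Q) $$ (p i, p j)"
    if "i < n" "j < n" for i j
  proof -
    have "(transpose_mat M * A * M) $$ (i,j) = col M i \<bullet> (A *\<^sub>v col M j)"
      if "i < n" "j < n" "M \<in> carrier_mat n n" for M i j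
    proof -
      have "(transpose_mat M * A * M) $$ (i,j) = (transpose_mat M * (A * M)) $$ (i,j)"
        using that A by (simp add: assoc_mult_mat[of _ n n _ n _ n])
      also have "\<dots> = col M i \<bullet> col (A * M) j" using that A by simp
      finally show ?thesis by (simp only: col_mult2[OF A that(3,2)])
    qed
    from this[of i j R] this[of "p i" "p j" Q] show ?thesis
      using that pn Q' orth_groupD(1)[OF R] \<open>\<And>j. j < n \<Longrightarrow> col R j = col Q (p j)\<close>
      by (simp del: index_mult_mat)
  qed
  then have "transpose_mat R * A * R = mat_diag n (d \<circ> p)"
    unfolding Q(2) using pn inj A by (intro eq_matI) (auto simp: R_def mat_diag_def)
  then show ?thesis using R p(2) by (intro bexI[of _ R] exI[of _ "d \<circ> p"]) auto
qed

section \<open>Rectangular diagonal matrices and the singular value decomposition\<close>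

definition rect_diag :: "nat \<Rightarrow> nat \<Rightarrow> (nat \<Rightarrow> real) \<Rightarrow> real mat" where
  "rect_diag m n s = mat m n (\<lambda>(i, j). if i = j then s i else 0)"

lemma rect_diag_carrier [simp]: "rect_diag m n s \<in> carrier_mat m n"
  "dim_row (rect_diag m n s) = m" "dim_col (rect_diag m n s) = n"
  by (simp_all add: rect_diag_def)

lemma rect_diag_index [simp]:
  "i < m \<Longrightarrow> j < n \<Longrightarrow> rect_diag m n s $$ (i, j) = (if i = j then s i else 0)"
  by (simp add: rect_diag_def)

lemma mult_rect_diag_index:
  assumes "P \<in> carrier_mat p m" "i < p" "j < n"
  shows "(P * rect_diag m n s) $$ (i,j) = (if j < m then P $$ (i,j) * s j else 0)"
proof -
  have "(P * rect_diag m n s) $$ (i,j) = (\<Sum>l<m. P $$ (i,l) * (if l = j then s l else 0))"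
    using assms by (simp add: scalar_prod_def lessThan_atLeast0)
  also have "\<dots> = (\<Sum>l<m. if l = j then P $$ (i,l) * s l else 0)" by (intro sum.cong) auto
  finally show ?thesis by simp
qed

lemma rect_diag_mult_index:
  assumes "P \<in> carrier_mat n p" "i < m" "j < p" "m \<le> n"
  shows "(rect_diag m n s * P) $$ (i,j) = s i * P $$ (i,j)"
proof -
  have "(rect_diag m n s * P) $$ (i,j) = (\<Sum>l<n. (if i = l then s i else 0) * P $$ (l,j))"
    using assms by (simp add: scalar_prod_def lessThan_atLeast0)
  also have "\<dots> = (\<Sum>l<n. if i = l then s i * P $$ (l,j) else 0)" by (intro sum.cong) auto
  finally show ?thesis using assms by simp
qed

lemma rect_diag_transpose_mult:
  assumes "m \<le> n"
  shows "rect_diag m n a * transpose_mat (rect_diag m n b) = mat_diag m (\<lambda>i. a i * b i)"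
    and "transpose_mat (rect_diag m n b) * rect_diag m n a = mat_diag n (\<lambda>i. if i < m then a i * b i else 0)"
proof -
  show "rect_diag m n a * transpose_mat (rect_diag m n b) = mat_diag m (\<lambda>i. a i * b i)"
  proof (rule eq_matI)
    fix i j assume "i < dim_row (mat_diag m (\<lambda>i. a i * b i))" "j < dim_col (mat_diag m (\<lambda>i. a i * b i))"
    then have ij: "i < m" "j < m" "j < n" "i < n" using assms by (auto simp: mat_diag_def)
    show "(rect_diag m n a * transpose_mat (rect_diag m n b)) $$ (i,j) = mat_diag m (\<lambda>i. a i * b i) $$ (i,j)"
      using rect_diag_mult_index[of "transpose_mat (rect_diag m n b)" n m i m j a] ij assms
      by (auto simp: mat_diag_def simp del: index_mult_mat(1))
  qed (auto simp: mat_diag_def)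
  show "transpose_mat (rect_diag m n b) * rect_diag m n a = mat_diag n (\<lambda>i. if i < m then a i * b i else 0)"
  proof (rule eq_matI)
    fix i j assume "i < dim_row (mat_diag n (\<lambda>i. if i < m then a i * b i else 0))"
      "j < dim_col (mat_diag n (\<lambda>i. if i < m then a i * b i else 0))"
    then have ij: "i < n" "j < n" by (auto simp: mat_diag_def)
    show "(transpose_mat (rect_diag m n b) * rect_diag m n a) $$ (i,j) = mat_diag n (\<lambda>i. if i < m then a i * b i else 0) $$ (i,j)"
      using mult_rect_diag_index[of "transpose_mat (rect_diag m n b)" n m i j n a] ij
      by (auto simp: mat_diag_def simp del: index_mult_mat(1))
  qed (auto simp: mat_diag_def)
qed

text \<open>
  The monotonicity is only required below \<open>m\<close>, because \<open>sing_val\<close> is arbitrary beyond the number of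
  rows.
\<close>

definition decreasing_nonneg :: "nat \<Rightarrow> (nat \<Rightarrow> real) \<Rightarrow> bool" where
  "decreasing_nonneg m s \<longleftrightarrow> (\<forall>i j. i \<le> j \<longrightarrow> j < m \<longrightarrow> s j \<le> s i) \<and> (\<forall>i<m. 0 \<le> s i)"

text \<open>
  The Gram matrix is orthogonally similar to the diagonal matrix of squares.
\<close>

lemma gram_char_poly:
  fixes s :: "nat \<Rightarrow> real"
  assumes mn: "m \<le> n" and U: "U \<in> orth_group m" and V: "V \<in> orth_group n"
    and Z: "Z = U * rect_diag m n s * transpose_mat V"
  shows "char_poly (Z * transpose_mat Z) = (\<Prod>i\<leftarrow>[0..<m]. [:- (s i * s i), 1:])"
  unfolding Z
proof -
  let ?D = "rect_diag m n s" and ?Z = "U * rect_diag m n s * transpose_mat V"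
  note U' = orth_groupD[OF U] and V' = orth_groupD[OF V]
  have Zt: "transpose_mat ?Z = V * (transpose_mat ?D * transpose_mat U)"
    using U' V' by (simp add: transpose_mult[of _ m n _ n] transpose_mult[of _ m m _ n])
  have "?Z * transpose_mat ?Z = U * ?D * (transpose_mat V * (V * (transpose_mat ?D * transpose_mat U)))"
    unfolding Zt using U'(1) V'(1) by (intro assoc_mult_mat[of _ m n _ n _ m]) auto
  also have "transpose_mat V * (V * (transpose_mat ?D * transpose_mat U)) = transpose_mat ?D * transpose_mat U"
    by (rule orth_cancel[OF V, of _ m]) (use U' in auto)
  also have "U * ?D * (transpose_mat ?D * transpose_mat U) = U * (?D * (transpose_mat ?D * transpose_mat U))"
    using U' by (intro assoc_mult_mat) auto
  also have "?D * (transpose_mat ?D * transpose_mat U) = ?D * transpose_mat ?D * transpose_mat U"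
    using U' by (intro assoc_mult_mat[symmetric]) auto
  also have "U * (?D * transpose_mat ?D * transpose_mat U) = U * mat_diag m (\<lambda>i. s i * s i) * transpose_mat U"
    unfolding rect_diag_transpose_mult(1)[OF mn] using U' by (intro assoc_mult_mat[symmetric]) auto
  finally have ZZ: "?Z * transpose_mat ?Z = U * mat_diag m (\<lambda>i. s i * s i) * transpose_mat U" .
  have "similar_mat (?Z * transpose_mat ?Z) (mat_diag m (\<lambda>i. s i * s i))"
    unfolding ZZ similar_mat_def similar_mat_wit_def
    using U' by (intro exI[of _ U] exI[of _ "transpose_mat U"]) (auto simp: Let_def)
  then have "char_poly (?Z * transpose_mat ?Z) = char_poly (mat_diag m (\<lambda>i. s i * s i))"
    by (rule char_poly_similar)
  also have "\<dots> = (\<Prod>a\<leftarrow>diag_mat (mat_diag m (\<lambda>i. s i * s i)). [:- a, 1:])"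
    by (rule char_poly_upper_triangular[of _ m]) (auto simp: mat_diag_def upper_triangular_def)
  also have "diag_mat (mat_diag m (\<lambda>i. s i * s i)) = map (\<lambda>i. s i * s i) [0..<m]"
    by (auto simp: diag_mat_def mat_diag_def)
  finally show "char_poly (?Z * transpose_mat ?Z) = (\<Prod>i\<leftarrow>[0..<m]. [:- (s i * s i), 1:])"
    by (simp add: o_def)
qed

theorem sing_vals_unique:
  assumes mn: "m \<le> n" and U: "U \<in> orth_group m" and V: "V \<in> orth_group n"
    and s: "decreasing_nonneg m s"
  shows "sing_vals (U * rect_diag m n s * transpose_mat V) = map s [0..<m]"
proof -
  let ?Z = "U * rect_diag m n s * transpose_mat V"
  note cp = gram_char_poly[OF mn U V refl, of s]
  have "proots (\<Prod>i\<leftarrow>is. [:- (s i * s i), 1:]) = mset (map (\<lambda>i. s i * s i) is)" for "is" :: "nat list"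
  proof (induction "is")
    case (Cons i "is")
    have nz: "(\<Prod>i\<leftarrow>is. [:- (s i * s i), 1:]) \<noteq> 0" by (induction "is") (simp_all only: list.map prod_list.Nil prod_list.Cons mult_eq_0_iff, auto)
    show ?case
      unfolding list.map prod_list.Cons by (subst proots_mult) (use nz Cons in auto)
  qed simp
  then have "image_mset sqrt (proots (char_poly (?Z * transpose_mat ?Z)))
      = image_mset sqrt (mset (map (\<lambda>i. s i * s i) [0..<m]))"
    unfolding cp by simp
  also have "\<dots> = mset (map s [0..<m])"
    using s by (auto simp: decreasing_nonneg_def multiset.map_comp o_def intro!: image_mset_cong)
  also have "\<dots> = mset (rev (map s [0..<m]))" by simp
  finally have "sing_vals ?Z = rev (sort (rev (map s [0..<m])))"
    by (simp only: sing_vals_def sorted_list_of_multiset_mset)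
  moreover have "sorted (rev (map s [0..<m]))"
    using s by (auto simp: sorted_iff_nth_mono rev_nth decreasing_nonneg_def)
  ultimately show ?thesis by (simp only: sorted_sort_id rev_rev_ident)
qed

corollary sing_val_unique:
  assumes "m \<le> n" "U \<in> orth_group m" "V \<in> orth_group n" "decreasing_nonneg m s" "i < m"
  shows "sing_val (U * rect_diag m n s * transpose_mat V) i = s i"
  using sing_vals_unique[OF assms(1-4)] assms(5) by (simp add: sing_val_def)

text \<open>
  The rows of \<open>U\<^sup>T Z\<close>, with \<open>U\<close> diagonalising \<open>Z Z\<^sup>T\<close>, are pairwise orthogonal. Because the eigenvalues
  decrease, the nonzero rows come first; normalised, they are the first columns of \<open>V\<close>.
\<close>

theorem svd_exists:
  assumes mn: "m \<le> n" and Z: "Z \<in> carrier_mat m n"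
  shows "\<exists>U \<in> orth_group m. \<exists>V \<in> orth_group n. Z = U * rect_diag m n (sing_val Z) * transpose_mat V
    \<and> decreasing_nonneg m (sing_val Z)"
proof -
  have "Z * transpose_mat Z \<in> carrier_mat m m" "transpose_mat (Z * transpose_mat Z) = Z * transpose_mat Z"
    using Z by (simp_all add: transpose_mult[of _ m n _ m])
  from decreasing_spectral_theorem[OF this] obtain U d where U: "U \<in> orth_group m"
    and UZ: "transpose_mat U * (Z * transpose_mat Z) * U = mat_diag m d"
    and dec: "\<And>i j. i \<le> j \<Longrightarrow> j < m \<Longrightarrow> d j \<le> d i" by blast
  note U' = orth_groupD[OF U]
  define Y where "Y = transpose_mat U * Z"
  have Y: "Y \<in> carrier_mat m n" using U' Z by (simp add: Y_def)
  have "Y * transpose_mat Y = mat_diag m d"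
    unfolding UZ[symmetric] Y_def using U' Z
    by (simp add: transpose_mult[of _ m m _ n] assoc_mult_mat[of _ m m _ n _ m]
       assoc_mult_mat[of _ m m _ m _ m] assoc_mult_mat[of _ m n _ m _ m])
  then have YY: "(Y * transpose_mat Y) $$ (i,j) = mat_diag m d $$ (i,j)" for i j by simp
  have rows: "row Y i \<bullet> row Y j = (if i = j then d i else 0)" if "i < m" "j < m" for i j
    using YY[of i j] that Y by (simp add: mat_diag_def)
  have dnn: "0 \<le> d i" if "i < m" for i
    
  proof -
    have "d i = row Y i \<bullet> row Y i" using rows[OF that that] by simp
    also have "\<dots> \<ge> 0" unfolding scalar_prod_def by (intro sum_nonneg) simp
    finally show ?thesis .
  qed
  \<comment> \<open>\<open>r\<close> is the rank, so that the rows below \<open>r\<close> are the nonzero ones.\<close>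
  define r where "r = card {i. i < m \<and> d i > 0}"
  have rdef: "d i > 0 \<longleftrightarrow> i < r" if "i < m" for i
  proof
    assume "d i > 0"
    then have "{..i} \<subseteq> {i. i < m \<and> d i > 0}" using dec[of _ i] that by (auto intro: less_le_trans)
    then have "card {..i} \<le> r" unfolding r_def by (intro card_mono) auto
    then show "i < r" by simp
  next
    assume "i < r"
    show "d i > 0"
    proof (rule ccontr)
      assume "\<not> d i > 0"
      have "{i. i < m \<and> d i > 0} \<subseteq> {..<i}"
      proof
        fix j assume "j \<in> {i. i < m \<and> d i > 0}"
        then show "j \<in> {..<i}" using dec[of i j] \<open>\<not> d i > 0\<close> by (cases "i \<le> j") auto
      qed
      then have "r \<le> card {..<i}" unfolding r_def by (intro card_mono) auto
      with \<open>i < r\<close> show False by simp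
    qed
  qed
  have rm: "r \<le> m" unfolding r_def using card_mono[of "{..<m}" "{i. i < m \<and> d i > 0}"] by auto
  let ?f = "\<lambda>l. (1 / sqrt (d l)) \<cdot>\<^sub>v row Y l"
  have "\<exists>V \<in> orth_group n. \<forall>l<r. col V l = ?f l"
  proof (rule orthonormal_extend)
    show "r \<le> n" using rm mn by simp
    show "?f l \<in> carrier_vec n" if "l < r" for l using Y row_carrier[of Y l] by simp
    show "?f i \<bullet> ?f j = (if i = j then 1 else 0)" if "i < r" "j < r" for i j
      using rows[of i j] that rm rdef[of i] Y by (auto simp: field_simps)
  qed
  then obtain V where V: "V \<in> orth_group n" "\<And>l. l < r \<Longrightarrow> col V l = ?f l" by blast
  note V' = orth_groupD[OF V(1)]
  let ?s = "\<lambda>i. sqrt (d i)"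
  have "Y * V = rect_diag m n ?s"
  proof (rule eq_matI)
    fix i j assume "i < dim_row (rect_diag m n ?s)" "j < dim_col (rect_diag m n ?s)"
    then have ij: "i < m" "j < n" by auto
    have "(Y * V) $$ (i,j) = row Y i \<bullet> col V j" using ij Y V' by simp
    also have "\<dots> = (if i = j then ?s i else 0)"
    proof (cases "d i > 0")
      case True
      then have ir: "i < r" using rdef ij by simp
      have "row Y i = ?s i \<cdot>\<^sub>v col V i"
        using V(2)[OF ir] True by (simp add: smult_smult_assoc)
      then have "row Y i \<bullet> col V j = ?s i * (col V i \<bullet> col V j)"
        using V' ij mn by (simp add: smult_scalar_prod_distrib[of _ n])
      also have "col V i \<bullet> col V j = (transpose_mat V * V) $$ (i,j)"
        using V'(1) ij mn by simp
      finally show ?thesis unfolding V'(2) using ij mn by simp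
    next
      case False
      then have d0: "d i = 0" using dnn ij by force
      have "row Y i \<bullet> row Y i = 0" using rows[of i i] d0 ij by simp
      then have "(\<Sum>l<n. Y $$ (i,l) * Y $$ (i,l)) = 0"
        using Y ij by (simp add: scalar_prod_def lessThan_atLeast0)
      then have "Y $$ (i,l) = 0" if "l < n" for l
        using that by (subst (asm) sum_nonneg_eq_0_iff) auto
      then show ?thesis using d0 Y V' ij by (auto simp: scalar_prod_def)
    qed
    finally show "(Y * V) $$ (i,j) = rect_diag m n ?s $$ (i,j)" using ij by simp
  qed (use Y V' in auto)
  then have "U * rect_diag m n ?s * transpose_mat V = U * (Y * V) * transpose_mat V" by simp
  also have "U * (Y * V) * transpose_mat V = U * (Y * V * transpose_mat V)"
    using U' V' Y by (intro assoc_mult_mat) auto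
  also have "\<dots> = Z" using orth_cancel_right[OF V(1) Y] orth_cancel[OF U Z] by (simp add: Y_def)
  finally have ZD: "Z = U * rect_diag m n ?s * transpose_mat V" by simp
  have s: "decreasing_nonneg m ?s" using dec dnn by (auto simp: decreasing_nonneg_def)
  have sv: "sing_val Z i = ?s i" if "i < m" for i
    using sing_val_unique[OF mn U V(1) s that] ZD by simp
  have "rect_diag m n (sing_val Z) = rect_diag m n ?s"
    by (rule eq_matI) (auto simp: sv)
  moreover have "decreasing_nonneg m (sing_val Z)"
    using s by (auto simp: decreasing_nonneg_def sv)
  ultimately show ?thesis using ZD U V(1) by (metis (no_types, lifting))
qed

section \<open>The Ky Fan norm as a maximum of linear functionals\<close>

lemma mat_inner_entries:
  assumes "Y \<in> carrier_mat m n" "Z \<in> carrier_mat m n"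
  shows "mat_inner Y Z = (\<Sum>i<m. \<Sum>j<n. Y $$ (i,j) * Z $$ (i,j))"
proof -
  have "mat_inner Y Z = (\<Sum>j<n. \<Sum>i<m. Y $$ (i,j) * Z $$ (i,j))"
    using assms by (simp add: mat_inner_def mat_tr_def scalar_prod_def lessThan_atLeast0)
  then show ?thesis by (simp add: sum.swap[of _ "{..<n}"])
qed

lemma mat_inner_add_right:
  assumes "S \<in> carrier_mat m n" "A \<in> carrier_mat m n" "B \<in> carrier_mat m n"
  shows "mat_inner S (A + B) = mat_inner S A + mat_inner S B"
  using assms by (simp add: mat_inner_entries[of _ m n] sum.distrib algebra_simps)

lemma mat_inner_diff_right:
  assumes "S \<in> carrier_mat m n" "A \<in> carrier_mat m n" "B \<in> carrier_mat m n"
  shows "mat_inner S (A - B) = mat_inner S A - mat_inner S B"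
  using assms
  by (simp add: mat_inner_entries[of _ m n] minus_carrier_mat[of _ m n] sum_subtractf right_diff_distrib)

lemma mat_inner_smult_right:
  assumes "S \<in> carrier_mat m n" "A \<in> carrier_mat m n"
  shows "mat_inner S (c \<cdot>\<^sub>m A) = c * mat_inner S A"
  using assms by (simp add: mat_inner_entries[of _ m n] sum_distrib_left algebra_simps)

lemma mat_inner_commute:
  assumes "S \<in> carrier_mat m n" "A \<in> carrier_mat m n"
  shows "mat_inner S A = mat_inner A S"
  using assms by (simp add: mat_inner_entries[of _ m n] mult.commute)

lemma mat_inner_mult_left:
  assumes "P \<in> carrier_mat m p" "A \<in> carrier_mat p n" "B \<in> carrier_mat m n"
  shows "mat_inner (P * A) B = mat_inner A (transpose_mat P * B)"
proof -
  have "mat_inner (P * A) B = (\<Sum>i<m. \<Sum>j<n. \<Sum>k<p. P $$ (i,k) * A $$ (k,j) * B $$ (i,j))"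
    using assms by (simp add: mat_inner_entries[of _ m n] scalar_prod_def lessThan_atLeast0 sum_distrib_right)
  also have "\<dots> = (\<Sum>i<m. \<Sum>k<p. \<Sum>j<n. P $$ (i,k) * A $$ (k,j) * B $$ (i,j))"
    by (intro sum.cong refl sum.swap)
  also have "\<dots> = (\<Sum>k<p. \<Sum>i<m. \<Sum>j<n. P $$ (i,k) * A $$ (k,j) * B $$ (i,j))"
    by (rule sum.swap)
  also have "\<dots> = (\<Sum>k<p. \<Sum>j<n. \<Sum>i<m. P $$ (i,k) * A $$ (k,j) * B $$ (i,j))"
    by (intro sum.cong refl sum.swap)
  also have "\<dots> = mat_inner A (transpose_mat P * B)"
    using assms by (simp add: mat_inner_entries[of _ p n] scalar_prod_def lessThan_atLeast0
        sum_distrib_left mult_ac)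
  finally show ?thesis .
qed

lemma mat_inner_mult_right:
  assumes "A \<in> carrier_mat m p" "R \<in> carrier_mat p n" "B \<in> carrier_mat m n"
  shows "mat_inner (A * R) B = mat_inner A (B * transpose_mat R)"
proof -
  have "mat_inner (A * R) B = (\<Sum>i<m. \<Sum>j<n. \<Sum>k<p. A $$ (i,k) * R $$ (k,j) * B $$ (i,j))"
    using assms by (simp add: mat_inner_entries[of _ m n] scalar_prod_def lessThan_atLeast0 sum_distrib_right)
  also have "\<dots> = (\<Sum>i<m. \<Sum>k<p. \<Sum>j<n. A $$ (i,k) * R $$ (k,j) * B $$ (i,j))"
    by (intro sum.cong refl sum.swap)
  also have "\<dots> = mat_inner A (B * transpose_mat R)"
    using assms by (simp add: mat_inner_entries[of _ m p] scalar_prod_def lessThan_atLeast0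
        sum_distrib_left mult_ac)
  finally show ?thesis .
qed

lemma mat_inner_sandwich:
  assumes "P \<in> carrier_mat m m" "R \<in> carrier_mat n n" "A \<in> carrier_mat m n" "B \<in> carrier_mat m n"
  shows "mat_inner (P * A * transpose_mat R) B = mat_inner A (transpose_mat P * B * R)"
proof -
  have "mat_inner (P * A * transpose_mat R) B = mat_inner (P * A) (B * R)"
    using assms by (subst mat_inner_mult_right[of _ m n _ n]) auto
  also have "\<dots> = mat_inner A (transpose_mat P * (B * R))"
    using assms by (intro mat_inner_mult_left) auto
  finally show ?thesis using assms by (simp add: assoc_mult_mat[of _ m m _ n _ n])
qed

lemma mat_inner_orth_invariant:
  assumes "P \<in> orth_group m" "R \<in> orth_group n" "A \<in> carrier_mat m n" "B \<in> carrier_mat m n"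
  shows "mat_inner (P * A * transpose_mat R) (P * B * transpose_mat R) = mat_inner A B"
proof -
  note P = orth_groupD[OF assms(1)] and R = orth_groupD[OF assms(2)]
  have "transpose_mat P * (P * B * transpose_mat R) * R = B"
    using P R assms orth_cancel[OF assms(1)] orth_cancel_right[OF assms(2)]
    by (simp add: assoc_mult_mat[of _ m m _ n _ n])
  then show ?thesis using P R assms by (subst mat_inner_sandwich[of _ m _ n]) auto
qed

lemma rect_diag_inner:
  assumes "B \<in> carrier_mat m n" "m \<le> n"
  shows "mat_inner (rect_diag m n s) B = (\<Sum>i<m. s i * B $$ (i,i))"
proof -
  have "mat_inner (rect_diag m n s) B = (\<Sum>i<m. \<Sum>j<n. (if i = j then s i else 0) * B $$ (i,j))"
    using assms by (simp add: mat_inner_entries[of _ m n])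
  also have "\<dots> = (\<Sum>i<m. s i * B $$ (i,i))"
  proof (intro sum.cong refl)
    fix i assume "i \<in> {..<m}"
    then have "i < n" using assms by simp
    have "(\<Sum>j<n. (if i = j then s i else 0) * B $$ (i,j)) = (\<Sum>j<n. if i = j then s i * B $$ (i,j) else 0)"
      by (intro sum.cong) auto
    then show "(\<Sum>j<n. (if i = j then s i else 0) * B $$ (i,j)) = s i * B $$ (i,i)"
      using \<open>i < n\<close> by simp
  qed
  finally show ?thesis .
qed

lemma rect_diag_sandwich_index:
  assumes "P \<in> carrier_mat m m" "R \<in> carrier_mat n n" "m \<le> n" "i < m" "k < n"
  shows "(P * rect_diag m n e * transpose_mat R) $$ (i,k) = (\<Sum>l<m. e l * (P $$ (i,l) * R $$ (k,l)))"
proof -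
  have "(P * rect_diag m n e * transpose_mat R) $$ (i,k)
      = (\<Sum>l<n. (P * rect_diag m n e) $$ (i,l) * R $$ (k,l))"
    using assms by (subst index_mult_mat(1)) (auto simp: scalar_prod_def lessThan_atLeast0 simp del: index_mult_mat(1))
  also have "\<dots> = (\<Sum>l<n. if l < m then e l * (P $$ (i,l) * R $$ (k,l)) else 0)"
    using assms by (intro sum.cong) (auto simp: mult_rect_diag_index[of _ m] simp del: index_mult_mat(1))
  also have "\<dots> = (\<Sum>l\<in>{..<n} \<inter> {l. l < m}. e l * (P $$ (i,l) * R $$ (k,l)))"
    by (simp add: sum.inter_restrict)
  also have "{..<n} \<inter> {l. l < m} = {..<m}" using assms by auto
  finally show ?thesis .
qed

text \<open>
  The entrywise norm makes perturbation estimates and limits reducible to single entries.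
\<close>

definition mat_l1 :: "real mat \<Rightarrow> real" where
  "mat_l1 A = (\<Sum>i<dim_row A. \<Sum>j<dim_col A. \<bar>A $$ (i,j)\<bar>)"

lemma mat_l1_nonneg: "0 \<le> mat_l1 A"
  by (simp add: mat_l1_def sum_nonneg)

text \<open>
  Subtracting the \<open>j\<close>-th largest value \<open>t\<close> from \<open>s\<close> makes the summands with \<open>i < j\<close> nonnegative and the
  others nonpositive; the part \<open>t * \<Sum>\<bar>c i\<bar>\<close> is controlled by the bound on the sum.
\<close>

lemma sum_fan_inequality:
  assumes "decreasing_nonneg m s" "j \<le> m" "\<And>i. i < m \<Longrightarrow> \<bar>c i\<bar> \<le> 1" "(\<Sum>i<m. \<bar>c i\<bar>) \<le> real j"
  shows "(\<Sum>i<m. s i * c i) \<le> (\<Sum>i<j. s i)"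
proof (cases "j = 0")
  case True
  then have "(\<Sum>i<m. \<bar>c i\<bar>) = 0" using assms(4) by (simp add: antisym sum_nonneg)
  then have "\<forall>i\<in>{..<m}. \<bar>c i\<bar> = 0" by (subst (asm) sum_nonneg_eq_0_iff) auto
  then show ?thesis using True by simp
next
  case False
  define t where "t = s (j - 1)"
  have s0: "0 \<le> s i" if "i < m" for i using assms(1) that by (auto simp: decreasing_nonneg_def)
  have dec: "s j \<le> s i" if "i \<le> j" "j < m" for i j
    using assms(1) that by (auto simp: decreasing_nonneg_def)
  have t0: "0 \<le> t" unfolding t_def using s0 assms(2) False by simp
  have "(\<Sum>i<m. s i * c i) \<le> (\<Sum>i<m. s i * \<bar>c i\<bar>)"
    by (intro sum_mono mult_left_mono) (auto simp: s0)
  also have "\<dots> = (\<Sum>i<m. (s i - t) * \<bar>c i\<bar>) + t * (\<Sum>i<m. \<bar>c i\<bar>)"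
    by (simp add: sum_distrib_left algebra_simps sum_subtractf)
  also have "(\<Sum>i<m. (s i - t) * \<bar>c i\<bar>) \<le> (\<Sum>i<m. if i < j then s i - t else 0)"
  proof (intro sum_mono)
    fix i assume i: "i \<in> {..<m}"
    show "(s i - t) * \<bar>c i\<bar> \<le> (if i < j then s i - t else 0)"
    proof (cases "i < j")
      case True
      then have "s i - t \<ge> 0" using dec[of i "j - 1"] assms(2) by (simp add: t_def)
      then show ?thesis using True mult_left_mono[OF assms(3)[of i], of "s i - t"] i by simp
    next
      case False
      then have "s i - t \<le> 0" using dec[of "j - 1" i] i by (simp add: t_def)
      then show ?thesis using False by (simp add: mult_nonpos_nonneg)
    qed
  qed
  also have "(\<Sum>i<m. if i < j then s i - t else 0) = (\<Sum>i\<in>{..<m} \<inter> {i. i < j}. s i - t)"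
    by (simp add: sum.inter_restrict)
  also have "{..<m} \<inter> {i. i < j} = {..<j}" using assms(2) by auto
  also have "t * (\<Sum>i<m. \<bar>c i\<bar>) \<le> t * real j" by (intro mult_left_mono assms t0)
  finally show ?thesis by (simp add: sum_subtractf mult.commute)
qed

definition first_ones :: "nat \<Rightarrow> nat \<Rightarrow> real" where
  "first_ones j i = (if i < j then 1 else 0)"

lemma orth_row_le_1:
  assumes "A \<in> orth_group p" "i < p" "J \<subseteq> {..<p}"
  shows "(\<Sum>l\<in>J. (A $$ (i,l))\<^sup>2) \<le> 1"
proof -
  have "(\<Sum>l\<in>J. (A $$ (i,l))\<^sup>2) \<le> (\<Sum>l<p. (A $$ (i,l))\<^sup>2)"
    using assms by (intro sum_mono2) auto
  also have "\<dots> = 1" using orth_group_rows[OF assms(1,2,2)] by (simp add: power2_eq_square)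
  finally show ?thesis .
qed

lemma orth_col_le_1:
  assumes "A \<in> orth_group p" "i < p" "J \<subseteq> {..<p}"
  shows "(\<Sum>l\<in>J. (A $$ (l,i))\<^sup>2) \<le> 1"
proof -
  have "(\<Sum>l\<in>J. (A $$ (l,i))\<^sup>2) \<le> (\<Sum>l<p. (A $$ (l,i))\<^sup>2)"
    using assms by (intro sum_mono2) auto
  also have "\<dots> = 1" using assms(1,2) by (auto simp: orth_group_entries power2_eq_square)
  finally show ?thesis .
qed

lemma orth_entry_le_1:
  assumes "A \<in> orth_group p" "i < p" "j < p"
  shows "\<bar>A $$ (i,j)\<bar> \<le> 1"
  using orth_row_le_1[OF assms(1,2), of "{j}"] assms(3) by (simp add: abs_square_le_1)

lemma abs_mult_le_half_squares: "\<bar>a * b\<bar> \<le> (a\<^sup>2 + b\<^sup>2) / (2::real)"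
proof -
  have "0 \<le> (\<bar>a\<bar> - \<bar>b\<bar>)\<^sup>2" by simp
  then show ?thesis by (simp add: power2_diff abs_mult)
qed

lemma orth_rows_product_le_1:
  assumes "A \<in> orth_group m" "B \<in> orth_group n" "i < m" "k < n" "j \<le> m" "m \<le> n"
  shows "\<bar>\<Sum>l<j. A $$ (i,l) * B $$ (k,l)\<bar> \<le> 1"
proof -
  have "\<bar>\<Sum>l<j. A $$ (i,l) * B $$ (k,l)\<bar> \<le> (\<Sum>l<j. \<bar>A $$ (i,l) * B $$ (k,l)\<bar>)" by (rule sum_abs)
  also have "\<dots> \<le> (\<Sum>l<j. ((A $$ (i,l))\<^sup>2 + (B $$ (k,l))\<^sup>2) / 2)"
    by (intro sum_mono abs_mult_le_half_squares)
  also have "\<dots> = ((\<Sum>l<j. (A $$ (i,l))\<^sup>2) + (\<Sum>l<j. (B $$ (k,l))\<^sup>2)) / 2"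
    by (simp add: sum.distrib flip: sum_divide_distrib)
  also have "\<dots> \<le> 1"
    using orth_row_le_1[OF assms(1,3), of "{..<j}"] orth_row_le_1[OF assms(2,4), of "{..<j}"] assms
    by (simp add: subset_eq)
  finally show ?thesis .
qed

lemma rect_diag_first_ones_index:
  assumes "P \<in> carrier_mat m m" "R \<in> carrier_mat n n" "m \<le> n" "i < m" "k < n" "j \<le> m"
  shows "(P * rect_diag m n (first_ones j) * transpose_mat R) $$ (i,k) = (\<Sum>l<j. P $$ (i,l) * R $$ (k,l))"
proof -
  have "(\<Sum>l<m. first_ones j l * (P $$ (i,l) * R $$ (k,l))) = (\<Sum>l<m. if l < j then P $$ (i,l) * R $$ (k,l) else 0)"
    by (intro sum.cong) (auto simp: first_ones_def)
  also have "\<dots> = (\<Sum>l\<in>{..<m} \<inter> {l. l < j}. P $$ (i,l) * R $$ (k,l))"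
    by (simp add: sum.inter_restrict)
  also have "{..<m} \<inter> {l. l < j} = {..<j}" using assms by auto
  finally show ?thesis
    using assms by (simp add: rect_diag_sandwich_index del: index_mult_mat(1))
qed

lemma sandwich_sandwich:
  fixes P U D V R :: "real mat"
  assumes "P \<in> carrier_mat m m" "U \<in> carrier_mat m m" "D \<in> carrier_mat m n"
    "V \<in> carrier_mat n n" "R \<in> carrier_mat n n"
  shows "P * (U * D * transpose_mat V) * transpose_mat R = (P * U) * D * transpose_mat (R * V)"
proof -
  have "P * (U * D * transpose_mat V) = P * U * D * transpose_mat V"
    using assms by (simp add: assoc_mult_mat[of _ m m _ m _ n] assoc_mult_mat[of _ m m _ n _ n])
  moreover have "(P * U * D * transpose_mat V) * transpose_mat R
      = P * U * D * (transpose_mat V * transpose_mat R)"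
    using assms by (intro assoc_mult_mat[of _ m n _ n _ n]) auto
  ultimately show ?thesis using assms by (simp add: transpose_mult[of _ n n _ n])
qed

text \<open>
  The diagonal entries of a product of \<open>j\<close> columns of one orthogonal matrix with \<open>j\<close> rows of another
  satisfy the hypotheses of \<open>sum_fan_inequality\<close>.
\<close>

theorem ky_fan_upper:
  assumes mn: "m \<le> n" and j: "j \<le> m" and P: "P \<in> orth_group m" and R: "R \<in> orth_group n"
    and Z: "Z \<in> carrier_mat m n"
  shows "mat_inner (P * rect_diag m n (first_ones j) * transpose_mat R) Z \<le> ky_fan j Z"
proof -
  let ?E = "rect_diag m n (first_ones j)"
  obtain U V where U: "U \<in> orth_group m" and V: "V \<in> orth_group n"
    and ZD: "Z = U * rect_diag m n (sing_val Z) * transpose_mat V" and s: "decreasing_nonneg m (sing_val Z)"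
    using svd_exists[OF mn Z] by blast
  note cs = orth_groupD(1)[OF U] orth_groupD(1)[OF V] orth_groupD(1)[OF P] orth_groupD(1)[OF R]
  define A B where "A = transpose_mat U * P" and "B = transpose_mat V * R"
  have A: "A \<in> orth_group m" and B: "B \<in> orth_group n"
    unfolding A_def B_def using U V P R by (auto intro: orth_group_mult orth_group_transpose)
  have eq: "transpose_mat U * (P * ?E * transpose_mat R) * V = A * ?E * transpose_mat B"
    using cs sandwich_sandwich[of "transpose_mat U" m P ?E n R "transpose_mat V"]
    unfolding A_def B_def by simp
  let ?c = "\<lambda>i. \<Sum>l<j. A $$ (i,l) * B $$ (i,l)"
  have "mat_inner (P * ?E * transpose_mat R) Z = mat_inner Z (P * ?E * transpose_mat R)"
    using cs Z by (intro mat_inner_commute) auto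
  also have "\<dots> = mat_inner (rect_diag m n (sing_val Z)) (A * ?E * transpose_mat B)"
    unfolding eq[symmetric] by (subst ZD, intro mat_inner_sandwich) (use cs in auto)
  also have "\<dots> = (\<Sum>i<m. sing_val Z i * (A * ?E * transpose_mat B) $$ (i,i))"
    using orth_groupD(1)[OF A] orth_groupD(1)[OF B] mn by (intro rect_diag_inner) auto
  also have "\<dots> = (\<Sum>i<m. sing_val Z i * ?c i)"
    using orth_groupD(1)[OF A] orth_groupD(1)[OF B] mn j by (intro sum.cong refl) (subst rect_diag_first_ones_index, auto)
  also have "\<dots> \<le> (\<Sum>i<j. sing_val Z i)"
  proof (rule sum_fan_inequality[OF s j])
    show "\<bar>?c i\<bar> \<le> 1" if "i < m" for i
      using orth_rows_product_le_1[OF A B that _ j mn] that mn by simp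
    have "(\<Sum>i<m. \<bar>?c i\<bar>) \<le> (\<Sum>i<m. \<Sum>l<j. ((A $$ (i,l))\<^sup>2 + (B $$ (i,l))\<^sup>2) / 2)"
      by (intro sum_mono order_trans[OF sum_abs] abs_mult_le_half_squares)
    also have "\<dots> = (\<Sum>l<j. \<Sum>i<m. ((A $$ (i,l))\<^sup>2 + (B $$ (i,l))\<^sup>2) / 2)"
      by (rule sum.swap)
    also have "\<dots> = (\<Sum>l<j. ((\<Sum>i<m. (A $$ (i,l))\<^sup>2) + (\<Sum>i<m. (B $$ (i,l))\<^sup>2)) / 2)"
      by (simp add: sum.distrib flip: sum_divide_distrib)
    also have "\<dots> \<le> (\<Sum>l<j. 1)"
    proof (intro sum_mono)
      fix l assume "l \<in> {..<j}"
      then show "((\<Sum>i<m. (A $$ (i,l))\<^sup>2) + (\<Sum>i<m. (B $$ (i,l))\<^sup>2)) / 2 \<le> 1"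
        using orth_col_le_1[OF A, of l "{..<m}"] orth_col_le_1[OF B, of l "{..<m}"] mn j by auto
    qed
    finally show "(\<Sum>i<m. \<bar>?c i\<bar>) \<le> real j" by simp
  qed
  finally show ?thesis by (simp add: ky_fan_def)
qed

text \<open>
  Together with \<open>ky_fan_upper\<close> this represents the norm as a maximum of linear functionals, from which
  the triangle inequality and all Lipschitz estimates follow.
\<close>

theorem ky_fan_attained:
  assumes mn: "m \<le> n" and j: "j \<le> m" and Z: "Z \<in> carrier_mat m n"
  shows "\<exists>P \<in> orth_group m. \<exists>R \<in> orth_group n.
    ky_fan j Z = mat_inner (P * rect_diag m n (first_ones j) * transpose_mat R) Z"
proof -
  obtain U V where U: "U \<in> orth_group m" and V: "V \<in> orth_group n"
    and ZD: "Z = U * rect_diag m n (sing_val Z) * transpose_mat V"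
    using svd_exists[OF mn Z] by blast
  have "mat_inner (U * rect_diag m n (first_ones j) * transpose_mat V) Z
     = mat_inner (rect_diag m n (first_ones j)) (rect_diag m n (sing_val Z))"
    by (subst ZD, rule mat_inner_orth_invariant[OF U V]) auto
  also have "\<dots> = (\<Sum>i<m. if i < j then sing_val Z i else 0)"
    using mn by (subst rect_diag_inner) (auto simp: first_ones_def intro!: sum.cong)
  also have "\<dots> = (\<Sum>i\<in>{..<m} \<inter> {i. i < j}. sing_val Z i)"
    by (simp add: sum.inter_restrict)
  also have "{..<m} \<inter> {i. i < j} = {..<j}" using j by auto
  finally have "ky_fan j Z = mat_inner (U * rect_diag m n (first_ones j) * transpose_mat V) Z"
    by (simp add: ky_fan_def)
  then show ?thesis using U V by blast
qed

lemma ky_fan_triangle: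
  assumes "m \<le> n" "j \<le> m" "A \<in> carrier_mat m n" "B \<in> carrier_mat m n"
  shows "ky_fan j (A + B) \<le> ky_fan j A + ky_fan j B"
proof -
  have AB: "A + B \<in> carrier_mat m n" using assms by simp
  obtain P R where PR: "P \<in> orth_group m" "R \<in> orth_group n"
    "ky_fan j (A + B) = mat_inner (P * rect_diag m n (first_ones j) * transpose_mat R) (A + B)"
    using ky_fan_attained[OF assms(1,2) AB] by blast
  let ?S = "P * rect_diag m n (first_ones j) * transpose_mat R"
  have S: "?S \<in> carrier_mat m n" using orth_groupD(1)[OF PR(1)] orth_groupD(1)[OF PR(2)] by auto
  have "mat_inner ?S (A + B) = mat_inner ?S A + mat_inner ?S B"
    using S assms by (intro mat_inner_add_right)
  then show ?thesis
    using PR ky_fan_upper[OF assms(1,2) PR(1,2)] assms(3,4) by (simp add: add_mono)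
qed

lemma ky_fan_le_l1:
  assumes "m \<le> n" "j \<le> m" "A \<in> carrier_mat m n"
  shows "ky_fan j A \<le> mat_l1 A"
proof -
  obtain P R where PR: "P \<in> orth_group m" "R \<in> orth_group n"
    "ky_fan j A = mat_inner (P * rect_diag m n (first_ones j) * transpose_mat R) A"
    using ky_fan_attained[OF assms] by blast
  let ?S = "P * rect_diag m n (first_ones j) * transpose_mat R"
  note cs = orth_groupD(1)[OF PR(1)] orth_groupD(1)[OF PR(2)]
  have S: "?S \<in> carrier_mat m n" using cs by auto
  have "ky_fan j A = (\<Sum>i<m. \<Sum>k<n. ?S $$ (i,k) * A $$ (i,k))"
    unfolding PR(3) by (rule mat_inner_entries[OF S assms(3)])
  also have "\<dots> \<le> (\<Sum>i<m. \<Sum>k<n. \<bar>A $$ (i,k)\<bar>)"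
  proof (intro sum_mono)
    fix i k assume ik: "i \<in> {..<m}" "k \<in> {..<n}"
    have "\<bar>?S $$ (i,k)\<bar> \<le> 1"
      using orth_rows_product_le_1[OF PR(1,2), of i k j] ik assms cs
      by (subst rect_diag_first_ones_index) auto
    then have "\<bar>?S $$ (i,k)\<bar> * \<bar>A $$ (i,k)\<bar> \<le> 1 * \<bar>A $$ (i,k)\<bar>" by (intro mult_right_mono) auto
    then have "\<bar>?S $$ (i,k) * A $$ (i,k)\<bar> \<le> \<bar>A $$ (i,k)\<bar>" by (simp only: abs_mult mult_1)
    then show "?S $$ (i,k) * A $$ (i,k) \<le> \<bar>A $$ (i,k)\<bar>" by linarith
  qed
  also have "\<dots> = mat_l1 A" using assms(3) by (simp add: mat_l1_def)
  finally show ?thesis .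
qed

lemma ky_fan_lipschitz:
  assumes "m \<le> n" "j \<le> m" "A \<in> carrier_mat m n" "B \<in> carrier_mat m n"
  shows "\<bar>ky_fan j A - ky_fan j B\<bar> \<le> mat_l1 (A - B)"
proof -
  have "ky_fan j A \<le> ky_fan j B + mat_l1 (A - B)" if "A \<in> carrier_mat m n" "B \<in> carrier_mat m n" for A B
  proof -
    have "A = B + (A - B)" using that by (intro eq_matI) auto
    then have "ky_fan j A \<le> ky_fan j B + ky_fan j (A - B)"
      using ky_fan_triangle[OF assms(1,2) that(2), of "A - B"] that by (simp add: minus_carrier_mat[of _ m n])
    also have "ky_fan j (A - B) \<le> mat_l1 (A - B)"
      using that by (intro ky_fan_le_l1[OF assms(1,2)]) auto
    finally show ?thesis by simp
  qed
  from this[OF assms(3,4)] this[OF assms(4,3)]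
  have "ky_fan j A \<le> ky_fan j B + mat_l1 (A - B)" "ky_fan j B \<le> ky_fan j A + mat_l1 (B - A)" .
  moreover have "mat_l1 (B - A) = mat_l1 (A - B)"
    using assms(3,4) by (auto simp: mat_l1_def abs_minus_commute intro!: sum.cong)
  ultimately show ?thesis by linarith
qed

lemma sing_val_lipschitz:
  assumes "m \<le> n" "i < m" "A \<in> carrier_mat m n" "B \<in> carrier_mat m n"
  shows "\<bar>sing_val A i - sing_val B i\<bar> \<le> 2 * mat_l1 (A - B)"
proof -
  have "sing_val Z i = ky_fan (Suc i) Z - ky_fan i Z" for Z by (simp add: ky_fan_def)
  then show ?thesis
    using ky_fan_lipschitz[OF assms(1) _ assms(3,4), of i] ky_fan_lipschitz[OF assms(1) _ assms(3,4), of "Suc i"]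
      assms(2) by simp
qed

lemma sing_val_orth_invariant:
  assumes mn: "m \<le> n" and P: "P \<in> orth_group m" and R: "R \<in> orth_group n" and Z: "Z \<in> carrier_mat m n"
    and i: "i < m"
  shows "sing_val (P * Z * transpose_mat R) i = sing_val Z i"
proof -
  obtain U V where U: "U \<in> orth_group m" and V: "V \<in> orth_group n"
    and ZD: "Z = U * rect_diag m n (sing_val Z) * transpose_mat V" and s: "decreasing_nonneg m (sing_val Z)"
    using svd_exists[OF mn Z] by blast
  note cs = orth_groupD(1)[OF U] orth_groupD(1)[OF V] orth_groupD(1)[OF P] orth_groupD(1)[OF R]
  have "P * Z * transpose_mat R = P * (U * rect_diag m n (sing_val Z) * transpose_mat V) * transpose_mat R"
    by (subst ZD) (rule refl)
  also have "\<dots> = (P * U) * rect_diag m n (sing_val Z) * transpose_mat (R * V)"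
    using cs by (intro sandwich_sandwich) auto
  finally show ?thesis
    using sing_val_unique[OF mn orth_group_mult[OF P U] orth_group_mult[OF R V] s i] by simp
qed

lemma ky_fan_orth_invariant:
  assumes "m \<le> n" "P \<in> orth_group m" "R \<in> orth_group n" "Z \<in> carrier_mat m n" "j \<le> m"
  shows "ky_fan j (P * Z * transpose_mat R) = ky_fan j Z"
  unfolding ky_fan_def using assms by (intro sum.cong refl sing_val_orth_invariant[of m n]) auto

lemma orth_group_one: "1\<^sub>m p \<in> orth_group p" by (simp add: orth_group_def)

lemma sing_val_rect_diag:
  assumes "m \<le> n" "decreasing_nonneg m s" "i < m"
  shows "sing_val (rect_diag m n s) i = s i"
  using sing_val_unique[OF assms(1) orth_group_one orth_group_one assms(2,3)] by simp

section \<open>Directions along which singular values are affine\<close>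

lemma exists_positive_gap:
  fixes S :: "real set"
  assumes "finite S"
  shows "\<exists>g>0. \<forall>a\<in>S. \<forall>b\<in>S. a \<noteq> b \<longrightarrow> g \<le> \<bar>a - b\<bar>"
proof -
  let ?G = "insert 1 {\<bar>a - b\<bar> |a b. a \<in> S \<and> b \<in> S \<and> a \<noteq> b}"
  have "{\<bar>a - b\<bar> |a b. a \<in> S \<and> b \<in> S \<and> a \<noteq> b} \<subseteq> (\<lambda>(a,b). \<bar>a - b\<bar>) ` (S \<times> S)" by auto
  then have fin: "finite ?G" using assms by (simp add: finite_subset)
  have "Min ?G \<in> ?G" using fin by (intro Min_in) auto
  then have "Min ?G > 0" by auto
  moreover have "Min ?G \<le> \<bar>a - b\<bar>" if "a \<in> S" "b \<in> S" "a \<noteq> b" for a b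
    using fin that by (intro Min_le) auto
  ultimately show ?thesis by blast
qed

text \<open>
  Summing absolute values over both groups of equations gives
  \<open>\<bar>a\<bar> (\<parallel>x\<parallel>\<^sub>1 + \<parallel>y\<parallel>\<^sub>1) \<le> \<bar>e\<bar> b (\<parallel>x\<parallel>\<^sub>1 + \<parallel>y\<parallel>\<^sub>1)\<close> with \<open>b\<close> the entry sum of \<open>B\<close>. The lemma
  serves to show that singular vectors of a small perturbation do not mix different blocks.
\<close>

lemma dominated_linear_system_trivial:
  fixes x y :: "nat \<Rightarrow> real"
  assumes fin: "finite I" "finite J"
    and x: "\<And>i. i \<in> I \<Longrightarrow> a * x i = e * (\<Sum>j\<in>J. B i j * y j)"
    and y: "\<And>j. j \<in> J \<Longrightarrow> a * y j = e * (\<Sum>i\<in>I. B i j * x i)"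
    and small: "\<bar>e\<bar> * (\<Sum>i\<in>I. \<Sum>j\<in>J. \<bar>B i j\<bar>) < \<bar>a\<bar>"
  shows "(\<forall>i\<in>I. x i = 0) \<and> (\<forall>j\<in>J. y j = 0)"
proof -
  let ?X = "\<Sum>i\<in>I. \<bar>x i\<bar>" and ?Y = "\<Sum>j\<in>J. \<bar>y j\<bar>" and ?b = "\<Sum>i\<in>I. \<Sum>j\<in>J. \<bar>B i j\<bar>"
  have Xle: "\<bar>x i\<bar> \<le> ?X" if "i \<in> I" for i using fin that by (intro member_le_sum) auto
  have Yle: "\<bar>y j\<bar> \<le> ?Y" if "j \<in> J" for j using fin that by (intro member_le_sum) auto
  have "\<bar>a\<bar> * ?X = (\<Sum>i\<in>I. \<bar>a * x i\<bar>)" by (simp add: sum_distrib_left abs_mult)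
  also have "\<dots> = (\<Sum>i\<in>I. \<bar>e\<bar> * \<bar>\<Sum>j\<in>J. B i j * y j\<bar>)" by (simp add: x abs_mult)
  also have "\<dots> \<le> (\<Sum>i\<in>I. \<bar>e\<bar> * (\<Sum>j\<in>J. \<bar>B i j\<bar> * ?Y))"
    by (intro sum_mono mult_left_mono order_trans[OF sum_abs]) (auto simp: abs_mult intro!: sum_mono mult_left_mono Yle)
  also have "\<dots> = \<bar>e\<bar> * ?b * ?Y" by (simp add: sum_distrib_left sum_distrib_right mult_ac)
  finally have 1: "\<bar>a\<bar> * ?X \<le> \<bar>e\<bar> * ?b * ?Y" .
  have "\<bar>a\<bar> * ?Y = (\<Sum>j\<in>J. \<bar>a * y j\<bar>)" by (simp add: sum_distrib_left abs_mult)
  also have "\<dots> = (\<Sum>j\<in>J. \<bar>e\<bar> * \<bar>\<Sum>i\<in>I. B i j * x i\<bar>)" by (simp add: y abs_mult)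
  also have "\<dots> \<le> (\<Sum>j\<in>J. \<bar>e\<bar> * (\<Sum>i\<in>I. \<bar>B i j\<bar> * ?X))"
    by (intro sum_mono mult_left_mono order_trans[OF sum_abs]) (auto simp: abs_mult intro!: sum_mono mult_left_mono Xle)
  also have "\<dots> = \<bar>e\<bar> * (\<Sum>j\<in>J. \<Sum>i\<in>I. \<bar>B i j\<bar>) * ?X" by (simp add: sum_distrib_left sum_distrib_right mult_ac)
  also have "(\<Sum>j\<in>J. \<Sum>i\<in>I. \<bar>B i j\<bar>) = ?b" by (rule sum.swap)
  finally have 2: "\<bar>a\<bar> * ?Y \<le> \<bar>e\<bar> * ?b * ?X" .
  have XY: "?X + ?Y \<ge> 0" by (intro add_nonneg_nonneg sum_nonneg) auto
  have "\<bar>a\<bar> * (?X + ?Y) \<le> \<bar>e\<bar> * ?b * (?X + ?Y)" using 1 2 by (simp add: distrib_left)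
  then have "?X + ?Y \<le> 0" using small XY by (smt (verit) mult_less_cancel_right)
  moreover have "?X \<ge> 0" "?Y \<ge> 0" by (auto intro: sum_nonneg)
  ultimately have "?X = 0" "?Y = 0" by linarith+
  then show ?thesis using fin by (simp add: sum_nonneg_eq_0_iff)
qed

corollary dominated_symmetric_system_trivial:
  fixes x :: "nat \<Rightarrow> real"
  assumes "finite I" "\<And>i j. i \<in> I \<Longrightarrow> j \<in> I \<Longrightarrow> B i j = B j i"
    and "\<And>i. i \<in> I \<Longrightarrow> a * x i = e * (\<Sum>j\<in>I. B i j * x j)"
    and "\<bar>e\<bar> * (\<Sum>i\<in>I. \<Sum>j\<in>I. \<bar>B i j\<bar>) < \<bar>a\<bar>" "i \<in> I"
  shows "x i = 0"
proof -
  have "a * x j = e * (\<Sum>i\<in>I. B i j * x i)" if "j \<in> I" for j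
    unfolding assms(3)[OF that] using assms(2)[OF that] by (auto intro!: arg_cong[of _ _ "(*) e"] sum.cong)
  then show ?thesis
    using dominated_linear_system_trivial[of I I a x e B x, OF assms(1,1,3) _ assms(4)] assms(5) by blast
qed

text \<open>
  For a fixed small \<open>e\<close>, let \<open>D + e B = P Diag(z) R\<^sup>T\<close>. Since \<open>B\<close> respects the blocks of \<open>D\<close>, every block
  component of a pair of singular vectors satisfies the same equations as the whole pair. A singular
  value \<open>z l\<close> is close to \<open>s l\<close>, hence far from the values of the other blocks, so all components in
  other blocks vanish; on a block with positive value, symmetry of \<open>B\<close> makes left and right components
  equal. This says \<open>P D R\<^sup>T = D\<close>. Then \<open>D + t B\<close>, an affine combination of \<open>D\<close> and \<open>D + e B\<close>, has singular
  values that are convex combinations of the two decreasing sequences \<open>s\<close> and \<open>z\<close>, for \<open>0 \<le> t \<le> e\<close>.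
\<close>

theorem sing_val_affine_along_block_direction:
  fixes B :: "real mat" and s :: "nat \<Rightarrow> real"
  assumes mn: "m \<le> n" and B: "B \<in> carrier_mat m n" and dec: "decreasing_nonneg m s"
    and tail: "\<And>j. m \<le> j \<Longrightarrow> s j = 0"
    and block: "\<And>i j. i < m \<Longrightarrow> j < n \<Longrightarrow> s i \<noteq> s j \<Longrightarrow> B $$ (i,j) = 0"
    and symB: "\<And>i j. i < m \<Longrightarrow> j < m \<Longrightarrow> s i = s j \<Longrightarrow> s i > 0 \<Longrightarrow> B $$ (i,j) = B $$ (j,i)"
  shows "\<exists>e>0. \<exists>d. \<forall>t. 0 \<le> t \<longrightarrow> t \<le> e \<longrightarrow>
    (\<forall>i<m. sing_val (rect_diag m n s + t \<cdot>\<^sub>m B) i = s i + t * d i)"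
proof -
  have s0: "0 \<le> s i" for i using dec tail by (cases "i < m") (auto simp: decreasing_nonneg_def)
  define b where "b = mat_l1 B"
  have b0: "0 \<le> b" by (simp add: b_def mat_l1_nonneg)
  obtain g where g: "g > 0" "\<And>x y. x \<in> insert 0 (s ` {..<n}) \<Longrightarrow> y \<in> insert 0 (s ` {..<n}) \<Longrightarrow> x \<noteq> y \<Longrightarrow> g \<le> \<bar>x - y\<bar>"
    using exists_positive_gap[of "insert 0 (s ` {..<n})"] by (metis finite_imageI finite_insert finite_lessThan)
  \<comment> \<open>The perturbation \<open>e B\<close> then has entry sum below \<open>g / 4\<close>. Singular values move by at most twice that
    (\<open>sing_val_lipschitz\<close>), hence by less than half the gap, and more than \<open>g / 4\<close> of the gap remains.\<close>
  define e where "e = g / (4 * (b + 1))"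
  have e: "e > 0" using g b0 by (simp add: e_def)
  have eb: "e * b < g / 4"
    using g(1) b0 by (simp add: e_def field_simps)
  have gap: "g \<le> \<bar>s i - s j\<bar>" if "s i \<noteq> s j" "i < n" "j < n" for i j using g(2) that by auto
  have gap0: "g \<le> s i" if "s i > 0" "i < n" for i using g(2)[of "s i" 0] that by auto
  have subB: "(\<Sum>i\<in>I. \<Sum>j\<in>J. \<bar>B $$ (i,j)\<bar>) \<le> b" if "I \<subseteq> {..<m}" "J \<subseteq> {..<n}" for I J
  proof -
    have "(\<Sum>i\<in>I. \<Sum>j\<in>J. \<bar>B $$ (i,j)\<bar>) \<le> (\<Sum>i\<in>I. \<Sum>j<n. \<bar>B $$ (i,j)\<bar>)"
      by (intro sum_mono sum_mono2) (use that in auto)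
    also have "\<dots> \<le> (\<Sum>i<m. \<Sum>j<n. \<bar>B $$ (i,j)\<bar>)"
      by (intro sum_mono2 sum_nonneg) (use that in auto)
    finally show ?thesis using B by (simp add: b_def mat_l1_def)
  qed
  have ebI: "\<bar>- e\<bar> * (\<Sum>i\<in>I. \<Sum>j\<in>J. \<bar>B $$ (i,j)\<bar>) \<le> e * b" if "I \<subseteq> {..<m}" "J \<subseteq> {..<n}" for I J
    using mult_left_mono[OF subB[OF that], of e] e by simp
  let ?D = "rect_diag m n s"
  define Y where "Y = ?D + e \<cdot>\<^sub>m B"
  have Y: "Y \<in> carrier_mat m n" using B by (simp add: Y_def)
  define z where "z = sing_val Y"
  obtain P R where P: "P \<in> orth_group m" and R: "R \<in> orth_group n"
    and YD: "Y = P * rect_diag m n z * transpose_mat R" and zdec: "decreasing_nonneg m z"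
    using svd_exists[OF mn Y] unfolding z_def by blast
  note P' = orth_groupD[OF P] and R' = orth_groupD[OF R]
  have z0: "0 \<le> z l" if "l < m" for l using zdec that by (auto simp: decreasing_nonneg_def)
  have zs: "\<bar>z l - s l\<bar> \<le> 2 * (e * b)" if "l < m" for l
  proof -
    have "\<bar>sing_val Y l - sing_val ?D l\<bar> \<le> 2 * mat_l1 (Y - ?D)"
      by (rule sing_val_lipschitz[OF mn that Y]) simp
    also have "Y - ?D = e \<cdot>\<^sub>m B" using B by (intro eq_matI) (auto simp: Y_def)
    also have "mat_l1 (e \<cdot>\<^sub>m B) = e * b"
      using B e by (simp add: mat_l1_def b_def sum_distrib_left abs_mult)
    finally show ?thesis using sing_val_rect_diag[OF mn dec that] by (simp add: z_def)
  qed
  have YR: "(\<Sum>j<n. Y $$ (i,j) * R $$ (j,l)) = (if l < m then P $$ (i,l) * z l else 0)"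
    if "i < m" "l < n" for i l
  proof -
    have "Y * R = P * rect_diag m n z"
      using orth_cancel_right(1)[OF R, of "P * rect_diag m n z" m] P' by (simp add: YD)
    then have "(Y * R) $$ (i,l) = (if l < m then P $$ (i,l) * z l else 0)"
      using mult_rect_diag_index[OF P'(1) that] by simp
    moreover have "(Y * R) $$ (i,l) = (\<Sum>j<n. Y $$ (i,j) * R $$ (j,l))"
      using Y R' that by (simp add: scalar_prod_def lessThan_atLeast0)
    ultimately show ?thesis by simp
  qed
  have YP: "(\<Sum>i<m. Y $$ (i,j) * P $$ (i,l)) = z l * R $$ (j,l)" if "j < n" "l < m" for j l
  proof -
    have "transpose_mat P * Y = rect_diag m n z * transpose_mat R"
      using orth_cancel(1)[OF P mult_carrier_mat[OF rect_diag_carrier(1)[of m n z], of "transpose_mat R" n]] P' R'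
      by (simp add: YD assoc_mult_mat[of _ m m _ n _ n])
    then have "(transpose_mat P * Y) $$ (l,j) = (rect_diag m n z * transpose_mat R) $$ (l,j)" by simp
    also have "\<dots> = z l * transpose_mat R $$ (l,j)"
      using that R' mn by (intro rect_diag_mult_index[of _ n n]) auto
    also have "\<dots> = z l * R $$ (j,l)" using that R' mn by simp
    finally show ?thesis
      using Y P' that by (simp add: scalar_prod_def lessThan_atLeast0 mult.commute)
  qed
  have row_eq: "s i * R $$ (i,l) + e * (\<Sum>j\<in>{j. j < n \<and> s j = s i}. B $$ (i,j) * R $$ (j,l))
      = (if l < m then P $$ (i,l) * z l else 0)" if "i < m" "l < n" for i l
  proof -
    have "(\<Sum>j<n. Y $$ (i,j) * R $$ (j,l))
        = (\<Sum>j<n. (if i = j then s i * R $$ (j,l) else 0) + e * (B $$ (i,j) * R $$ (j,l)))"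
      using that B by (intro sum.cong) (auto simp: Y_def algebra_simps)
    also have "\<dots> = s i * R $$ (i,l) + e * (\<Sum>j<n. B $$ (i,j) * R $$ (j,l))"
      using that mn by (simp add: sum.distrib sum_distrib_left)
    also have "(\<Sum>j<n. B $$ (i,j) * R $$ (j,l)) = (\<Sum>j\<in>{j. j < n \<and> s j = s i}. B $$ (i,j) * R $$ (j,l))"
      using that by (intro sum.mono_neutral_right) (auto, metis block)
    finally show ?thesis using YR[OF that] by simp
  qed
  have col_eq: "s j * (if j < m then P $$ (j,l) else 0)
      + e * (\<Sum>i\<in>{i. i < m \<and> s i = s j}. B $$ (i,j) * P $$ (i,l)) = z l * R $$ (j,l)"
    if "j < n" "l < m" for j l
  proof -
    have "(\<Sum>i<m. Y $$ (i,j) * P $$ (i,l))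
        = (\<Sum>i<m. (if j = i then s i * P $$ (i,l) else 0) + e * (B $$ (i,j) * P $$ (i,l)))"
      using that B by (intro sum.cong) (auto simp: Y_def algebra_simps)
    also have "\<dots> = s j * (if j < m then P $$ (j,l) else 0) + e * (\<Sum>i<m. B $$ (i,j) * P $$ (i,l))"
      by (simp add: sum.distrib sum_distrib_left)
    also have "(\<Sum>i<m. B $$ (i,j) * P $$ (i,l)) = (\<Sum>i\<in>{i. i < m \<and> s i = s j}. B $$ (i,j) * P $$ (i,l))"
      using that by (intro sum.mono_neutral_right) (auto, metis block)
    finally show ?thesis using YP[OF that] by simp
  qed
  have pos_set: "{j. j < n \<and> s j = s i} = {j. j < m \<and> s j = s i}" if "s i > 0" for i
    using that tail mn by (metis (mono_tags, lifting) leI less_le_trans order_less_irrefl)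
  \<comment> \<open>The difference and the sum of the two singular vectors decouple: they are eigenvectors of the
    symmetric block of \<open>D + e B\<close> for the values \<open>- z l\<close> and \<open>z l\<close>.\<close>
  have RP: "R $$ (i,l) = P $$ (i,l) \<and> (s i \<noteq> s l \<longrightarrow> P $$ (i,l) = 0)"
    if i: "i < m" "s i > 0" and l: "l < m" for i l
  proof -
    let ?I = "{j. j < m \<and> s j = s i}"
    have in_I: "i \<in> ?I" and fin: "finite ?I" and sub: "?I \<subseteq> {..<m}" "?I \<subseteq> {..<n}" using i mn by auto
    have eq1: "s i * R $$ (j,l) + e * (\<Sum>k\<in>?I. B $$ (j,k) * R $$ (k,l)) = P $$ (j,l) * z l" if "j \<in> ?I" for j
      using row_eq[of j l] that l mn pos_set[OF i(2)] by auto
    have eq2: "s i * P $$ (j,l) + e * (\<Sum>k\<in>?I. B $$ (j,k) * P $$ (k,l)) = z l * R $$ (j,l)" if "j \<in> ?I" for j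
    proof -
      have "(\<Sum>k\<in>?I. B $$ (k,j) * P $$ (k,l)) = (\<Sum>k\<in>?I. B $$ (j,k) * P $$ (k,l))"
        using symB that i by (intro sum.cong) auto
      then show ?thesis using col_eq[of j l] that l mn by auto
    qed
    have symI: "B $$ (j,k) = B $$ (k,j)" if "j \<in> ?I" "k \<in> ?I" for j k using symB that i by auto
    have "R $$ (i,l) - P $$ (i,l) = 0"
    proof (rule dominated_symmetric_system_trivial[OF fin symI _ _ in_I,
          where a = "s i + z l" and e = "- e" and x = "\<lambda>j. R $$ (j,l) - P $$ (j,l)"])
      fix j assume j: "j \<in> ?I"
      have "(s i + z l) * (R $$ (j,l) - P $$ (j,l)) =
          - e * ((\<Sum>k\<in>?I. B $$ (j,k) * R $$ (k,l)) - (\<Sum>k\<in>?I. B $$ (j,k) * P $$ (k,l)))"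
        using eq1[OF j] eq2[OF j] by (simp add: algebra_simps)
      then show "(s i + z l) * (R $$ (j,l) - P $$ (j,l)) =
          - e * (\<Sum>k\<in>?I. B $$ (j,k) * (R $$ (k,l) - P $$ (k,l)))"
        by (simp add: right_diff_distrib sum_subtractf)
    next
      show "\<bar>- e\<bar> * (\<Sum>i\<in>?I. \<Sum>j\<in>?I. \<bar>B $$ (i,j)\<bar>) < \<bar>s i + z l\<bar>"
        using ebI[OF sub] eb gap0[of i] i mn z0[OF l] g(1) by simp
    qed auto
    moreover have "R $$ (i,l) + P $$ (i,l) = 0" if "s i \<noteq> s l"
    proof (rule dominated_symmetric_system_trivial[OF fin symI _ _ in_I,
          where a = "s i - z l" and e = "- e" and x = "\<lambda>j. R $$ (j,l) + P $$ (j,l)"])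
      fix j assume j: "j \<in> ?I"
      have "(s i - z l) * (R $$ (j,l) + P $$ (j,l)) =
          - e * ((\<Sum>k\<in>?I. B $$ (j,k) * R $$ (k,l)) + (\<Sum>k\<in>?I. B $$ (j,k) * P $$ (k,l)))"
        using eq1[OF j] eq2[OF j] by (simp add: algebra_simps)
      then show "(s i - z l) * (R $$ (j,l) + P $$ (j,l)) =
          - e * (\<Sum>k\<in>?I. B $$ (j,k) * (R $$ (k,l) + P $$ (k,l)))"
        by (simp add: distrib_left sum.distrib)
    next
      show "\<bar>- e\<bar> * (\<Sum>i\<in>?I. \<Sum>j\<in>?I. \<bar>B $$ (i,j)\<bar>) < \<bar>s i - z l\<bar>"
        using ebI[OF sub] eb gap[of i l] i l mn that zs[OF l] by linarith
    qed auto
    ultimately show ?thesis by auto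
  qed
  have P0: "P $$ (i,l) = 0" if i: "i < m" "s i = 0" and l: "l < m" "s l \<noteq> 0" for i l
  proof -
    let ?I = "{i. i < m \<and> s i = 0}" and ?J = "{j. j < n \<and> s j = 0}"
    have "(\<forall>i\<in>?I. P $$ (i,l) = 0) \<and> (\<forall>j\<in>?J. R $$ (j,l) = 0)"
    proof (rule dominated_linear_system_trivial[where a = "z l" and e = e and B = "\<lambda>i j. B $$ (i,j)"])
      show "z l * P $$ (i,l) = e * (\<Sum>j\<in>?J. B $$ (i,j) * R $$ (j,l))" if "i \<in> ?I" for i
        using row_eq[of i l] that l mn by simp
      show "z l * R $$ (j,l) = e * (\<Sum>i\<in>?I. B $$ (i,j) * P $$ (i,l))" if "j \<in> ?J" for j
        using col_eq[of j l] that l by simp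
      have "?I \<subseteq> {..<m}" "?J \<subseteq> {..<n}" by auto
      from ebI[OF this] show "\<bar>e\<bar> * (\<Sum>i\<in>?I. \<Sum>j\<in>?J. \<bar>B $$ (i,j)\<bar>) < \<bar>z l\<bar>"
        using eb gap0[of l] s0[of l] l mn zs[OF l(1)] by simp
    qed auto
    then show ?thesis using i by blast
  qed
  \<comment> \<open>The columns of \<open>R\<close> beyond \<open>m\<close> lie in the kernel of \<open>D + e B\<close>, whose vectors vanish on the blocks with
    positive value.\<close>
  have R0: "R $$ (i,l) = 0" if i: "i < m" "s i > 0" and l: "m \<le> l" "l < n" for i l
  proof -
    let ?I = "{j. j < m \<and> s j = s i}"
    have in_I: "i \<in> ?I" and fin: "finite ?I" and sub: "?I \<subseteq> {..<m}" "?I \<subseteq> {..<n}" using i mn by auto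
    have symI: "B $$ (j,k) = B $$ (k,j)" if "j \<in> ?I" "k \<in> ?I" for j k using symB that i by auto
    show ?thesis
    proof (rule dominated_symmetric_system_trivial[OF fin symI _ _ in_I,
          where a = "s i" and e = "- e" and x = "\<lambda>j. R $$ (j,l)"])
      show "s i * R $$ (j,l) = - e * (\<Sum>k\<in>?I. B $$ (j,k) * R $$ (k,l))" if "j \<in> ?I" for j
        using row_eq[of j l] that l pos_set[OF i(2)] by auto
      show "\<bar>- e\<bar> * (\<Sum>i\<in>?I. \<Sum>j\<in>?I. \<bar>B $$ (i,j)\<bar>) < \<bar>s i\<bar>"
        using ebI[OF sub] eb gap0[of i] i mn g(1) by simp
    qed auto
  qed
  have "?D * R = P * ?D"
  proof (rule eq_matI)
    fix i l assume "i < dim_row (P * ?D)" "l < dim_col (P * ?D)"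
    then have il: "i < m" "l < n" using P' by auto
    have 1: "(?D * R) $$ (i,l) = s i * R $$ (i,l)"
      using il R' mn by (intro rect_diag_mult_index) auto
    have 2: "(P * ?D) $$ (i,l) = (if l < m then P $$ (i,l) * s l else 0)"
      by (rule mult_rect_diag_index[OF P'(1) il])
    show "(?D * R) $$ (i,l) = (P * ?D) $$ (i,l)"
      unfolding 1 2 using RP[of i l] P0[of i l] R0[of i l] il s0[of i] by (cases "s i = 0"; cases "l < m") auto
  qed (use P' R' in auto)
  then have "P * ?D * transpose_mat R = ?D * R * transpose_mat R" by simp
  then have DD: "P * ?D * transpose_mat R = ?D" using orth_cancel_right(2)[OF R, of ?D m] by simp
  have sv: "sing_val (?D + t \<cdot>\<^sub>m B) i = s i + t * ((z i - s i) / e)" if t: "0 \<le> t" "t \<le> e" and i: "i < m" for t i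
  proof -
    define w where "w l = (1 - t / e) * s l + t / e * z l" for l
    have te: "0 \<le> t / e" "t / e \<le> 1" using t e by auto
    have "decreasing_nonneg m w"
    proof -
      have "(1 - q) * s j + q * z j \<le> (1 - q) * s i + q * z i" "0 \<le> (1 - q) * s j + q * z j"
        if "0 \<le> q" "q \<le> 1" "i \<le> j" "j < m" for q i j
        using that dec zdec unfolding decreasing_nonneg_def
        by (auto intro!: add_mono mult_left_mono add_nonneg_nonneg mult_nonneg_nonneg)
      from this[OF te] show ?thesis unfolding decreasing_nonneg_def w_def by blast
    qed
    moreover have "?D + t \<cdot>\<^sub>m B = P * rect_diag m n w * transpose_mat R"
    proof (rule eq_matI)
      fix i k assume "i < dim_row (P * rect_diag m n w * transpose_mat R)" "k < dim_col (P * rect_diag m n w * transpose_mat R)"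
      then have ik: "i < m" "k < n" using P' R' by auto
      have "(P * rect_diag m n w * transpose_mat R) $$ (i,k)
          = (1 - t / e) * (P * ?D * transpose_mat R) $$ (i,k) + t / e * (P * rect_diag m n z * transpose_mat R) $$ (i,k)"
        unfolding rect_diag_sandwich_index[OF P'(1) R'(1) mn ik]
        by (simp only: w_def sum_distrib_left sum.distrib[symmetric]) (simp only: distrib_right mult.assoc)
      also have "\<dots> = (1 - t / e) * ?D $$ (i,k) + t / e * Y $$ (i,k)"
        by (simp only: DD YD[symmetric])
      also have "\<dots> = (?D + t \<cdot>\<^sub>m B) $$ (i,k)"
        using ik B e by (simp add: Y_def field_simps)
      finally show "(?D + t \<cdot>\<^sub>m B) $$ (i,k) = (P * rect_diag m n w * transpose_mat R) $$ (i,k)" by simp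
    qed (use B P' R' in auto)
    ultimately have "sing_val (?D + t \<cdot>\<^sub>m B) i = w i"
      using sing_val_unique[OF mn P R _ i] by simp
    then show ?thesis using e by (simp add: w_def field_simps)
  qed
  show ?thesis by (rule exI[of _ e], rule conjI[OF e], rule exI[of _ "\<lambda>i. (z i - s i) / e"]) (auto simp: sv)
qed

section \<open>Orthogonal curves and second order expansions\<close>

lemma skew_quadratic_form_zero:
  fixes A :: "real mat"
  assumes A: "A \<in> carrier_mat p p" and skew: "transpose_mat A = - A" and v: "v \<in> carrier_vec p"
  shows "v \<bullet> (A *\<^sub>v v) = 0"
proof -
  have skew': "A $$ (j,i) = - A $$ (i,j)" if "i < p" "j < p" for i j
    using arg_cong[OF skew, of "\<lambda>M. M $$ (i,j)"] A that by simp
  have "(\<Sum>i<p. \<Sum>j<p. v $ i * A $$ (i,j) * v $ j) = (\<Sum>i<p. \<Sum>j<p. - (v $ j * A $$ (j,i) * v $ i))"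
  proof (intro sum.cong refl)
    fix i j assume "i \<in> {..<p}" "j \<in> {..<p}"
    then show "v $ i * A $$ (i,j) * v $ j = - (v $ j * A $$ (j,i) * v $ i)"
      by (simp add: skew'[of i j])
  qed
  also have "\<dots> = - (\<Sum>j<p. \<Sum>i<p. v $ j * A $$ (j,i) * v $ i)"
    by (subst sum.swap) (simp add: sum_negf)
  finally have "(\<Sum>i<p. \<Sum>j<p. v $ i * A $$ (i,j) * v $ j) = 0" by simp
  then show ?thesis
    using A v by (simp add: scalar_prod_def lessThan_atLeast0 sum_distrib_left mult.assoc)
qed

text \<open>
  The Cayley transform \<open>Q = (1 + A) (1 - A)\<^sup>-\<^sup>1\<close> is orthogonal for skew \<open>A\<close>, and the implicit equation for
  \<open>Q\<close> yields its Taylor expansion by substituting it into itself.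
\<close>

lemma cayley_orthogonal:
  fixes A :: "real mat"
  assumes A: "A \<in> carrier_mat p p" and skew: "transpose_mat A = - A"
  shows "\<exists>Q \<in> orth_group p. Q = 1\<^sub>m p + A + Q * A"
proof -
  let ?M = "1\<^sub>m p - A" and ?N = "1\<^sub>m p + A"
  have M: "?M \<in> carrier_mat p p" and N: "?N \<in> carrier_mat p p" using A by auto
  have Mt: "transpose_mat ?M = ?N"
  proof (rule eq_matI)
    fix i j assume "i < dim_row ?N" "j < dim_col ?N"
    then show "transpose_mat ?M $$ (i,j) = ?N $$ (i,j)"
      using arg_cong[OF skew, of "\<lambda>M. M $$ (i,j)"] A by auto
  qed (use A in auto)
  have Nt: "transpose_mat ?N = ?M" using Mt by (metis transpose_transpose)
  have "det ?M \<noteq> 0"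
  proof
    assume "det ?M = 0"
    then obtain v where v: "v \<in> carrier_vec p" "v \<noteq> 0\<^sub>v p" "?M *\<^sub>v v = 0\<^sub>v p"
      using M by (auto simp: det_0_iff_vec_prod_zero)
    have "?M *\<^sub>v v = v - A *\<^sub>v v" using A v by (simp add: minus_mult_distrib_mat_vec[of _ p p])
    then have "v - A *\<^sub>v v = 0\<^sub>v p" using v by simp
    then have "v \<bullet> (v - A *\<^sub>v v) = 0" using v by simp
    then have "v \<bullet> v = 0"
      using skew_quadratic_form_zero[OF A skew v(1)] A v(1) by (simp add: scalar_prod_minus_distrib[of _ p])
    then have "(\<Sum>i<p. v $ i * v $ i) = 0" using v(1) by (simp add: scalar_prod_def lessThan_atLeast0)
    then have "\<forall>i\<in>{..<p}. v $ i * v $ i = 0" by (subst (asm) sum_nonneg_eq_0_iff) auto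
    then have "v = 0\<^sub>v p" using v(1) by (intro eq_vecI) auto
    then show False using v(2) by simp
  qed
  then have "?M \<in> Units (ring_mat TYPE(real) p ())" using M by (intro det_non_zero_imp_unit)
  then obtain I where I: "I \<in> carrier_mat p p" "I * ?M = 1\<^sub>m p" "?M * I = 1\<^sub>m p"
    by (auto simp: Units_def ring_mat_simps)
  define Q where "Q = ?N * I"
  have Q: "Q \<in> carrier_mat p p" using N I by (simp add: Q_def)
  have QM: "Q * ?M = ?N"
    unfolding Q_def assoc_mult_mat[OF N I(1) M] I(2) by (rule right_mult_one_mat[OF N])
  have comm: "?M * ?N = ?N * ?M"
  proof -
    have one: "1\<^sub>m p \<in> carrier_mat p p" by simp
    have "?M * ?N = ?M + (A - A * A)"
      unfolding mult_add_distrib_mat[OF M one A] minus_mult_distrib_mat[OF one A A]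
      by (simp only: right_mult_one_mat[OF M] left_mult_one_mat[OF A])
    moreover have "?N * ?M = ?N - (A + A * A)"
      unfolding mult_minus_distrib_mat[OF N one A] add_mult_distrib_mat[OF one A A]
      by (simp only: right_mult_one_mat[OF N] left_mult_one_mat[OF A])
    moreover have "?M + (A - A * A) = ?N - (A + A * A)"
      using A mult_carrier_mat[OF A A] by (intro eq_matI) (auto simp del: index_mult_mat(1))
    ultimately show ?thesis by simp
  qed
  have It: "transpose_mat I * ?N = 1\<^sub>m p"
  proof -
    have "transpose_mat I * transpose_mat ?M = transpose_mat (?M * I)"
      by (rule transpose_mult[OF M I(1), symmetric])
    then show ?thesis by (simp only: I Mt transpose_one)
  qed
  have Itc: "transpose_mat I \<in> carrier_mat p p" using I(1) by simp
  have "transpose_mat Q * Q = transpose_mat I * ?M * (?N * I)"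
    by (simp only: Q_def transpose_mult[OF N I(1)] Nt)
  also have "\<dots> = transpose_mat I * (?M * (?N * I))"
    by (rule assoc_mult_mat[OF Itc M mult_carrier_mat[OF N I(1)]])
  also have "?M * (?N * I) = ?N * (?M * I)"
    by (simp only: assoc_mult_mat[OF M N I(1), symmetric] comm assoc_mult_mat[OF N M I(1)])
  also have "\<dots> = ?N" by (simp only: I(3) right_mult_one_mat[OF N])
  also note It
  finally have "Q \<in> orth_group p" using Q by (simp add: orth_group_def)
  moreover have "Q = 1\<^sub>m p + A + Q * A"
  proof (rule eq_matI)
    fix i j assume "i < dim_row (1\<^sub>m p + A + Q * A)" "j < dim_col (1\<^sub>m p + A + Q * A)"
    then have ij: "i < p" "j < p" using Q A by auto
    have "Q * ?M = Q - Q * A"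
      unfolding mult_minus_distrib_mat[OF Q one_carrier_mat A] by (simp only: right_mult_one_mat[OF Q])
    then have "(Q - Q * A) $$ (i,j) = ?N $$ (i,j)" using QM by simp
    then show "Q $$ (i,j) = (1\<^sub>m p + A + Q * A) $$ (i,j)"
      using ij Q A by (simp del: index_mult_mat(1))
  qed (use Q A in auto)
  ultimately show ?thesis by blast
qed

text \<open>
  The shape of this limit is that of the parabolic second derivative, up to the factor \<open>1/2\<close>.
\<close>

definition quad_expansion :: "(real \<Rightarrow> real) \<Rightarrow> real \<Rightarrow> real \<Rightarrow> real \<Rightarrow> bool" where
  "quad_expansion f a0 a1 a2 \<longleftrightarrow> ((\<lambda>t. (f t - a0 - a1 * t) / t\<^sup>2) \<longlongrightarrow> a2) (at_right 0)"

lemma quad_expansion_poly: "quad_expansion (\<lambda>t. a0 + a1 * t + a2 * t\<^sup>2) a0 a1 a2"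
proof -
  have "((\<lambda>t. a2) \<longlongrightarrow> a2) (at_right (0::real))" by simp
  then show ?thesis unfolding quad_expansion_def
    by (rule Lim_transform_eventually) (rule eventually_mono[OF eventually_at_right_less], simp)
qed

lemma quad_expansion_mult:
  assumes "quad_expansion f a0 a1 a2" "quad_expansion g b0 b1 b2"
  shows "quad_expansion (\<lambda>t. f t * g t) (a0 * b0) (a0 * b1 + a1 * b0) (a0 * b2 + a1 * b1 + a2 * b0)"
proof -
  let ?F = "\<lambda>t. (f t - a0 - a1 * t) / t\<^sup>2" and ?G = "\<lambda>t. (g t - b0 - b1 * t) / t\<^sup>2"
  have "((\<lambda>t. a0 * ?G t + a1 * b1 + ?F t * b0 + t * (a1 * ?G t + b1 * ?F t) + t\<^sup>2 * (?F t * ?G t))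
      \<longlongrightarrow> a0 * b2 + a1 * b1 + a2 * b0 + 0 * (a1 * b2 + b1 * a2) + 0\<^sup>2 * (a2 * b2)) (at_right 0)"
    using assms unfolding quad_expansion_def by (intro tendsto_intros)
  then have "((\<lambda>t. a0 * ?G t + a1 * b1 + ?F t * b0 + t * (a1 * ?G t + b1 * ?F t) + t\<^sup>2 * (?F t * ?G t))
      \<longlongrightarrow> a0 * b2 + a1 * b1 + a2 * b0) (at_right 0)" by simp
  then show ?thesis unfolding quad_expansion_def
  proof (rule Lim_transform_eventually, intro eventually_mono[OF eventually_at_right_less])
    fix t :: real assume t: "0 < t"
    have f: "f t = a0 + a1 * t + ?F t * t\<^sup>2" and g: "g t = b0 + b1 * t + ?G t * t\<^sup>2"
      using t by auto
    have "f t * g t - a0 * b0 - (a0 * b1 + a1 * b0) * t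
      = (a0 * ?G t + a1 * b1 + ?F t * b0 + t * (a1 * ?G t + b1 * ?F t) + t\<^sup>2 * (?F t * ?G t)) * t\<^sup>2"
      by (subst f, subst g) (simp only: algebra_simps power2_eq_square)
    then show "a0 * ?G t + a1 * b1 + ?F t * b0 + t * (a1 * ?G t + b1 * ?F t) + t\<^sup>2 * (?F t * ?G t)
      = (f t * g t - a0 * b0 - (a0 * b1 + a1 * b0) * t) / t\<^sup>2"
      using t by (simp only: nonzero_mult_div_cancel_right) simp
  qed
qed

lemma quad_expansion_sum:
  assumes "\<And>i. i \<in> I \<Longrightarrow> quad_expansion (f i) (a0 i) (a1 i) (a2 i)"
  shows "quad_expansion (\<lambda>t. \<Sum>i\<in>I. f i t) (\<Sum>i\<in>I. a0 i) (\<Sum>i\<in>I. a1 i) (\<Sum>i\<in>I. a2 i)"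
proof -
  have "((\<lambda>t. \<Sum>i\<in>I. (f i t - a0 i - a1 i * t) / t\<^sup>2) \<longlongrightarrow> (\<Sum>i\<in>I. a2 i)) (at_right 0)"
    using assms unfolding quad_expansion_def by (intro tendsto_sum)
  moreover have "(\<lambda>t. \<Sum>i\<in>I. (f i t - a0 i - a1 i * t) / t\<^sup>2)
      = (\<lambda>t. ((\<Sum>i\<in>I. f i t) - (\<Sum>i\<in>I. a0 i) - (\<Sum>i\<in>I. a1 i) * t) / t\<^sup>2)"
    by (simp add: sum_subtractf sum_distrib_right flip: sum_divide_distrib)
  ultimately show ?thesis unfolding quad_expansion_def by simp
qed

definition mat_expansion :: "nat \<Rightarrow> nat \<Rightarrow> (real \<Rightarrow> real mat) \<Rightarrow> real mat \<Rightarrow> real mat \<Rightarrow> real mat \<Rightarrow> bool" where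
  "mat_expansion m n M A0 A1 A2 \<longleftrightarrow> (\<forall>t. M t \<in> carrier_mat m n)
     \<and> A0 \<in> carrier_mat m n \<and> A1 \<in> carrier_mat m n \<and> A2 \<in> carrier_mat m n
     \<and> (\<forall>i<m. \<forall>j<n. quad_expansion (\<lambda>t. M t $$ (i,j)) (A0 $$ (i,j)) (A1 $$ (i,j)) (A2 $$ (i,j)))"

lemma mat_expansion_mult:
  assumes "mat_expansion m p M A0 A1 A2" "mat_expansion p n N B0 B1 B2"
  shows "mat_expansion m n (\<lambda>t. M t * N t) (A0 * B0) (A0 * B1 + A1 * B0) (A0 * B2 + A1 * B1 + A2 * B0)"
proof -
  have car: "M t \<in> carrier_mat m p" "N t \<in> carrier_mat p n" "A0 \<in> carrier_mat m p" "A1 \<in> carrier_mat m p"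
    "A2 \<in> carrier_mat m p" "B0 \<in> carrier_mat p n" "B1 \<in> carrier_mat p n" "B2 \<in> carrier_mat p n" for t
    using assms by (auto simp: mat_expansion_def)
  have "quad_expansion (\<lambda>t. (M t * N t) $$ (i,j)) ((A0 * B0) $$ (i,j)) ((A0 * B1 + A1 * B0) $$ (i,j))
      ((A0 * B2 + A1 * B1 + A2 * B0) $$ (i,j))" if ij: "i < m" "j < n" for i j
  proof -
    have "quad_expansion (\<lambda>t. \<Sum>k<p. M t $$ (i,k) * N t $$ (k,j)) (\<Sum>k<p. A0 $$ (i,k) * B0 $$ (k,j))
        (\<Sum>k<p. A0 $$ (i,k) * B1 $$ (k,j) + A1 $$ (i,k) * B0 $$ (k,j))
        (\<Sum>k<p. A0 $$ (i,k) * B2 $$ (k,j) + A1 $$ (i,k) * B1 $$ (k,j) + A2 $$ (i,k) * B0 $$ (k,j))"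
    proof (rule quad_expansion_sum)
      fix k assume "k \<in> {..<p}"
      then show "quad_expansion (\<lambda>t. M t $$ (i,k) * N t $$ (k,j)) (A0 $$ (i,k) * B0 $$ (k,j))
        (A0 $$ (i,k) * B1 $$ (k,j) + A1 $$ (i,k) * B0 $$ (k,j))
        (A0 $$ (i,k) * B2 $$ (k,j) + A1 $$ (i,k) * B1 $$ (k,j) + A2 $$ (i,k) * B0 $$ (k,j))"
        using assms ij unfolding mat_expansion_def by (intro quad_expansion_mult) blast+
    qed
    moreover have "(A0 * B1 + A1 * B0) $$ (i,j) = (\<Sum>k<p. A0 $$ (i,k) * B1 $$ (k,j) + A1 $$ (i,k) * B0 $$ (k,j))"
      using car ij by (simp add: mat_mult_sum[of _ m p _ n] sum.distrib del: index_mult_mat(1))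
    moreover have "(A0 * B2 + A1 * B1 + A2 * B0) $$ (i,j)
        = (\<Sum>k<p. A0 $$ (i,k) * B2 $$ (k,j) + A1 $$ (i,k) * B1 $$ (k,j) + A2 $$ (i,k) * B0 $$ (k,j))"
      using car ij by (simp add: mat_mult_sum[of _ m p _ n] sum.distrib del: index_mult_mat(1))
    ultimately show ?thesis by (simp only: mat_mult_sum[OF car(1,2) ij] mat_mult_sum[OF car(3,6) ij])
  qed
  moreover have "M t * N t \<in> carrier_mat m n" "A0 * B0 \<in> carrier_mat m n" "A0 * B1 + A1 * B0 \<in> carrier_mat m n"
    "A0 * B2 + A1 * B1 + A2 * B0 \<in> carrier_mat m n" for t
    by (intro add_carrier_mat mult_carrier_mat[of _ m p _ n] car)+
  ultimately show ?thesis by (simp add: mat_expansion_def del: index_mult_mat(1) index_add_mat(1))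
qed

text \<open>
  The Cayley transform of \<open>t K / 2\<close>. Its remainder is \<open>t\<^sup>3 (1 + Q) K\<^sup>3 / 8\<close>, where the entries of the
  orthogonal factor are bounded by 1.
\<close>

lemma orthogonal_curve:
  fixes K :: "real mat"
  assumes K: "K \<in> carrier_mat p p" and skew: "transpose_mat K = - K"
  shows "\<exists>Q. (\<forall>t. Q t \<in> orth_group p) \<and> mat_expansion p p Q (1\<^sub>m p) K ((1/2) \<cdot>\<^sub>m (K * K))"
proof -
  have "\<exists>Q \<in> orth_group p. Q = 1\<^sub>m p + (t/2) \<cdot>\<^sub>m K + Q * ((t/2) \<cdot>\<^sub>m K)" for t
  proof (rule cayley_orthogonal)
    show "transpose_mat ((t/2) \<cdot>\<^sub>m K) = - ((t/2) \<cdot>\<^sub>m K)"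
    proof (rule eq_matI)
      fix i j assume "i < dim_row (- ((t/2) \<cdot>\<^sub>m K))" "j < dim_col (- ((t/2) \<cdot>\<^sub>m K))"
      then have ij: "i < p" "j < p" using K by auto
      have "transpose_mat K $$ (i,j) = (- K) $$ (i,j)" by (simp only: skew)
      then show "transpose_mat ((t/2) \<cdot>\<^sub>m K) $$ (i,j) = (- ((t/2) \<cdot>\<^sub>m K)) $$ (i,j)"
        using K ij by simp
    qed (use K in auto)
  qed (use K in simp)
  then obtain Q where Q: "\<And>t. Q t \<in> orth_group p" "\<And>t. Q t = 1\<^sub>m p + (t/2) \<cdot>\<^sub>m K + Q t * ((t/2) \<cdot>\<^sub>m K)"
    by metis
  note Qc = orth_groupD(1)[OF Q(1)]
  have rec: "Q t = 1\<^sub>m p + (t/2) \<cdot>\<^sub>m K + (t/2) \<cdot>\<^sub>m (Q t * K)" for t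
    by (subst Q(2)) (simp only: mult_smult_distrib[OF Qc K])
  have rec': "Q t * B = B + (t/2) \<cdot>\<^sub>m (K * B) + (t/2) \<cdot>\<^sub>m (Q t * (K * B))" if B: "B \<in> carrier_mat p p" for t B
  proof -
    have c: "(t/2) \<cdot>\<^sub>m K \<in> carrier_mat p p" "Q t * K \<in> carrier_mat p p" "(t/2) \<cdot>\<^sub>m (Q t * K) \<in> carrier_mat p p"
      "1\<^sub>m p + (t/2) \<cdot>\<^sub>m K \<in> carrier_mat p p" using Qc[of t] K by auto
    have "Q t * B = (1\<^sub>m p + (t/2) \<cdot>\<^sub>m K + (t/2) \<cdot>\<^sub>m (Q t * K)) * B"
      using rec[of t] by (rule arg_cong)
    also have "\<dots> = 1\<^sub>m p * B + (t/2) \<cdot>\<^sub>m K * B + (t/2) \<cdot>\<^sub>m (Q t * K) * B"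
      by (simp only: add_mult_distrib_mat[OF c(4,3) B] add_mult_distrib_mat[OF one_carrier_mat c(1) B])
    also have "\<dots> = B + (t/2) \<cdot>\<^sub>m (K * B) + (t/2) \<cdot>\<^sub>m (Q t * (K * B))"
      by (simp only: left_mult_one_mat[OF B] mult_smult_assoc_mat[OF K B] mult_smult_assoc_mat[OF c(2) B]
        assoc_mult_mat[OF Qc K B])
    finally show ?thesis .
  qed
  let ?K2 = "K * K" and ?K3 = "K * (K * K)"
  have exp: "Q t $$ (i,j) = 1\<^sub>m p $$ (i,j) + K $$ (i,j) * t + (1/2 * ?K2 $$ (i,j) + t/8 * (?K3 $$ (i,j) + (Q t * ?K3) $$ (i,j))) * t\<^sup>2"
    if ij: "i < p" "j < p" for i j t
  proof -
    have e1: "Q t $$ (i,j) = 1\<^sub>m p $$ (i,j) + t/2 * K $$ (i,j) + t/2 * (Q t * K) $$ (i,j)"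
      using arg_cong[OF rec[of t], of "\<lambda>M. M $$ (i,j)"] ij K Qc[of t] by (simp del: index_mult_mat(1) index_one_mat(1))
    have e2: "(Q t * B) $$ (i,j) = B $$ (i,j) + t/2 * (K * B) $$ (i,j) + t/2 * (Q t * (K * B)) $$ (i,j)"
      if B: "B \<in> carrier_mat p p" for B
      using arg_cong[OF rec'[of B t], of "\<lambda>M. M $$ (i,j)"] B ij K Qc[of t] by (simp del: index_mult_mat(1))
    show ?thesis
      unfolding e1 e2[OF K] e2[OF mult_carrier_mat[OF K K]] by (simp only: algebra_simps power2_eq_square) simp
  qed
  have bnd: "\<bar>(Q t * ?K3) $$ (i,j)\<bar> \<le> (\<Sum>l<p. \<bar>?K3 $$ (l,j)\<bar>)" if ij: "i < p" "j < p" for i j t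
  proof -
    have "(Q t * ?K3) $$ (i,j) = (\<Sum>l<p. Q t $$ (i,l) * ?K3 $$ (l,j))"
      using ij K Qc[of t] by (simp add: scalar_prod_def[of "row (Q t) i"] lessThan_atLeast0 del: index_mult_mat(1)) 
        (simp add: scalar_prod_def[of "row (Q t) i"] lessThan_atLeast0)
    also have "\<bar>\<dots>\<bar> \<le> (\<Sum>l<p. \<bar>Q t $$ (i,l)\<bar> * \<bar>?K3 $$ (l,j)\<bar>)"
      by (simp only: sum_abs abs_mult[symmetric])
    also have "\<dots> \<le> (\<Sum>l<p. 1 * \<bar>?K3 $$ (l,j)\<bar>)"
      by (intro sum_mono mult_right_mono) (use orth_entry_le_1[OF Q(1)] ij in auto)
    finally show ?thesis by simp
  qed
  have "quad_expansion (\<lambda>t. Q t $$ (i,j)) (1\<^sub>m p $$ (i,j)) (K $$ (i,j)) (((1/2) \<cdot>\<^sub>m ?K2) $$ (i,j))"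
    if ij: "i < p" "j < p" for i j
  proof -
    let ?r = "\<lambda>t. ?K3 $$ (i,j) + (Q t * ?K3) $$ (i,j)" and ?c = "\<bar>?K3 $$ (i,j)\<bar> + (\<Sum>l<p. \<bar>?K3 $$ (l,j)\<bar>)"
    have "((\<lambda>t. t/8 * ?r t) \<longlongrightarrow> 0) (at_right 0)"
    proof (rule tendsto_0_le[where K = ?c])
      show "\<forall>\<^sub>F t in at_right 0. norm (t/8 * ?r t) \<le> norm t * ?c"
      proof (rule eventually_mono[OF eventually_at_right_less])
        fix t :: real assume t: "0 < t"
        have "\<bar>?r t\<bar> \<le> ?c" using bnd[OF ij, of t] by linarith
        then have "t/8 * \<bar>?r t\<bar> \<le> t * ?c" using t by (intro mult_mono) auto
        then show "norm (t/8 * ?r t) \<le> norm t * ?c" using t by (simp only: real_norm_def abs_mult)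
      qed
      show "((\<lambda>t::real. t) \<longlongrightarrow> 0) (at_right 0)" by (rule tendsto_ident_at)
    qed
    then have "((\<lambda>t. 1/2 * ?K2 $$ (i,j) + t/8 * ?r t) \<longlongrightarrow> 1/2 * ?K2 $$ (i,j) + 0) (at_right 0)"
      by (intro tendsto_add tendsto_const)
    then have "((\<lambda>t. 1/2 * ?K2 $$ (i,j) + t/8 * ?r t) \<longlongrightarrow> ((1/2) \<cdot>\<^sub>m ?K2) $$ (i,j)) (at_right 0)"
      using ij K by (simp del: index_mult_mat(1))
    then show ?thesis unfolding quad_expansion_def
    proof (rule Lim_transform_eventually, intro eventually_mono[OF eventually_at_right_less])
      fix t :: real assume t: "0 < t"
      show "1/2 * ?K2 $$ (i,j) + t/8 * ?r t = (Q t $$ (i,j) - 1\<^sub>m p $$ (i,j) - K $$ (i,j) * t) / t\<^sup>2"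
        unfolding exp[OF ij, of t] using t by (simp del: index_mult_mat(1) index_one_mat(1))
    qed
  qed
  then have "mat_expansion p p Q (1\<^sub>m p) K ((1/2) \<cdot>\<^sub>m (K * K))"
    using Qc K by (simp add: mat_expansion_def)
  then show ?thesis using Q(1) by blast
qed

section \<open>Existence of the second order directional derivatives\<close>

lemma sing_val_square_root_char_poly:
  assumes mn: "m \<le> n" and Z: "Z \<in> carrier_mat m n" and i: "i < m"
  shows "poly (char_poly (Z * transpose_mat Z)) (sing_val Z i * sing_val Z i) = 0"
proof -
  obtain U V where "U \<in> orth_group m" "V \<in> orth_group n"
    "Z = U * rect_diag m n (sing_val Z) * transpose_mat V"
    using svd_exists[OF mn Z] by blast
  from gram_char_poly[OF mn this]
  have "char_poly (Z * transpose_mat Z) = (\<Prod>i\<leftarrow>[0..<m]. [:- (sing_val Z i * sing_val Z i), 1:])" .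
  moreover have "poly (\<Prod>i\<leftarrow>is. [:- f i, 1:]) (f j) = 0" if "j \<in> set is" for f :: "nat \<Rightarrow> real" and j "is"
    using that by (induction "is") auto
  from this[of i "[0..<m]" "\<lambda>i. sing_val Z i * sing_val Z i"] i
  have "poly (\<Prod>i\<leftarrow>[0..<m]. [:- (sing_val Z i * sing_val Z i), 1:]) (sing_val Z i * sing_val Z i) = 0"
    by simp
  ultimately show ?thesis by simp
qed

lemma det_char_matrix_iff:
  fixes A :: "real mat"
  assumes "A \<in> carrier_mat m m"
  shows "det (char_matrix A x) = 0 \<longleftrightarrow> poly (char_poly A) x = 0"
  using assms by (simp add: eigenvalue_root_char_poly[symmetric] eigenvalue_det)

text \<open>
  If \<open>\<sigma>\<^sub>i(Z(t)) = y(t)\<close> for the parabola \<open>y\<close> with coefficient \<open>c\<close>, then \<open>det (Z(t) Z(t)\<^sup>T - y(t)\<^sup>2)\<close>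
  vanishes, and this is a polynomial in \<open>t\<close>. It can be the zero polynomial only for the finitely many
  \<open>c\<close> for which \<open>y(1)\<^sup>2\<close> is a root of the characteristic polynomial at \<open>t = 1\<close>.
\<close>

lemma sing_val_hits_parabola_finitely_often:
  fixes A H W :: "real mat"
  assumes mn: "m \<le> n" and A: "A \<in> carrier_mat m n" and H: "H \<in> carrier_mat m n" and W: "W \<in> carrier_mat m n"
    and i: "i < m"
  defines "Z \<equiv> \<lambda>t. A + t \<cdot>\<^sub>m H + (1/2 * t\<^sup>2) \<cdot>\<^sub>m W"
  shows "finite {c. infinite {t. sing_val (Z t) i = x0 + x1 * t + 1/2 * c * t\<^sup>2}}"
proof -
  have Zc: "Z t \<in> carrier_mat m n" for t using A H W by (simp add: Z_def)
  define P where "P i j = [:A $$ (i,j), H $$ (i,j), W $$ (i,j) / 2:]" for i j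
  define M where "M c = mat m m (\<lambda>(i,j). (\<Sum>k<n. P i k * P j k) - (if i = j then [:x0, x1, c/2:] * [:x0, x1, c/2:] else 0))" for c
  have PZ: "poly (P a b) t = Z t $$ (a,b)" if "a < m" "b < n" for a b t
    using that A H W by (simp add: P_def Z_def power2_eq_square algebra_simps)
  let ?y = "\<lambda>c t. x0 + x1 * t + 1/2 * c * t\<^sup>2"
  have detM: "poly (det (M c)) t = det (char_matrix (Z t * transpose_mat (Z t)) (?y c t * ?y c t))" for c t
  proof -
    have "comm_ring_hom (\<lambda>p. poly p t)" by unfold_locales auto
    then have "poly (det (M c)) t = det (map_mat (\<lambda>p. poly p t) (M c))"
      by (rule comm_ring_hom.hom_det[symmetric])
    also have "map_mat (\<lambda>p. poly p t) (M c) = char_matrix (Z t * transpose_mat (Z t)) (?y c t * ?y c t)"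
      using Zc[of t] by (intro eq_matI)
        (auto simp: M_def char_matrix_def poly_sum PZ scalar_prod_def lessThan_atLeast0 power2_eq_square algebra_simps)
    finally show ?thesis .
  qed
  have Zsq: "Z t * transpose_mat (Z t) \<in> carrier_mat m m" for t using Zc[of t] by simp
  have root: "poly (det (M c)) t = 0 \<longleftrightarrow> poly (char_poly (Z t * transpose_mat (Z t))) (?y c t * ?y c t) = 0" for c t
    unfolding detM by (rule det_char_matrix_iff[OF Zsq])
  have hit: "{t. sing_val (Z t) i = ?y c t} \<subseteq> {t. poly (det (M c)) t = 0}" for c
  proof safe
    fix t assume "sing_val (Z t) i = ?y c t"
    with sing_val_square_root_char_poly[OF mn Zc[of t] i]
    show "poly (det (M c)) t = 0" unfolding root by simp
  qed
  let ?R = "{x. poly (char_poly (Z 1 * transpose_mat (Z 1))) x = 0}"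
  have "char_poly (Z 1 * transpose_mat (Z 1)) \<noteq> 0"
    using degree_monic_char_poly[OF Zsq[of 1]] by auto
  then have "finite ?R" by (rule poly_roots_finite)
  then have fin: "finite (\<Union>r\<in>?R. {2 * (sqrt r - x0 - x1), 2 * (- sqrt r - x0 - x1)})" by auto
  have "{c. infinite {t. sing_val (Z t) i = ?y c t}} \<subseteq> (\<Union>r\<in>?R. {2 * (sqrt r - x0 - x1), 2 * (- sqrt r - x0 - x1)})"
  proof
    fix c assume "c \<in> {c. infinite {t. sing_val (Z t) i = ?y c t}}"
    then have "infinite {t. poly (det (M c)) t = 0}" using hit finite_subset by blast
    then have "det (M c) = 0" using poly_roots_finite by blast
    then have "?y c 1 * ?y c 1 \<in> ?R" using root[of c 1] by simp
    moreover have "?y c 1 = sqrt (?y c 1 * ?y c 1) \<or> ?y c 1 = - sqrt (?y c 1 * ?y c 1)" by (auto simp: abs_if)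
    then have "c = 2 * (sqrt (?y c 1 * ?y c 1) - x0 - x1) \<or> c = 2 * (- sqrt (?y c 1 * ?y c 1) - x0 - x1)"
      by (auto simp del: real_sqrt_mult_self)
    ultimately show "c \<in> (\<Union>r\<in>?R. {2 * (sqrt r - x0 - x1), 2 * (- sqrt r - x0 - x1)})" by blast
  qed
  then show ?thesis using fin finite_subset by blast
qed

text \<open>
  By the intermediate value theorem the function eventually stays on one side of each level that it
  meets only finitely often. So it is eventually above every such level below
  \<open>Sup {c. eventually c < q}\<close> and below every such level above it.
\<close>

lemma limit_exists_if_levels_avoided:
  fixes q :: "real \<Rightarrow> real"
  assumes d: "d > 0" and cont: "continuous_on {0<..<d} q" and bnd: "\<And>t. 0 < t \<Longrightarrow> t < d \<Longrightarrow> \<bar>q t\<bar> \<le> C"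
    and fin: "finite {c. infinite {t. 0 < t \<and> t < d \<and> q t = c}}"
  shows "\<exists>L. (q \<longlongrightarrow> L) (at_right 0)"
proof -
  let ?E = "{c. infinite {t. 0 < t \<and> t < d \<and> q t = c}}"
  have dich: "(\<forall>\<^sub>F t in at_right 0. q t < c) \<or> (\<forall>\<^sub>F t in at_right 0. c < q t)" if c: "c \<notin> ?E" for c
  proof -
    let ?F = "{t. 0 < t \<and> t < d \<and> q t = c}"
    define r where "r = Min (insert d ?F)"
    have finF: "finite (insert d ?F)" using c by simp
    have "r \<in> insert d ?F" unfolding r_def using finF by (intro Min_in) auto
    then have r: "0 < r" "r \<le> d" using d by auto
    have ne: "q t \<noteq> c" if "0 < t" "t < r" for t
    proof
      assume "q t = c"
      then have "t \<in> ?F" using that r by simp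
      then have "r \<le> t" unfolding r_def using finF by (intro Min_le) auto
      then show False using that by simp
    qed
    have "connected (q ` {0<..<r})"
      using r cont by (intro connected_continuous_image) (auto intro: continuous_on_subset)
    moreover have "c \<notin> q ` {0<..<r}" using ne by force
    ultimately have "(\<forall>t. 0 < t \<and> t < r \<longrightarrow> q t < c) \<or> (\<forall>t. 0 < t \<and> t < r \<longrightarrow> c < q t)"
      using connectedD_interval[of "q ` {0<..<r}" _ _ c] ne
      by (metis (no_types, lifting) greaterThanLessThan_iff imageI linorder_less_linear order_less_imp_le)
    then show ?thesis using r(1) unfolding eventually_at_right[OF r(1)] by (metis r(1))
  qed
  have cofin: "\<exists>c. a < c \<and> c < b \<and> c \<notin> ?E" if "a < b" for a b
  proof -
    have "infinite {a<..<b}" using that by (simp add: infinite_Ioo)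
    then have "\<not> {a<..<b} \<subseteq> ?E" using fin finite_subset by blast
    then show ?thesis by auto
  qed
  define S where "S = {c. \<forall>\<^sub>F t in at_right 0. c < q t}"
  have ev: "\<forall>\<^sub>F t in at_right 0. - C - 1 < q t \<and> q t < C + 1"
    unfolding eventually_at_right[OF d] using bnd d by (intro bexI[of _ d] exI[of _ d]) (auto simp: abs_le_iff dest!: bnd)
  have ne: "- C - 1 \<in> S" using ev unfolding S_def by (auto elim: eventually_mono)
  have bdd: "c \<le> C + 1" if "c \<in> S" for c
  proof -
    have "\<forall>\<^sub>F t in at_right 0. c < q t \<and> (- C - 1 < q t \<and> q t < C + 1)"
      using that ev unfolding S_def by (auto intro: eventually_conj)
    then have "\<exists>t. c < q t \<and> (- C - 1 < q t \<and> q t < C + 1)"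
      by (rule eventually_happens'[rotated]) simp
    then show ?thesis by auto
  qed
  then have bddS: "bdd_above S" by (auto simp: bdd_above_def)
  let ?L = "Sup S"
  have "(q \<longlongrightarrow> ?L) (at_right 0)"
  proof (rule order_tendstoI)
    fix a assume "a < ?L"
    then obtain c where "c \<in> S" "a < c" using less_cSup_iff[of S a] ne bddS by auto
    then show "\<forall>\<^sub>F t in at_right 0. a < q t" unfolding S_def by (auto elim: eventually_mono)
  next
    fix a assume "?L < a"
    then obtain c where c: "?L < c" "c < a" "c \<notin> ?E" using cofin by blast
    then have "c \<notin> S" using cSup_upper[of c S] bddS by auto
    then have "\<forall>\<^sub>F t in at_right 0. q t < c" using dich[OF c(3)] by (auto simp: S_def)
    then show "\<forall>\<^sub>F t in at_right 0. q t < a" using c(2) by (auto elim: eventually_mono)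
  qed
  then show ?thesis by blast
qed

lemma tendsto_mat_l1_zero:
  assumes "\<And>t. M t \<in> carrier_mat m n" "\<And>i j. i < m \<Longrightarrow> j < n \<Longrightarrow> ((\<lambda>t. M t $$ (i,j)) \<longlongrightarrow> 0) F"
  shows "((\<lambda>t. mat_l1 (M t)) \<longlongrightarrow> 0) F"
proof -
  have "((\<lambda>t. \<Sum>i<m. \<Sum>j<n. \<bar>M t $$ (i,j)\<bar>) \<longlongrightarrow> (\<Sum>i<m. \<Sum>j<n. 0)) F"
    using assms by (intro tendsto_sum tendsto_rabs_zero) auto
  moreover have "mat_l1 (M t) = (\<Sum>i<m. \<Sum>j<n. \<bar>M t $$ (i,j)\<bar>)" for t
    using carrier_matD[OF assms(1)[of t]] by (simp add: mat_l1_def)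
  ultimately show ?thesis by simp
qed

lemma continuous_sing_val_curve:
  fixes A H W :: "real mat"
  assumes mn: "m \<le> n" and A: "A \<in> carrier_mat m n" and H: "H \<in> carrier_mat m n" and W: "W \<in> carrier_mat m n"
    and i: "i < m"
  shows "continuous_on T (\<lambda>t. sing_val (A + t \<cdot>\<^sub>m H + (1/2 * t\<^sup>2) \<cdot>\<^sub>m W) i)"
proof -
  let ?Z = "\<lambda>t. A + t \<cdot>\<^sub>m H + (1/2 * t\<^sup>2) \<cdot>\<^sub>m W"
  have Zc: "?Z t \<in> carrier_mat m n" for t using A H W by simp
  have "((\<lambda>t. sing_val (?Z t) i) \<longlongrightarrow> sing_val (?Z s) i) (at s within T)" for s
  proof -
    have l1: "((\<lambda>t. mat_l1 (?Z t - ?Z s)) \<longlongrightarrow> 0) (at s within T)"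
    proof (rule tendsto_mat_l1_zero[of _ m n])
      show "?Z t - ?Z s \<in> carrier_mat m n" for t by (rule minus_carrier_mat[OF Zc])
      fix a b assume ab: "a < m" "b < n"
      have "((\<lambda>t. (t - s) * H $$ (a,b) + (1/2 * (t\<^sup>2 - s\<^sup>2)) * W $$ (a,b))
        \<longlongrightarrow> (s - s) * H $$ (a,b) + (1/2 * (s\<^sup>2 - s\<^sup>2)) * W $$ (a,b)) (at s within T)"
        by (intro tendsto_intros)
      moreover have "(?Z t - ?Z s) $$ (a,b) = (t - s) * H $$ (a,b) + (1/2 * (t\<^sup>2 - s\<^sup>2)) * W $$ (a,b)" for t
        using ab A H W by (simp add: algebra_simps)
      ultimately show "((\<lambda>t. (?Z t - ?Z s) $$ (a,b)) \<longlongrightarrow> 0) (at s within T)"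
        by (simp only:) simp
    qed
    have "((\<lambda>t. sing_val (?Z t) i - sing_val (?Z s) i) \<longlongrightarrow> 0) (at s within T)"
      by (rule tendsto_0_le[OF l1, of _ 2])
        (use sing_val_lipschitz[OF mn i Zc Zc] mat_l1_nonneg in \<open>auto simp: mult.commute\<close>)
    then show ?thesis by (simp add: LIM_zero_iff)
  qed
  then show ?thesis by (simp add: continuous_on_def)
qed

theorem second_order_limit_exists:
  fixes A H W :: "real mat"
  assumes mn: "m \<le> n" and A: "A \<in> carrier_mat m n" and H: "H \<in> carrier_mat m n" and W: "W \<in> carrier_mat m n"
    and i: "i < m" and e: "e > 0"
  defines "Z \<equiv> \<lambda>t. A + t \<cdot>\<^sub>m H + (1/2 * t\<^sup>2) \<cdot>\<^sub>m W"
  assumes bnd: "\<And>t. 0 < t \<Longrightarrow> t < e \<Longrightarrow> \<bar>sing_val (Z t) i - x0 - x1 * t\<bar> \<le> C * t\<^sup>2"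
  shows "\<exists>L. ((\<lambda>t. (sing_val (Z t) i - x0 - x1 * t) / (1/2 * t\<^sup>2)) \<longlongrightarrow> L) (at_right 0)"
proof (rule limit_exists_if_levels_avoided[OF e])
  let ?q = "\<lambda>t. (sing_val (Z t) i - x0 - x1 * t) / (1/2 * t\<^sup>2)"
  show "continuous_on {0<..<e} ?q"
    unfolding Z_def by (intro continuous_intros continuous_sing_val_curve[OF mn A H W i]) auto
  show "\<bar>?q t\<bar> \<le> 2 * C" if "0 < t" "t < e" for t
    using bnd[OF that] that by (simp add: abs_mult field_simps)
  have "{c. infinite {t. 0 < t \<and> t < e \<and> ?q t = c}}
      \<subseteq> {c. infinite {t. sing_val (Z t) i = x0 + x1 * t + 1/2 * c * t\<^sup>2}}"
  proof safe
    fix c assume inf: "infinite {t. 0 < t \<and> t < e \<and> ?q t = c}"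
      and fin: "finite {t. sing_val (Z t) i = x0 + x1 * t + 1/2 * c * t\<^sup>2}"
    have "{t. 0 < t \<and> t < e \<and> ?q t = c} \<subseteq> {t. sing_val (Z t) i = x0 + x1 * t + 1/2 * c * t\<^sup>2}"
      by (auto simp: field_simps)
    then show False using inf fin finite_subset by blast
  qed
  then show "finite {c. infinite {t. 0 < t \<and> t < e \<and> ?q t = c}}"
    using sing_val_hits_parabola_finitely_often[OF mn A H W i, of x0 x1] unfolding Z_def
    by (rule finite_subset)
qed

section \<open>Subgradients and their singular vectors\<close>

lemma subdifferential_orth_invariant:
  assumes mn: "m \<le> n" and k: "k \<le> m" and P: "P \<in> orth_group m" and R: "R \<in> orth_group n"
    and X: "X \<in> carrier_mat m n" and S: "S \<in> subdifferential (ky_fan k) X"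
  shows "P * S * transpose_mat R \<in> subdifferential (ky_fan k) (P * X * transpose_mat R)"
proof -
  note P' = orth_groupD[OF P] and R' = orth_groupD[OF R]
  have Sc: "S \<in> carrier_mat m n" using S X by (auto simp: subdifferential_def)
  have PX: "P * X * transpose_mat R \<in> carrier_mat m n" and PS: "P * S * transpose_mat R \<in> carrier_mat m n"
    using P' R' X Sc by auto
  have "ky_fan k (P * X * transpose_mat R) + mat_inner (P * S * transpose_mat R) (Z - P * X * transpose_mat R)
      \<le> ky_fan k Z" if Z: "Z \<in> carrier_mat m n" for Z
  proof -
    let ?Z = "transpose_mat P * Z * R"
    have Zc: "?Z \<in> carrier_mat m n" using P' R' Z by auto
    have ZZ: "P * ?Z * transpose_mat R = Z"
    proof -
      have "P * ?Z = Z * R"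
        using orth_cancel(2)[OF P, of "Z * R" n] P' R' Z by (simp add: assoc_mult_mat[of _ m m _ n _ n])
      then show ?thesis using orth_cancel_right(2)[OF R Z] by simp
    qed
    have "ky_fan k (P * X * transpose_mat R) = ky_fan k X"
      by (rule ky_fan_orth_invariant[OF mn P R X k])
    moreover have "mat_inner (P * S * transpose_mat R) (Z - P * X * transpose_mat R)
        = mat_inner (P * S * transpose_mat R) Z - mat_inner (P * S * transpose_mat R) (P * X * transpose_mat R)"
      by (rule mat_inner_diff_right[OF PS Z PX])
    moreover have "mat_inner (P * S * transpose_mat R) (P * X * transpose_mat R) = mat_inner S X"
      by (rule mat_inner_orth_invariant[OF P R Sc X])
    moreover have "mat_inner (P * S * transpose_mat R) Z = mat_inner S ?Z"
      by (rule mat_inner_sandwich[OF P'(1) R'(1) Sc Z])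
    moreover have "mat_inner S (?Z - X) = mat_inner S ?Z - mat_inner S X"
      by (rule mat_inner_diff_right[OF Sc Zc X])
    moreover have "ky_fan k X + mat_inner S (?Z - X) \<le> ky_fan k ?Z"
      using S Zc X by (auto simp: subdifferential_def)
    moreover have "ky_fan k ?Z = ky_fan k Z"
      using ky_fan_orth_invariant[OF mn P R Zc k] ZZ by simp
    ultimately show ?thesis by linarith
  qed
  then show ?thesis
    using PS unfolding subdifferential_def carrier_matD[OF PX] by blast
qed

lemma subdifferential_monotone:
  assumes X: "X1 \<in> carrier_mat m n" "X2 \<in> carrier_mat m n"
    and S: "S1 \<in> subdifferential f X1" "S2 \<in> subdifferential f X2"
  shows "0 \<le> (\<Sum>i<m. \<Sum>j<n. (S1 $$ (i,j) - S2 $$ (i,j)) * (X1 $$ (i,j) - X2 $$ (i,j)))"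
proof -
  have Sc: "S1 \<in> carrier_mat m n" "S2 \<in> carrier_mat m n" using S X by (auto simp: subdifferential_def)
  have "f X1 + mat_inner S1 (X2 - X1) \<le> f X2" "f X2 + mat_inner S2 (X1 - X2) \<le> f X1"
    using S X by (auto simp: subdifferential_def)
  then have "mat_inner S1 (X2 - X1) + mat_inner S2 (X1 - X2) \<le> 0" by linarith
  moreover have "mat_inner S1 (X2 - X1) + mat_inner S2 (X1 - X2)
      = - (\<Sum>i<m. \<Sum>j<n. (S1 $$ (i,j) - S2 $$ (i,j)) * (X1 $$ (i,j) - X2 $$ (i,j)))"
    using X Sc
    by (simp add: mat_inner_entries[OF Sc(1) minus_carrier_mat[OF X(1)]] mat_inner_entries[OF Sc(2) minus_carrier_mat[OF X(2)]]
        left_diff_distrib right_diff_distrib sum_subtractf)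
  ultimately show ?thesis by linarith
qed

lemma subdifferential_sum_unique:
  assumes X: "X1 \<in> carrier_mat m n" "X2 \<in> carrier_mat m n"
    and S: "S1 \<in> subdifferential f X1" "S2 \<in> subdifferential f X2"
    and eq: "X1 + S1 = X2 + S2"
  shows "X1 = X2"
proof (rule eq_matI)
  have Sc: "S1 \<in> carrier_mat m n" "S2 \<in> carrier_mat m n" using S X by (auto simp: subdifferential_def)
  have d: "S1 $$ (i,j) - S2 $$ (i,j) = - (X1 $$ (i,j) - X2 $$ (i,j))" if "i < m" "j < n" for i j
    using arg_cong[OF eq, of "\<lambda>M. M $$ (i,j)"] that X Sc by simp
  have "0 \<le> (\<Sum>i<m. \<Sum>j<n. (S1 $$ (i,j) - S2 $$ (i,j)) * (X1 $$ (i,j) - X2 $$ (i,j)))"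
    by (rule subdifferential_monotone[OF X S])
  also have "\<dots> = (\<Sum>i<m. \<Sum>j<n. - ((X1 $$ (i,j) - X2 $$ (i,j)) * (X1 $$ (i,j) - X2 $$ (i,j))))"
    by (intro sum.cong refl) (simp only: d lessThan_iff mult_minus_left)
  also have "\<dots> = - (\<Sum>i<m. \<Sum>j<n. (X1 $$ (i,j) - X2 $$ (i,j)) * (X1 $$ (i,j) - X2 $$ (i,j)))"
    by (simp add: sum_negf)
  finally have le: "(\<Sum>i<m. \<Sum>j<n. (X1 $$ (i,j) - X2 $$ (i,j)) * (X1 $$ (i,j) - X2 $$ (i,j))) \<le> 0" by simp
  have nn: "0 \<le> (\<Sum>j<n. (X1 $$ (i,j) - X2 $$ (i,j)) * (X1 $$ (i,j) - X2 $$ (i,j)))" for i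
    by (intro sum_nonneg) simp
  have "(\<Sum>i<m. \<Sum>j<n. (X1 $$ (i,j) - X2 $$ (i,j)) * (X1 $$ (i,j) - X2 $$ (i,j))) = 0"
    by (rule antisym[OF le]) (intro sum_nonneg nn)
  then have rows: "\<forall>i\<in>{..<m}. (\<Sum>j<n. (X1 $$ (i,j) - X2 $$ (i,j)) * (X1 $$ (i,j) - X2 $$ (i,j))) = 0"
    using nn by (subst (asm) sum_nonneg_eq_0_iff) auto
  fix i j assume "i < dim_row X2" "j < dim_col X2"
  then have ij: "i < m" "j < n" using X by auto
  then have "(\<Sum>j<n. (X1 $$ (i,j) - X2 $$ (i,j)) * (X1 $$ (i,j) - X2 $$ (i,j))) = 0" using rows by simp
  then have "\<forall>j\<in>{..<n}. (X1 $$ (i,j) - X2 $$ (i,j)) * (X1 $$ (i,j) - X2 $$ (i,j)) = 0"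
    by (subst (asm) sum_nonneg_eq_0_iff) auto
  then show "X1 $$ (i,j) = X2 $$ (i,j)" using ij by simp
qed (use X in auto)

lemma transpose_mat_diag: "transpose_mat (mat_diag p e) = mat_diag p e"
  by (rule eq_matI) (auto simp: mat_diag_def)

lemma sign_flip_orth_group: "mat_diag p (\<lambda>l. if l = i then - 1 else (1::real)) \<in> orth_group p"
proof -
  have "(\<lambda>l. (if l = i then - 1 else 1) * (if l = i then - 1 else (1::real))) = (\<lambda>_. 1)" by auto
  then have "mat_diag p (\<lambda>l. (if l = i then - 1 else 1) * (if l = i then - 1 else (1::real))) = 1\<^sub>m p"
    by (simp only: mat_diag_one)
  then show ?thesis by (simp only: orth_group_def mem_Collect_eq mat_diag_dim transpose_mat_diag mat_diag_diag)
qed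

lemma sign_flip_index:
  fixes M :: "real mat"
  assumes "M \<in> carrier_mat m n" "a < m" "b < n"
  shows "(mat_diag m e * M * transpose_mat (mat_diag n f)) $$ (a,b) = e a * f b * M $$ (a,b)"
proof -
  show ?thesis
    using assms by (simp add: transpose_mat_diag mat_diag_mult_left[of _ m n] mat_diag_mult_right[of _ m n])
qed

definition perm_mat :: "nat \<Rightarrow> (nat \<Rightarrow> nat) \<Rightarrow> real mat" where
  "perm_mat p f = mat p p (\<lambda>(a, b). if a = f b then 1 else 0)"

lemma perm_mat_orth_group:
  assumes "\<And>a. a < p \<Longrightarrow> f a < p" "\<And>a b. a < p \<Longrightarrow> b < p \<Longrightarrow> f a = f b \<Longrightarrow> a = b"
  shows "perm_mat p f \<in> orth_group p"
proof -
  have "(\<Sum>k<p. (if k = f a then 1 else 0) * (if k = f b then 1 else (0::real))) = (if a = b then 1 else 0)"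
    if "a < p" "b < p" for a b
  proof -
    have "(\<Sum>k<p. (if k = f a then 1 else 0) * (if k = f b then 1 else (0::real)))
        = (\<Sum>k<p. if k = f a then (if a = b then 1 else 0) else 0)"
      using assms(2)[OF that] by (intro sum.cong) auto
    then show ?thesis using assms(1)[OF that(1)] by simp
  qed
  then show ?thesis by (simp add: orth_group_entries perm_mat_def)
qed

lemma perm_mat_rect_diag:
  assumes mn: "m \<le> n" and f: "\<And>a. a < m \<Longrightarrow> f a < m" "\<And>a. f (f a) = a"
  shows "perm_mat m f * rect_diag m n x * transpose_mat (perm_mat n f) = rect_diag m n (\<lambda>a. x (f a))"
proof (rule eq_matI)
  fix a b assume "a < dim_row (rect_diag m n (\<lambda>a. x (f a)))" "b < dim_col (rect_diag m n (\<lambda>a. x (f a)))"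
  then have ab: "a < m" "b < n" by auto
  have "(perm_mat m f * rect_diag m n x * transpose_mat (perm_mat n f)) $$ (a,b)
      = (\<Sum>l<m. x l * (perm_mat m f $$ (a,l) * perm_mat n f $$ (b,l)))"
    using mn ab by (intro rect_diag_sandwich_index) (auto simp: perm_mat_def)
  also have "\<dots> = (\<Sum>l<m. if l = f a then (if a = b then x (f a) else 0) else 0)"
  proof (intro sum.cong refl)
    fix l assume "l \<in> {..<m}"
    then have "l < m" "l < n" using mn by auto
    then show "x l * (perm_mat m f $$ (a,l) * perm_mat n f $$ (b,l))
        = (if l = f a then (if a = b then x (f a) else 0) else 0)"
      using ab f(2)[of l] f(2)[of a] by (auto simp: perm_mat_def)
  qed
  also have "\<dots> = (if a = b then x (f a) else 0)" using f(1)[OF ab(1)] by simp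
  finally show "(perm_mat m f * rect_diag m n x * transpose_mat (perm_mat n f)) $$ (a,b)
      = rect_diag m n (\<lambda>a. x (f a)) $$ (a,b)" using ab by simp
qed (auto simp: perm_mat_def)

lemma rect_diag_double_sum:
  assumes "m \<le> n"
  shows "(\<Sum>i<m. \<Sum>j<n. (rect_diag m n a $$ (i,j) - rect_diag m n b $$ (i,j))
      * (rect_diag m n c $$ (i,j) - rect_diag m n d $$ (i,j))) = (\<Sum>i<m. (a i - b i) * (c i - d i))"
proof (intro sum.cong refl)
  fix i assume "i \<in> {..<m}"
  then have i: "i < m" "i < n" using assms by auto
  have "(\<Sum>j<n. (rect_diag m n a $$ (i,j) - rect_diag m n b $$ (i,j))
      * (rect_diag m n c $$ (i,j) - rect_diag m n d $$ (i,j)))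
      = (\<Sum>j<n. if i = j then (a i - b i) * (c i - d i) else 0)"
    using i by (intro sum.cong) auto
  then show "(\<Sum>j<n. (rect_diag m n a $$ (i,j) - rect_diag m n b $$ (i,j))
      * (rect_diag m n c $$ (i,j) - rect_diag m n d $$ (i,j))) = (a i - b i) * (c i - d i)"
    using i by simp
qed

text \<open>
  Uniqueness of the decomposition \<open>X + S\<close> gives \<open>P X R\<^sup>T = X\<close> whenever \<open>P Diag(y) R\<^sup>T = Diag(y)\<close>. Sign
  flips of one row together with the column of the same index are such symmetries, and they force \<open>X\<close>
  and hence \<open>S\<close> to be diagonal. Monotonicity between \<open>(X, S)\<close> and its image under the flip of a single
  row gives \<open>s i * x i \<ge> 0\<close>, and under a transposition it gives that \<open>x\<close> and \<open>s\<close> are ordered alike; as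
  their sum \<open>y\<close> is nonnegative and decreasing, so are both summands.
\<close>

theorem subgradient_of_diagonal_sum:
  assumes mn: "m \<le> n" and k: "k \<le> m" and X: "X \<in> carrier_mat m n"
    and S: "S \<in> subdifferential (ky_fan k) X"
    and sum: "X + S = rect_diag m n y" and y: "decreasing_nonneg m y"
  shows "\<exists>x s. X = rect_diag m n x \<and> S = rect_diag m n s \<and> decreasing_nonneg m x \<and> decreasing_nonneg m s
    \<and> (\<forall>i<m. y i = x i + s i)"
proof -
  have Sc: "S \<in> carrier_mat m n" using S X by (auto simp: subdifferential_def)
  have sumE: "X $$ (i,j) + S $$ (i,j) = (if i = j then y i else 0)" if "i < m" "j < n" for i j
    using arg_cong[OF sum, of "\<lambda>M. M $$ (i,j)"] that X Sc by simp
  have off: "X $$ (i,j) = 0" if ij: "i < m" "j < n" "i \<noteq> j" for i j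
  proof -
    let ?e = "\<lambda>l. if l = i then - 1 else (1::real)"
    let ?P = "mat_diag m ?e" and ?R = "mat_diag n ?e"
    have sub: "?P * S * transpose_mat ?R \<in> subdifferential (ky_fan k) (?P * X * transpose_mat ?R)"
      by (rule subdifferential_orth_invariant[OF mn k sign_flip_orth_group sign_flip_orth_group X S])
    have c: "?P * X * transpose_mat ?R \<in> carrier_mat m n" "?P * S * transpose_mat ?R \<in> carrier_mat m n"
      using X Sc by (simp_all add: mat_diag_def mult_carrier_mat[of _ m n _ n] mult_carrier_mat[of _ m m _ n])
    have "X + S = ?P * X * transpose_mat ?R + ?P * S * transpose_mat ?R"
    proof (rule eq_matI)
      fix a b assume "a < dim_row (?P * X * transpose_mat ?R + ?P * S * transpose_mat ?R)"
        "b < dim_col (?P * X * transpose_mat ?R + ?P * S * transpose_mat ?R)"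
      then have ab: "a < m" "b < n" using c by auto
      have "(?P * X * transpose_mat ?R + ?P * S * transpose_mat ?R) $$ (a,b)
          = ?e a * ?e b * (X $$ (a,b) + S $$ (a,b))"
        using ab c by (simp only: index_add_mat carrier_matD[OF c(2)] sign_flip_index[OF X ab] sign_flip_index[OF Sc ab] distrib_left)
      then show "(X + S) $$ (a,b) = (?P * X * transpose_mat ?R + ?P * S * transpose_mat ?R) $$ (a,b)"
        using ab X Sc sumE[OF ab] by auto
    qed (use c X Sc in auto)
    then have "X = ?P * X * transpose_mat ?R"
      by (rule subdifferential_sum_unique[OF X c(1) S sub])
    then have "X $$ (i,j) = (?P * X * transpose_mat ?R) $$ (i,j)" by simp
    also have "\<dots> = - X $$ (i,j)" unfolding sign_flip_index[OF X ij(1,2)] using ij by simp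
    finally show ?thesis by simp
  qed
  define x s where "x i = X $$ (i,i)" and "s i = S $$ (i,i)" for i
  have XD: "X = rect_diag m n x" using X off by (intro eq_matI) (auto simp: x_def)
  have SD: "S = rect_diag m n s"
  proof (rule eq_matI)
    fix i j assume "i < dim_row (rect_diag m n s)" "j < dim_col (rect_diag m n s)"
    then show "S $$ (i,j) = rect_diag m n s $$ (i,j)"
      using off[of i j] sumE[of i j] by (auto simp: s_def)
  qed (use Sc in auto)
  have xs: "y i = x i + s i" if "i < m" for i using sumE[of i i] that mn by (simp add: x_def s_def)
  have y0: "0 \<le> y i" if "i < m" for i using y that by (simp add: decreasing_nonneg_def)
  have prod: "0 \<le> s i * x i" if i: "i < m" for i
  proof -
    let ?e = "\<lambda>l. if l = i then - 1 else (1::real)"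
    let ?P = "mat_diag m ?e" and ?R = "mat_diag n (\<lambda>_. 1) :: real mat"
    have R: "?R \<in> orth_group n" using orth_group_one by simp
    have flip: "?P * rect_diag m n w * transpose_mat ?R = rect_diag m n (\<lambda>l. ?e l * w l)" for w
    proof (rule eq_matI)
      fix a b assume "a < dim_row (rect_diag m n (\<lambda>l. ?e l * w l))" "b < dim_col (rect_diag m n (\<lambda>l. ?e l * w l))"
      then have ab: "a < m" "b < n" by auto
      show "(?P * rect_diag m n w * transpose_mat ?R) $$ (a,b) = rect_diag m n (\<lambda>l. ?e l * w l) $$ (a,b)"
        unfolding sign_flip_index[OF rect_diag_carrier(1) ab] using ab by simp
    qed (simp_all add: mat_diag_def)
    have "?P * S * transpose_mat ?R \<in> subdifferential (ky_fan k) (?P * X * transpose_mat ?R)"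
      by (rule subdifferential_orth_invariant[OF mn k sign_flip_orth_group R X S])
    then have "rect_diag m n (\<lambda>l. ?e l * s l) \<in> subdifferential (ky_fan k) (rect_diag m n (\<lambda>l. ?e l * x l))"
      by (simp only: XD SD flip)
    from subdifferential_monotone[OF _ _ S[unfolded XD SD] this, of m n]
    have "0 \<le> (\<Sum>l<m. (s l - ?e l * s l) * (x l - ?e l * x l))"
      by (simp only: rect_diag_carrier rect_diag_double_sum[OF mn])
    also have "\<dots> = (\<Sum>l<m. if l = i then 4 * (s i * x i) else 0)" by (intro sum.cong) auto
    finally show ?thesis using i by simp
  qed
  have nn: "0 \<le> x i" "0 \<le> s i" if i: "i < m" for i
    using prod[OF i] y0[OF i] xs[OF i] by (auto simp: zero_le_mult_iff)
  have swap: "0 \<le> (s i - s j) * (x i - x j)" if ij: "i < m" "j < m" "i \<noteq> j" for i j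
  proof -
    let ?f = "\<lambda>l. if l = i then j else if l = j then i else l"
    have P: "perm_mat m ?f \<in> orth_group m" and R: "perm_mat n ?f \<in> orth_group n"
      using ij mn by (auto intro!: perm_mat_orth_group split: if_splits)
    have "perm_mat m ?f * S * transpose_mat (perm_mat n ?f)
        \<in> subdifferential (ky_fan k) (perm_mat m ?f * X * transpose_mat (perm_mat n ?f))"
      by (rule subdifferential_orth_invariant[OF mn k P R X S])
    moreover have "perm_mat m ?f * rect_diag m n w * transpose_mat (perm_mat n ?f) = rect_diag m n (\<lambda>l. w (?f l))" for w
      by (rule perm_mat_rect_diag[OF mn]) (use ij in auto)
    ultimately have "rect_diag m n (\<lambda>l. s (?f l)) \<in> subdifferential (ky_fan k) (rect_diag m n (\<lambda>l. x (?f l)))"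
      by (simp only: XD SD)
    from subdifferential_monotone[OF _ _ S[unfolded XD SD] this, of m n]
    have "0 \<le> (\<Sum>l<m. (s l - s (?f l)) * (x l - x (?f l)))"
      by (simp only: rect_diag_carrier rect_diag_double_sum[OF mn])
    also have "\<dots> = (\<Sum>l<m. (if l = i then (s i - s j) * (x i - x j) else 0) + (if l = j then (s i - s j) * (x i - x j) else 0))"
      using ij by (intro sum.cong) (auto simp: algebra_simps)
    also have "\<dots> = (s i - s j) * (x i - x j) + (s i - s j) * (x i - x j)"
      using ij by (simp add: sum.distrib)
    finally show ?thesis by simp
  qed
  have ord: "x j \<le> x i \<and> s j \<le> s i" if ij: "i \<le> j" "j < m" for i j
  proof (cases "i = j")
    case False
    then have "0 \<le> (s i - s j) * (x i - x j)" using swap[of i j] ij by simp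
    moreover have "y j \<le> y i" using y ij by (simp add: decreasing_nonneg_def)
    ultimately show ?thesis using xs[of i] xs[of j] ij by (auto simp: zero_le_mult_iff)
  qed simp
  have "decreasing_nonneg m x" "decreasing_nonneg m s" using ord nn by (auto simp: decreasing_nonneg_def)
  then show ?thesis using XD SD xs by blast
qed

text \<open>
  Testing the subgradient inequality at \<open>0\<close> and at \<open>2 X\<close> gives equality at \<open>X\<close>.
\<close>

lemma subgradient_ky_fan_pairing:
  assumes mn: "m \<le> n" and k: "k \<le> m" and X: "X \<in> carrier_mat m n" and S: "S \<in> subdifferential (ky_fan k) X"
  shows "mat_inner S X = ky_fan k X" "\<And>Z. Z \<in> carrier_mat m n \<Longrightarrow> mat_inner S Z \<le> ky_fan k Z"
proof -
  have Sc: "S \<in> carrier_mat m n" using S X by (auto simp: subdifferential_def)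
  have sub: "ky_fan k X + (mat_inner S Z - mat_inner S X) \<le> ky_fan k Z" if "Z \<in> carrier_mat m n" for Z
    using S X that mat_inner_diff_right[OF Sc that X] by (auto simp: subdifferential_def)
  have "ky_fan k (0\<^sub>m m n) \<le> mat_l1 (0\<^sub>m m n)" by (rule ky_fan_le_l1[OF mn k]) simp
  then have "ky_fan k (0\<^sub>m m n) \<le> 0" by (simp add: mat_l1_def)
  moreover have "mat_inner S (0\<^sub>m m n) = 0" using Sc by (simp add: mat_inner_entries[of _ m n])
  ultimately have 1: "ky_fan k X \<le> mat_inner S X" using sub[of "0\<^sub>m m n"] by simp
  have "ky_fan k (X + X) \<le> ky_fan k X + ky_fan k X" by (rule ky_fan_triangle[OF mn k X X])
  then have "mat_inner S X \<le> ky_fan k X"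
    using sub[of "X + X"] X mat_inner_add_right[OF Sc X X] by simp
  with 1 show eq: "mat_inner S X = ky_fan k X" by simp
  show "mat_inner S Z \<le> ky_fan k Z" if "Z \<in> carrier_mat m n" for Z using sub[OF that] eq by simp
qed

text \<open>
  Testing with the first unit vector and with the constant sequence bounds \<open>u\<close> by 1 and its sum by \<open>k\<close>.
  With \<open>c = s (k - 1)\<close>, the equation \<open>\<Sum>u i * s i = \<Sum>i<k. s i\<close> says that the nonnegative numbers
  \<open>(1 - u i) (s i - c)\<close> for \<open>i < k\<close>, \<open>u i (c - s i)\<close> for \<open>i \<ge> k\<close> and \<open>c (k - \<Sum>u i)\<close> add up to zero.
\<close>

theorem subgradient_weights:
  assumes mn: "m \<le> n" and k: "1 \<le> k" "k \<le> m" and s: "decreasing_nonneg m s" and u: "decreasing_nonneg m u"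
    and pair: "mat_inner (rect_diag m n u) (rect_diag m n s) = ky_fan k (rect_diag m n s)"
    and dual: "\<And>Z. Z \<in> carrier_mat m n \<Longrightarrow> mat_inner (rect_diag m n u) Z \<le> ky_fan k Z"
    and i: "i < m"
  shows "s (k - 1) < s i \<Longrightarrow> u i = 1" "s i < s (k - 1) \<Longrightarrow> u i = 0"
proof -
  have inner: "mat_inner (rect_diag m n u) (rect_diag m n e) = (\<Sum>i<m. u i * e i)" for e
    using mn by (simp add: rect_diag_inner)
  have kf: "ky_fan k (rect_diag m n e) = (\<Sum>i<k. e i)" if "decreasing_nonneg m e" for e
    unfolding ky_fan_def using k that by (intro sum.cong refl sing_val_rect_diag[OF mn]) auto
  have u0: "0 \<le> u i" if "i < m" for i using u that by (simp add: decreasing_nonneg_def)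
  have "(\<Sum>i<m. u i * (if i = 0 then 1 else 0)) \<le> (\<Sum>i<k. if i = 0 then 1 else 0)"
    using dual[of "rect_diag m n (\<lambda>i. if i = 0 then 1 else 0)"] inner[of "\<lambda>i. if i = 0 then 1 else 0"]
      kf[of "\<lambda>i. if i = 0 then 1 else 0"] by (simp add: decreasing_nonneg_def)
  moreover have "(\<Sum>i<m. u i * (if i = 0 then 1 else 0)) = (\<Sum>i<m. if i = 0 then u i else 0)"
    by (intro sum.cong) auto
  ultimately have "u 0 \<le> 1" using k by simp
  then have u1: "u i \<le> 1" if "i < m" for i using u that unfolding decreasing_nonneg_def by (meson le0 order_trans)
  have sumu: "(\<Sum>i<m. u i) \<le> k"
    using dual[of "rect_diag m n (\<lambda>i. 1)"] inner[of "\<lambda>i. 1"] kf[of "\<lambda>i. 1"] by (simp add: decreasing_nonneg_def)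
  have sum_eq: "(\<Sum>i<m. u i * s i) = (\<Sum>i<k. s i)" using pair inner kf[OF s] by simp
  define c where "c = s (k - 1)"
  have c0: "0 \<le> c" unfolding c_def using s k by (simp add: decreasing_nonneg_def)
  let ?g = "\<lambda>i. if i < k then (1 - u i) * (s i - c) else u i * (c - s i)"
  have g0: "0 \<le> ?g i" if "i < m" for i
  proof (cases "i < k")
    case True
    then have "s i \<ge> c" using s k unfolding c_def decreasing_nonneg_def by auto
    then show ?thesis using True u1[OF that] by simp
  next
    case False
    then have "s i \<le> c" using s k that unfolding c_def decreasing_nonneg_def by auto
    then show ?thesis using False u0[OF that] by simp
  qed
  have split: "{..<m} \<inter> {i. i < k} = {..<k}" using k by auto
  have "(\<Sum>i<m. ?g i) = (\<Sum>i<m. (if i < k then s i - c else 0) - u i * s i + c * u i)"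
    by (intro sum.cong) (auto simp: algebra_simps)
  also have "\<dots> = (\<Sum>i<m. if i < k then s i - c else 0) - (\<Sum>i<m. u i * s i) + c * (\<Sum>i<m. u i)"
    by (simp add: sum.distrib sum_subtractf sum_distrib_left)
  also have "(\<Sum>i<m. if i < k then s i - c else 0) = (\<Sum>i\<in>{..<m} \<inter> {i. i < k}. s i - c)"
    by (simp add: sum.inter_restrict)
  also have "\<dots> = (\<Sum>i<k. s i - c)" by (simp only: split)
  also have "\<dots> = (\<Sum>i<k. s i) - k * c" by (simp add: sum_subtractf)
  finally have "(\<Sum>i<m. ?g i) = (\<Sum>i<k. s i) - k * c - (\<Sum>i<m. u i * s i) + c * (\<Sum>i<m. u i)" .
  then have "(\<Sum>i<m. ?g i) = c * ((\<Sum>i<m. u i) - k)" unfolding sum_eq by (simp add: right_diff_distrib)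
  also have "\<dots> \<le> 0" using c0 sumu by (simp add: mult_nonneg_nonpos)
  finally have "(\<Sum>i<m. ?g i) = 0" using g0 by (intro antisym sum_nonneg) auto
  then have "\<forall>i\<in>{..<m}. ?g i = 0" using g0 by (subst (asm) sum_nonneg_eq_0_iff) auto
  then have gi: "?g i = 0" using i by simp
  show "u i = 1" if "s (k - 1) < s i"
  proof -
    have "i < k"
    proof (rule ccontr)
      assume "\<not> i < k"
      then have "s i \<le> s (k - 1)" using s i k unfolding decreasing_nonneg_def by simp
      then show False using that by simp
    qed
    then show ?thesis using gi that by (simp add: c_def)
  qed
  show "u i = 0" if "s i < s (k - 1)"
  proof -
    have "\<not> i < k"
    proof
      assume "i < k"
      then have "s (k - 1) \<le> s i" using s k unfolding decreasing_nonneg_def by simp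
      then show False using that by simp
    qed
    then show ?thesis using gi that by (simp add: c_def)
  qed
qed

section \<open>The second order directional derivative of the Ky Fan norm\<close>

lemma quad_expansion_tendsto:
  assumes "quad_expansion f a0 a1 a2"
  shows "(f \<longlongrightarrow> a0) (at_right 0)"
proof -
  have "((\<lambda>t. a0 + a1 * t + (f t - a0 - a1 * t) / t\<^sup>2 * t\<^sup>2) \<longlongrightarrow> a0 + a1 * 0 + a2 * 0\<^sup>2) (at_right 0)"
    using assms unfolding quad_expansion_def by (intro tendsto_intros)
  then have "((\<lambda>t. a0 + a1 * t + (f t - a0 - a1 * t) / t\<^sup>2 * t\<^sup>2) \<longlongrightarrow> a0) (at_right 0)" by simp
  then show ?thesis
    by (rule Lim_transform_eventually) (rule eventually_mono[OF eventually_at_right_less], simp)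
qed

lemma mat_expansion_affine:
  assumes A: "A \<in> carrier_mat m n" and B: "B \<in> carrier_mat m n"
  shows "mat_expansion m n (\<lambda>t. A + t \<cdot>\<^sub>m B) A B (0\<^sub>m m n)"
proof -
  have "quad_expansion (\<lambda>t. (A + t \<cdot>\<^sub>m B) $$ (i,j)) (A $$ (i,j)) (B $$ (i,j)) (0\<^sub>m m n $$ (i,j))"
    if ij: "i < m" "j < n" for i j
  proof -
    have "(\<lambda>t. (A + t \<cdot>\<^sub>m B) $$ (i,j)) = (\<lambda>t. A $$ (i,j) + B $$ (i,j) * t + 0 * t\<^sup>2)"
      using ij A B by (simp add: mult.commute)
    then show ?thesis using quad_expansion_poly[of "A $$ (i,j)" "B $$ (i,j)" 0] ij by simp
  qed
  then show ?thesis using A B by (simp add: mat_expansion_def)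
qed

text \<open>
  With the Lipschitz estimates this transfers second order information about singular values between a
  parabola and any curve with the same tangent, exactly if \<open>W = 2 A2\<close> and up to \<open>O(t\<^sup>2)\<close> otherwise.
\<close>

lemma mat_expansion_l1:
  assumes N: "mat_expansion m n N A0 A1 A2" and W: "W \<in> carrier_mat m n"
  shows "((\<lambda>t. mat_l1 (A0 + t \<cdot>\<^sub>m A1 + (1/2 * t\<^sup>2) \<cdot>\<^sub>m W - N t) / t\<^sup>2) \<longlongrightarrow> mat_l1 ((1/2) \<cdot>\<^sub>m W - A2)) (at_right 0)"
proof -
  have c: "N t \<in> carrier_mat m n" "A0 \<in> carrier_mat m n" "A1 \<in> carrier_mat m n" "A2 \<in> carrier_mat m n" for t
    using N by (auto simp: mat_expansion_def)
  have ent: "((\<lambda>t. W $$ (i,j) / 2 - (N t $$ (i,j) - A0 $$ (i,j) - A1 $$ (i,j) * t) / t\<^sup>2)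
      \<longlongrightarrow> W $$ (i,j) / 2 - A2 $$ (i,j)) (at_right 0)" if "i < m" "j < n" for i j
    using N that unfolding mat_expansion_def quad_expansion_def by (intro tendsto_diff tendsto_const) blast
  have "((\<lambda>t. \<Sum>i<m. \<Sum>j<n. \<bar>W $$ (i,j) / 2 - (N t $$ (i,j) - A0 $$ (i,j) - A1 $$ (i,j) * t) / t\<^sup>2\<bar>)
      \<longlongrightarrow> (\<Sum>i<m. \<Sum>j<n. \<bar>W $$ (i,j) / 2 - A2 $$ (i,j)\<bar>)) (at_right 0)"
    by (intro tendsto_sum tendsto_rabs ent) auto
  also have "(\<Sum>i<m. \<Sum>j<n. \<bar>W $$ (i,j) / 2 - A2 $$ (i,j)\<bar>) = mat_l1 ((1/2) \<cdot>\<^sub>m W - A2)"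
    using c W by (simp add: mat_l1_def)
  finally show ?thesis
  proof (rule Lim_transform_eventually, intro eventually_mono[OF eventually_at_right_less])
    fix t :: real assume t: "0 < t"
    have "mat_l1 (A0 + t \<cdot>\<^sub>m A1 + (1/2 * t\<^sup>2) \<cdot>\<^sub>m W - N t) / t\<^sup>2
      = (\<Sum>i<m. \<Sum>j<n. \<bar>A0 $$ (i,j) + t * A1 $$ (i,j) + (1/2 * t\<^sup>2) * W $$ (i,j) - N t $$ (i,j)\<bar>) / t\<^sup>2"
      using c(1)[of t] c(2-4) W by (simp add: mat_l1_def add.assoc)
    also have "\<dots> = (\<Sum>i<m. \<Sum>j<n. \<bar>A0 $$ (i,j) + t * A1 $$ (i,j) + (1/2 * t\<^sup>2) * W $$ (i,j) - N t $$ (i,j)\<bar> / t\<^sup>2)"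
      by (simp add: sum_divide_distrib)
    also have "\<dots> = (\<Sum>i<m. \<Sum>j<n. \<bar>W $$ (i,j) / 2 - (N t $$ (i,j) - A0 $$ (i,j) - A1 $$ (i,j) * t) / t\<^sup>2\<bar>)"
    proof (intro sum.cong refl)
      fix i j
      have "\<bar>A0 $$ (i,j) + t * A1 $$ (i,j) + (1/2 * t\<^sup>2) * W $$ (i,j) - N t $$ (i,j)\<bar> / t\<^sup>2
        = \<bar>(A0 $$ (i,j) + t * A1 $$ (i,j) + (1/2 * t\<^sup>2) * W $$ (i,j) - N t $$ (i,j)) / t\<^sup>2\<bar>"
        by simp
      also have "(A0 $$ (i,j) + t * A1 $$ (i,j) + (1/2 * t\<^sup>2) * W $$ (i,j) - N t $$ (i,j)) / t\<^sup>2
        = W $$ (i,j) / 2 - (N t $$ (i,j) - A0 $$ (i,j) - A1 $$ (i,j) * t) / t\<^sup>2"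
        using t by (simp add: field_simps)
      finally show "\<bar>A0 $$ (i,j) + t * A1 $$ (i,j) + (1/2 * t\<^sup>2) * W $$ (i,j) - N t $$ (i,j)\<bar> / t\<^sup>2
        = \<bar>W $$ (i,j) / 2 - (N t $$ (i,j) - A0 $$ (i,j) - A1 $$ (i,j) * t) / t\<^sup>2\<bar>" .
    qed
    finally show "(\<Sum>i<m. \<Sum>j<n. \<bar>W $$ (i,j) / 2 - (N t $$ (i,j) - A0 $$ (i,j) - A1 $$ (i,j) * t) / t\<^sup>2\<bar>)
      = mat_l1 (A0 + t \<cdot>\<^sub>m A1 + (1/2 * t\<^sup>2) \<cdot>\<^sub>m W - N t) / t\<^sup>2" by simp
  qed
qed

text \<open>
  The matrix \<open>W0\<close> is twice the second order coefficient of the curve \<open>N(t) = Q(t) (D + t Hb) R(t)\<close>, whose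
  singular values are affine. All parabolas \<open>Z W t = D + t H + t\<^sup>2 W / 2\<close> are within \<open>O(t\<^sup>2)\<close> of \<open>N(t)\<close>, which
  gives the first derivatives and the boundedness of the second difference quotients; \<open>Z W0\<close> is within
  \<open>o(t\<^sup>2)\<close> of \<open>N\<close>, which gives the value 0. The lower bound for general \<open>W\<close> comes from the functional
  \<open>\<langle>Q(t) S R(t), _\<rangle>\<close>, which is dominated by the norm and agrees with it at \<open>N(t)\<close>.
\<close>

theorem ky_fan_second_derivative_bounds:
  fixes H Hb K G D W0 :: "real mat" and s u :: "nat \<Rightarrow> real"
  assumes mn: "m \<le> n" and k: "k \<le> m" and s: "decreasing_nonneg m s"
    and tail: "\<And>j. m \<le> j \<Longrightarrow> s j = 0"
    and K: "K \<in> carrier_mat m m" "transpose_mat K = - K"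
    and G: "G \<in> carrier_mat n n" "transpose_mat G = - G"
    and Hb: "Hb \<in> carrier_mat m n"
    and block: "\<And>i j. i < m \<Longrightarrow> j < n \<Longrightarrow> s i \<noteq> s j \<Longrightarrow> Hb $$ (i,j) = 0"
    and symH: "\<And>i j. i < m \<Longrightarrow> j < m \<Longrightarrow> s i = s j \<Longrightarrow> s i > 0 \<Longrightarrow> Hb $$ (i,j) = Hb $$ (j,i)"
    and H: "H = Hb + K * rect_diag m n s + rect_diag m n s * G"
    and pair: "mat_inner (rect_diag m n u) (rect_diag m n s) = ky_fan k (rect_diag m n s)"
    and dual: "\<And>Z. Z \<in> carrier_mat m n \<Longrightarrow> mat_inner (rect_diag m n u) Z \<le> ky_fan k Z"
    and crit: "dir_deriv (ky_fan k) (rect_diag m n s) H \<le> mat_inner (rect_diag m n u) H"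
    and D_def: "D = rect_diag m n s"
    and W0_def: "W0 = 2 \<cdot>\<^sub>m (D * ((1/2) \<cdot>\<^sub>m (G * G)) + (Hb + K * D) * G + (K * Hb + (1/2) \<cdot>\<^sub>m (K * K) * D))"
  shows "\<And>W. W \<in> carrier_mat m n \<Longrightarrow>
      mat_inner (rect_diag m n u) W - mat_inner (rect_diag m n u) W0
        \<le> (\<Sum>i<k. dir_deriv2 (\<lambda>Z. sing_val Z i) D H W)"
    and "(\<Sum>i<k. dir_deriv2 (\<lambda>Z. sing_val Z i) D H W0) = 0"
proof -
  let ?S = "rect_diag m n u"
  have D: "D \<in> carrier_mat m n" and Sc: "?S \<in> carrier_mat m n" by (simp_all add: D_def)
  note KD = mult_carrier_mat[OF K(1) D] and DG = mult_carrier_mat[OF D G(1)]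
  have Hc: "H \<in> carrier_mat m n" unfolding H D_def[symmetric] by (intro add_carrier_mat DG)
  obtain Q where Q: "\<And>t. Q t \<in> orth_group m" "mat_expansion m m Q (1\<^sub>m m) K ((1/2) \<cdot>\<^sub>m (K * K))"
    using orthogonal_curve[OF K] by blast
  obtain R where R: "\<And>t. R t \<in> orth_group n" "mat_expansion n n R (1\<^sub>m n) G ((1/2) \<cdot>\<^sub>m (G * G))"
    using orthogonal_curve[OF G] by blast
  note Qc = orth_groupD(1)[OF Q(1)] and Rc = orth_groupD(1)[OF R(1)]
  define M where "M t = D + t \<cdot>\<^sub>m Hb" for t
  have Mc: "M t \<in> carrier_mat m n" for t using D Hb by (simp add: M_def)
  define N where "N t = Q t * M t * R t" for t
  have Nc: "N t \<in> carrier_mat m n" for t using Qc Mc Rc unfolding N_def by (meson mult_carrier_mat)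
  have expM: "mat_expansion m n M D Hb (0\<^sub>m m n)"
    unfolding M_def by (rule mat_expansion_affine[OF D Hb])
  define A2 where "A2 = D * ((1/2) \<cdot>\<^sub>m (G * G)) + (Hb + K * D) * G + (K * Hb + (1/2) \<cdot>\<^sub>m (K * K) * D)"
  have A2: "A2 \<in> carrier_mat m n"
    unfolding A2_def using D Hb K(1) G(1) by (intro add_carrier_mat mult_carrier_mat smult_carrier_mat) auto
  have KKD: "(1/2) \<cdot>\<^sub>m (K * K) * D \<in> carrier_mat m n" using K(1) D by (meson mult_carrier_mat smult_carrier_mat)
  have W0: "W0 = 2 \<cdot>\<^sub>m A2" "W0 \<in> carrier_mat m n" using A2 unfolding W0_def A2_def by auto
  have expN: "mat_expansion m n N D H A2"
  proof -
    have 1: "mat_expansion m n (\<lambda>t. Q t * M t * R t)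
       (1\<^sub>m m * D * 1\<^sub>m n) (1\<^sub>m m * D * G + (1\<^sub>m m * Hb + K * D) * 1\<^sub>m n)
       (1\<^sub>m m * D * ((1/2) \<cdot>\<^sub>m (G * G)) + (1\<^sub>m m * Hb + K * D) * G
          + (1\<^sub>m m * 0\<^sub>m m n + K * Hb + (1/2) \<cdot>\<^sub>m (K * K) * D) * 1\<^sub>m n)"
      by (rule mat_expansion_mult[OF mat_expansion_mult[OF Q(2) expM] R(2)])
    have 2: "1\<^sub>m m * D * 1\<^sub>m n = D" using D by simp
    have HKD: "Hb + K * D \<in> carrier_mat m n" by (rule add_carrier_mat[OF KD])
    have "1\<^sub>m m * D * G + (1\<^sub>m m * Hb + K * D) * 1\<^sub>m n = D * G + (Hb + K * D)"
      by (simp only: left_mult_one_mat[OF D] left_mult_one_mat[OF Hb] right_mult_one_mat[OF HKD])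
    also have "\<dots> = H" unfolding H D_def[symmetric] by (rule comm_add_mat[OF DG HKD])
    finally have 3: "1\<^sub>m m * D * G + (1\<^sub>m m * Hb + K * D) * 1\<^sub>m n = H" .
    have KH: "K * Hb \<in> carrier_mat m n" using K(1) Hb by (rule mult_carrier_mat)
    have KHK: "K * Hb + (1/2) \<cdot>\<^sub>m (K * K) * D \<in> carrier_mat m n" by (rule add_carrier_mat[OF KKD])
    have z: "1\<^sub>m m * 0\<^sub>m m n + K * Hb = K * Hb" using KH by simp
    have 4: "1\<^sub>m m * D * ((1/2) \<cdot>\<^sub>m (G * G)) + (1\<^sub>m m * Hb + K * D) * G
          + (1\<^sub>m m * 0\<^sub>m m n + K * Hb + (1/2) \<cdot>\<^sub>m (K * K) * D) * 1\<^sub>m n = A2"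
      unfolding A2_def z by (simp only: left_mult_one_mat[OF D] left_mult_one_mat[OF Hb] right_mult_one_mat[OF KHK])
    show ?thesis using 1 unfolding 2 3 4 N_def .
  qed
  obtain e d where e: "e > 0" and aff: "\<And>t i. 0 \<le> t \<Longrightarrow> t \<le> e \<Longrightarrow> i < m \<Longrightarrow> sing_val (M t) i = s i + t * d i"
    using sing_val_affine_along_block_direction[OF mn Hb s tail block symH] unfolding M_def D_def by blast
  have svD: "sing_val D i = s i" if "i < m" for i unfolding D_def by (rule sing_val_rect_diag[OF mn s that])
  have svN: "sing_val (N t) i = s i + d i * t" if "0 \<le> t" "t \<le> e" "i < m" for t i
    using sing_val_orth_invariant[OF mn Q(1) orth_group_transpose[OF R(1)] Mc that(3)] aff[OF that]
    by (simp add: N_def mult.commute)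
  have kfN: "ky_fan k (N t) = ky_fan k D + (\<Sum>i<k. d i) * t" if "0 \<le> t" "t \<le> e" for t
    using svN[OF that] svD k unfolding ky_fan_def by (simp add: sum.distrib sum_distrib_right)
  define Z where "Z W t = D + t \<cdot>\<^sub>m H + (1/2 * t\<^sup>2) \<cdot>\<^sub>m W" for W t
  have Zc: "Z W t \<in> carrier_mat m n" if "W \<in> carrier_mat m n" for W t
    using D Hc that by (simp add: Z_def)
  have l1lim: "((\<lambda>t. mat_l1 (Z W t - N t) / t\<^sup>2) \<longlongrightarrow> mat_l1 ((1/2) \<cdot>\<^sub>m W - A2)) (at_right 0)"
    if "W \<in> carrier_mat m n" for W
    unfolding Z_def by (rule mat_expansion_l1[OF expN that])
  have quad: "\<exists>C e'. 0 < e' \<and> (\<forall>t. 0 < t \<longrightarrow> t < e' \<longrightarrow> (\<forall>i<m. \<bar>sing_val (Z W t) i - s i - d i * t\<bar> \<le> C * t\<^sup>2))"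
    if W: "W \<in> carrier_mat m n" for W
  proof -
    let ?C = "mat_l1 ((1/2) \<cdot>\<^sub>m W - A2) + 1"
    have "\<forall>\<^sub>F t in at_right 0. mat_l1 (Z W t - N t) / t\<^sup>2 < ?C"
      by (rule order_tendstoD(2)[OF l1lim[OF W]]) simp
    then obtain b where b: "b > 0" "\<And>t. 0 < t \<Longrightarrow> t < b \<Longrightarrow> mat_l1 (Z W t - N t) / t\<^sup>2 < ?C"
      by (auto simp: eventually_at_right[of 0 1])
    have "\<bar>sing_val (Z W t) i - s i - d i * t\<bar> \<le> 2 * ?C * t\<^sup>2" if t: "0 < t" "t < min b e" and i: "i < m" for t i
    proof -
      have "\<bar>sing_val (Z W t) i - sing_val (N t) i\<bar> \<le> 2 * mat_l1 (Z W t - N t)"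
        by (rule sing_val_lipschitz[OF mn i Zc[OF W] Nc])
      moreover have "mat_l1 (Z W t - N t) \<le> ?C * t\<^sup>2" using b(2)[of t] t by (simp add: field_simps)
      ultimately have "\<bar>sing_val (Z W t) i - (s i + d i * t)\<bar> \<le> 2 * (?C * t\<^sup>2)"
        using svN[of t i] t i by simp
      then show ?thesis by (simp only: diff_diff_eq mult.assoc)
    qed
    then show ?thesis using b(1) e by (intro exI[of _ "2 * ?C"] exI[of _ "min b e"]) auto
  qed
  have d1: "dir_deriv (\<lambda>Z. sing_val Z i) D H = d i" if i: "i < m" for i
  proof -
    have zc: "0\<^sub>m m n \<in> carrier_mat m n" by simp
    obtain C e' where C: "0 < e'" "\<And>t. 0 < t \<Longrightarrow> t < e' \<Longrightarrow> \<bar>sing_val (Z (0\<^sub>m m n) t) i - s i - d i * t\<bar> \<le> C * t\<^sup>2"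
      using quad[OF zc] i by blast
    have ZD: "Z (0\<^sub>m m n) t = D + t \<cdot>\<^sub>m H" for t using D Hc by (intro eq_matI) (auto simp: Z_def)
    have "((\<lambda>t. (sing_val (D + t \<cdot>\<^sub>m H) i - sing_val D i) / t - d i) \<longlongrightarrow> 0) (at_right 0)"
    proof (rule tendsto_0_le[where K = C])
      show "((\<lambda>t::real. t) \<longlongrightarrow> 0) (at_right 0)" by (rule tendsto_ident_at)
      have "norm ((sing_val (D + t \<cdot>\<^sub>m H) i - sing_val D i) / t - d i) \<le> norm t * C" if t: "0 < t" "t < e'" for t
      proof -
        have "(sing_val (D + t \<cdot>\<^sub>m H) i - sing_val D i) / t - d i = (sing_val (D + t \<cdot>\<^sub>m H) i - s i - d i * t) / t"
          using t svD[OF i] by (simp add: field_simps)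
        moreover have "\<bar>(sing_val (D + t \<cdot>\<^sub>m H) i - s i - d i * t) / t\<bar> \<le> C * t\<^sup>2 / t"
          using C(2)[OF t] t unfolding ZD by (simp add: divide_right_mono)
        ultimately show ?thesis using t by (simp add: power2_eq_square mult.commute)
      qed
      then show "\<forall>\<^sub>F t in at_right 0. norm ((sing_val (D + t \<cdot>\<^sub>m H) i - sing_val D i) / t - d i) \<le> norm t * C"
        by (intro eventually_at_rightI[of 0 e'] C(1)) (simp only: greaterThanLessThan_iff)
    qed
    then have "((\<lambda>t. (sing_val (D + t \<cdot>\<^sub>m H) i - sing_val D i) / t) \<longlongrightarrow> d i) (at_right 0)"
      by (rule LIM_zero_cancel)
    then show ?thesis unfolding dir_deriv_def by (intro tendsto_Lim) auto
  qed
  have d2: "((\<lambda>t. (sing_val (Z W t) i - s i - d i * t) / (1/2 * t\<^sup>2)) \<longlongrightarrow> dir_deriv2 (\<lambda>Z. sing_val Z i) D H W) (at_right 0)"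
    if W: "W \<in> carrier_mat m n" and i: "i < m" for W i
  proof -
    obtain C e' where C: "0 < e'" "\<And>t. 0 < t \<Longrightarrow> t < e' \<Longrightarrow> \<bar>sing_val (Z W t) i - s i - d i * t\<bar> \<le> C * t\<^sup>2"
      using quad[OF W] i by blast
    obtain L where L: "((\<lambda>t. (sing_val (Z W t) i - s i - d i * t) / (1/2 * t\<^sup>2)) \<longlongrightarrow> L) (at_right 0)"
      using second_order_limit_exists[OF mn D Hc W i C(1), of "s i" "d i" C] C(2) unfolding Z_def by blast
    have "dir_deriv2 (\<lambda>Z. sing_val Z i) D H W = L"
      unfolding dir_deriv2_def d1[OF i] svD[OF i]
      by (rule tendsto_Lim) (use L in \<open>simp_all add: Z_def mult.commute\<close>)
    then show ?thesis using L by simp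
  qed
  have sum2: "((\<lambda>t. (ky_fan k (Z W t) - ky_fan k D - (\<Sum>i<k. d i) * t) / (1/2 * t\<^sup>2))
      \<longlongrightarrow> (\<Sum>i<k. dir_deriv2 (\<lambda>Z. sing_val Z i) D H W)) (at_right 0)" if W: "W \<in> carrier_mat m n" for W
  proof -
    have "((\<lambda>t. \<Sum>i<k. (sing_val (Z W t) i - s i - d i * t) / (1/2 * t\<^sup>2))
      \<longlongrightarrow> (\<Sum>i<k. dir_deriv2 (\<lambda>Z. sing_val Z i) D H W)) (at_right 0)"
      using k by (intro tendsto_sum d2[OF W]) auto
    moreover have "(\<Sum>i<k. (sing_val (Z W t) i - s i - d i * t) / (1/2 * t\<^sup>2))
      = (ky_fan k (Z W t) - ky_fan k D - (\<Sum>i<k. d i) * t) / (1/2 * t\<^sup>2)" for t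
      using k svD unfolding ky_fan_def sum_divide_distrib[symmetric]
      by (simp add: sum_subtractf sum_distrib_right)
    ultimately show ?thesis by (simp only:)
  qed
  \<comment> \<open>Criticality gives one inequality; the other one holds for every subgradient.\<close>
  have slope: "(\<Sum>i<k. d i) = mat_inner ?S H"
  proof (rule antisym)
    have lim: "((\<lambda>t. (ky_fan k (D + t \<cdot>\<^sub>m H) - ky_fan k D) / t) \<longlongrightarrow> (\<Sum>i<k. d i)) (at_right 0)"
    proof -
      have zc: "0\<^sub>m m n \<in> carrier_mat m n" by simp
      have ZD: "Z (0\<^sub>m m n) t = D + t \<cdot>\<^sub>m H" for t using D Hc by (intro eq_matI) (auto simp: Z_def)
      let ?q = "\<lambda>t. (ky_fan k (D + t \<cdot>\<^sub>m H) - ky_fan k D - (\<Sum>i<k. d i) * t) / (1/2 * t\<^sup>2)"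
      have "((\<lambda>t. (\<Sum>i<k. d i) + 1/2 * t * ?q t) \<longlongrightarrow> (\<Sum>i<k. d i) + 1/2 * 0 * (\<Sum>i<k. dir_deriv2 (\<lambda>Z. sing_val Z i) D H (0\<^sub>m m n))) (at_right 0)"
        using sum2[OF zc] unfolding ZD by (intro tendsto_intros)
      then have "((\<lambda>t. (\<Sum>i<k. d i) + 1/2 * t * ?q t) \<longlongrightarrow> (\<Sum>i<k. d i)) (at_right 0)" by simp
      then show ?thesis
      proof (rule Lim_transform_eventually, intro eventually_mono[OF eventually_at_right_less])
        fix t :: real assume "0 < t"
        then show "(\<Sum>i<k. d i) + 1/2 * t * ?q t = (ky_fan k (D + t \<cdot>\<^sub>m H) - ky_fan k D) / t"
          by (simp add: field_simps power2_eq_square)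
      qed
    qed
    have "dir_deriv (ky_fan k) D H = (\<Sum>i<k. d i)"
      unfolding dir_deriv_def using lim by (intro tendsto_Lim) auto
    then show "(\<Sum>i<k. d i) \<le> mat_inner ?S H" using crit by (simp add: D_def)
    show "mat_inner ?S H \<le> (\<Sum>i<k. d i)"
    proof (rule tendsto_lowerbound[OF lim])
      have "mat_inner ?S H \<le> (ky_fan k (D + t \<cdot>\<^sub>m H) - ky_fan k D) / t" if t: "0 < t" for t
      proof -
        have "mat_inner ?S (D + t \<cdot>\<^sub>m H) = ky_fan k D + t * mat_inner ?S H"
          using pair D Hc by (simp add: D_def mat_inner_add_right[of _ m n] mat_inner_smult_right[of _ m n])
        moreover have "mat_inner ?S (D + t \<cdot>\<^sub>m H) \<le> ky_fan k (D + t \<cdot>\<^sub>m H)"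
          using D Hc by (intro dual) simp
        ultimately show ?thesis using t by (simp add: field_simps)
      qed
      then show "\<forall>\<^sub>F t in at_right 0. mat_inner ?S H \<le> (ky_fan k (D + t \<cdot>\<^sub>m H) - ky_fan k D) / t"
        by (intro eventually_mono[OF eventually_at_right_less])
    qed simp
  qed
  have SHb: "mat_inner ?S Hb = (\<Sum>i<k. d i)"
  proof -
    have diag0: "A $$ (i,i) = 0" if "A \<in> carrier_mat p p" "transpose_mat A = - A" "i < p" for A :: "real mat" and p i
    proof -
      have "transpose_mat A $$ (i,i) = (- A) $$ (i,i)" by (simp only: that(2))
      then show ?thesis using that(1,3) by simp
    qed
    have "mat_inner ?S H = (\<Sum>i<m. u i * H $$ (i,i))" by (rule rect_diag_inner[OF Hc mn])
    also have "\<dots> = (\<Sum>i<m. u i * Hb $$ (i,i))"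
    proof (intro sum.cong refl)
      fix i assume "i \<in> {..<m}"
      then have i: "i < m" "i < n" using mn by auto
      have "(K * D) $$ (i,i) = 0"
        unfolding D_def mult_rect_diag_index[OF K(1) i] using diag0[OF K i(1)] by simp
      moreover have "(D * G) $$ (i,i) = 0"
        unfolding D_def rect_diag_mult_index[OF G(1) i mn] using diag0[OF G i(2)] by simp
      ultimately have "H $$ (i,i) = Hb $$ (i,i)"
        unfolding H D_def[symmetric] using i carrier_matD[OF Hb] carrier_matD[OF KD] carrier_matD[OF DG]
        by (simp del: index_mult_mat(1))
      then show "u i * H $$ (i,i) = u i * Hb $$ (i,i)" by simp
    qed
    also have "\<dots> = mat_inner ?S Hb" by (rule rect_diag_inner[OF Hb mn, symmetric])
    finally show ?thesis using slope by simp
  qed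
  show "mat_inner ?S W - mat_inner ?S W0 \<le> (\<Sum>i<k. dir_deriv2 (\<lambda>Z. sing_val Z i) D H W)"
    if W: "W \<in> carrier_mat m n" for W
  proof (rule tendsto_le[OF _ sum2[OF W]])
    let ?T = "\<lambda>t. Q t * ?S * R t"
    have Tc: "?T t \<in> carrier_mat m n" for t using Qc Rc Sc by (meson mult_carrier_mat)
    have SS: "mat_expansion m n (\<lambda>t. ?S + t \<cdot>\<^sub>m 0\<^sub>m m n) ?S (0\<^sub>m m n) (0\<^sub>m m n)"
      by (rule mat_expansion_affine) auto
    have S0: "(\<lambda>t. ?S + t \<cdot>\<^sub>m 0\<^sub>m m n) = (\<lambda>t::real. ?S)"
    proof (rule ext)
      fix t :: real show "?S + t \<cdot>\<^sub>m 0\<^sub>m m n = ?S" by (rule eq_matI) auto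
    qed
    have S1: "1\<^sub>m m * ?S * 1\<^sub>m n = ?S" by (simp add: left_mult_one_mat[OF Sc] right_mult_one_mat[OF Sc])
    have limT: "((\<lambda>t. ?T t $$ (i,j)) \<longlongrightarrow> ?S $$ (i,j)) (at_right 0)" if "i < m" "j < n" for i j
      using mat_expansion_mult[OF mat_expansion_mult[OF Q(2) SS[unfolded S0]] R(2)] that
      unfolding S1 mat_expansion_def by (blast intro: quad_expansion_tendsto)
    let ?dq = "\<lambda>t i j. 2 * (W $$ (i,j) / 2 - (N t $$ (i,j) - D $$ (i,j) - H $$ (i,j) * t) / t\<^sup>2)"
    have limdq: "((\<lambda>t. ?dq t i j) \<longlongrightarrow> 2 * (W $$ (i,j) / 2 - A2 $$ (i,j))) (at_right 0)" if "i < m" "j < n" for i j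
      using expN that unfolding mat_expansion_def quad_expansion_def by (intro tendsto_intros) blast
    have "((\<lambda>t. \<Sum>i<m. \<Sum>j<n. ?T t $$ (i,j) * ?dq t i j)
       \<longlongrightarrow> (\<Sum>i<m. \<Sum>j<n. ?S $$ (i,j) * (2 * (W $$ (i,j) / 2 - A2 $$ (i,j))))) (at_right 0)"
      by (intro tendsto_sum tendsto_mult limT limdq) auto
    moreover have "(\<Sum>i<m. \<Sum>j<n. ?S $$ (i,j) * (2 * (W $$ (i,j) / 2 - A2 $$ (i,j)))) = mat_inner ?S W - mat_inner ?S W0"
    proof -
      have "W0 $$ (i,j) = 2 * A2 $$ (i,j)" if "i < m" "j < n" for i j
        unfolding W0(1) using that A2 by simp
      then have "(\<Sum>i<m. \<Sum>j<n. ?S $$ (i,j) * (2 * (W $$ (i,j) / 2 - A2 $$ (i,j))))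
          = (\<Sum>i<m. \<Sum>j<n. ?S $$ (i,j) * W $$ (i,j) - ?S $$ (i,j) * W0 $$ (i,j))"
        by (intro sum.cong refl) (simp add: right_diff_distrib)
      then show ?thesis
        unfolding mat_inner_entries[OF Sc W] mat_inner_entries[OF Sc W0(2)] by (simp only: sum_subtractf)
    qed
    ultimately show "((\<lambda>t. \<Sum>i<m. \<Sum>j<n. ?T t $$ (i,j) * ?dq t i j) \<longlongrightarrow> mat_inner ?S W - mat_inner ?S W0) (at_right 0)"
      by simp
    have "(\<Sum>i<m. \<Sum>j<n. ?T t $$ (i,j) * ?dq t i j) \<le> (ky_fan k (Z W t) - ky_fan k D - (\<Sum>i<k. d i) * t) / (1/2 * t\<^sup>2)"
      if t: "0 < t" for t
    proof -
      let ?Q' = "transpose_mat (Q t)" and ?R' = "transpose_mat (R t)"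
      have TZ: "mat_inner (?T t) Y = mat_inner ?S (?Q' * Y * ?R')" if "Y \<in> carrier_mat m n" for Y
        using mat_inner_sandwich[OF Qc[of t] _ Sc that, of ?R'] Rc[of t] by simp
      have "mat_inner (?T t) (Z W t) \<le> ky_fan k (?Q' * Z W t * ?R')"
        unfolding TZ[OF Zc[OF W]] using Qc[of t] Rc[of t] Zc[OF W, of t]
        by (intro dual mult_carrier_mat[of _ m n _ n] mult_carrier_mat[of _ m m _ n]) auto
      also have "\<dots> = ky_fan k (Z W t)"
        by (rule ky_fan_orth_invariant[OF mn orth_group_transpose[OF Q(1)] R(1) Zc[OF W] k])
      finally have le: "mat_inner (?T t) (Z W t) \<le> ky_fan k (Z W t)" .
      have "mat_inner (?T t) (N t) = mat_inner ?S (M t)"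
        using mat_inner_orth_invariant[OF Q(1)[of t] orth_group_transpose[OF R(1)[of t]] Sc Mc[of t]]
        by (simp add: N_def)
      also have "\<dots> = ky_fan k D + (\<Sum>i<k. d i) * t"
      proof -
        have "t \<cdot>\<^sub>m Hb \<in> carrier_mat m n" using Hb by simp
        from mat_inner_add_right[OF Sc D this] show ?thesis
          unfolding M_def mat_inner_smult_right[OF Sc Hb] SHb pair[folded D_def] by (simp only: mult.commute)
      qed
      finally have N: "mat_inner (?T t) (N t) = ky_fan k D + (\<Sum>i<k. d i) * t" .
      have "(\<Sum>i<m. \<Sum>j<n. ?T t $$ (i,j) * ?dq t i j)
          = (\<Sum>i<m. \<Sum>j<n. ?T t $$ (i,j) * (Z W t $$ (i,j) - N t $$ (i,j)) / (1/2 * t\<^sup>2))"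
      proof (intro sum.cong refl)
        fix i j assume ij: "i \<in> {..<m}" "j \<in> {..<n}"
        have "?dq t i j = (Z W t $$ (i,j) - N t $$ (i,j)) / (1/2 * t\<^sup>2)"
          using ij D Hc W t by (simp add: Z_def field_simps)
        then show "?T t $$ (i,j) * ?dq t i j = ?T t $$ (i,j) * (Z W t $$ (i,j) - N t $$ (i,j)) / (1/2 * t\<^sup>2)"
          by (simp del: index_mult_mat(1))
      qed
      also have "\<dots> = (mat_inner (?T t) (Z W t) - mat_inner (?T t) (N t)) / (1/2 * t\<^sup>2)"
        unfolding mat_inner_entries[OF Tc Zc[OF W]] mat_inner_entries[OF Tc Nc]
        by (simp only: sum_divide_distrib[symmetric] sum_subtractf[symmetric] right_diff_distrib)
      also have "\<dots> \<le> (ky_fan k (Z W t) - mat_inner (?T t) (N t)) / (1/2 * t\<^sup>2)"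
        using le by (intro divide_right_mono) auto
      finally show ?thesis unfolding N by (simp add: algebra_simps)
    qed
    then show "\<forall>\<^sub>F t in at_right 0. (\<Sum>i<m. \<Sum>j<n. ?T t $$ (i,j) * ?dq t i j)
        \<le> (ky_fan k (Z W t) - ky_fan k D - (\<Sum>i<k. d i) * t) / (1/2 * t\<^sup>2)"
      by (intro eventually_mono[OF eventually_at_right_less])
  qed simp
  show "(\<Sum>i<k. dir_deriv2 (\<lambda>Z. sing_val Z i) D H W0) = 0"
  proof -
    have "mat_l1 ((1/2) \<cdot>\<^sub>m W0 - A2) = 0" using A2 by (simp add: W0(1) mat_l1_def)
    then have l0: "((\<lambda>t. mat_l1 (Z W0 t - N t) / t\<^sup>2) \<longlongrightarrow> 0) (at_right 0)"
      using l1lim[OF W0(2)] by simp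
    have "((\<lambda>t. (ky_fan k (Z W0 t) - ky_fan k D - (\<Sum>i<k. d i) * t) / (1/2 * t\<^sup>2)) \<longlongrightarrow> 0) (at_right 0)"
    proof (rule tendsto_0_le[OF l0, where K = 2])
      have "norm ((ky_fan k (Z W0 t) - ky_fan k D - (\<Sum>i<k. d i) * t) / (1/2 * t\<^sup>2)) \<le> norm (mat_l1 (Z W0 t - N t) / t\<^sup>2) * 2"
        if t: "0 < t" "t < e" for t
      proof -
        have "\<bar>ky_fan k (Z W0 t) - ky_fan k (N t)\<bar> \<le> mat_l1 (Z W0 t - N t)"
          by (rule ky_fan_lipschitz[OF mn k Zc[OF W0(2)] Nc])
        then have "\<bar>ky_fan k (Z W0 t) - ky_fan k D - (\<Sum>i<k. d i) * t\<bar> \<le> mat_l1 (Z W0 t - N t)"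
          using kfN[of t] t by (simp add: algebra_simps)
        then show ?thesis using t mat_l1_nonneg[of "Z W0 t - N t"] by (simp add: abs_mult field_simps)
      qed
      then show "\<forall>\<^sub>F t in at_right 0. norm ((ky_fan k (Z W0 t) - ky_fan k D - (\<Sum>i<k. d i) * t) / (1/2 * t\<^sup>2))
          \<le> norm (mat_l1 (Z W0 t - N t) / t\<^sup>2) * 2"
        by (intro eventually_at_rightI[of 0 e] e) (simp only: greaterThanLessThan_iff)
    qed
    then show ?thesis using tendsto_unique[OF _ sum2[OF W0(2)]] by simp
  qed
qed

section \<open>Rotating a direction into block form\<close>

text \<open>
  Twice this is the coefficient of \<open>u i\<close> in the support function. The convention \<open>x / 0 = 0\<close> is
  essential: for \<open>s i > 0\<close> it drops the pairs with \<open>s j = s i\<close> exactly as the pseudoinverse in \<open>\<Omega>\<close> does,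
  and for \<open>s i = 0\<close> it removes the last term and leaves \<open>\<Sum>h\<^sub>i\<^sub>j h\<^sub>j\<^sub>i / s\<^sub>j\<close> over the nonzero \<open>s\<^sub>j\<close>, which
  is the form with \<open>X\<^sup>\<dagger>\<close>.
\<close>

definition Omega_diag :: "nat \<Rightarrow> nat \<Rightarrow> (nat \<Rightarrow> real) \<Rightarrow> real mat \<Rightarrow> nat \<Rightarrow> real" where
  "Omega_diag m n s h i =
    (\<Sum>j<m. ((h $$ (i,j) + h $$ (j,i)) / 2)\<^sup>2 / (s j - s i) - ((h $$ (i,j) - h $$ (j,i)) / 2)\<^sup>2 / (s j + s i))
    - (\<Sum>j=m..<n. (h $$ (i,j))\<^sup>2) / (2 * s i)"

text \<open>
  For \<open>a = h\<^sub>i\<^sub>j\<close>, \<open>b = h\<^sub>j\<^sub>i\<close>, \<open>s = s\<^sub>i\<close>, \<open>r = s\<^sub>j\<close> the numbers \<open>K\<close> and \<open>G\<close> solve the two linear equations that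
  make both entries of the rotated direction vanish. In terms of \<open>K - G\<close> and \<open>K + G\<close>, which are
  governed by the symmetric part \<open>(a + b) / 2\<close> and the skew part \<open>(a - b) / 2\<close>, the quadratic form
  separates.
\<close>

lemma rotation_pair_contribution:
  fixes a b r s :: real
  assumes "s \<noteq> r" "0 \<le> s" "0 \<le> r"
  defines "K \<equiv> (r * a + s * b) / (r\<^sup>2 - s\<^sup>2)" and "G \<equiv> - (s * a + r * b) / (r\<^sup>2 - s\<^sup>2)"
  shows "1/2 * s * (G\<^sup>2 + K\<^sup>2) - a * G + K * b + r * K * G = ((a + b) / 2)\<^sup>2 / (r - s) - ((a - b) / 2)\<^sup>2 / (r + s)"
    and "a - K * r - s * G = 0"
proof -
  have rs: "r - s \<noteq> 0" "r + s \<noteq> 0" using assms(1-3) by auto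
  define x y where "x = (a + b) / 2 / (r - s)" and "y = (a - b) / 2 / (r + s)"
  have "x * (r - s) = (a + b) / 2" "y * (r + s) = (a - b) / 2"
    unfolding x_def y_def by (rule nonzero_eq_divide_eq[THEN iffD1, OF rs(1) refl]
        nonzero_eq_divide_eq[THEN iffD1, OF rs(2) refl])+
  then have "a + b = 2 * (x * (r - s))" "a - b = 2 * (y * (r + s))" by simp_all
  moreover have "2 * a = (a + b) + (a - b)" "2 * b = (a + b) - (a - b)" by simp_all
  ultimately have ab: "a = x * (r - s) + y * (r + s)" "b = x * (r - s) - y * (r + s)" by simp_all
  have d: "r\<^sup>2 - s\<^sup>2 = (r - s) * (r + s)" by (simp add: power2_eq_square algebra_simps)
  have "r * a + s * b = (x + y) * (r\<^sup>2 - s\<^sup>2)"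
    unfolding ab by (simp add: algebra_simps power2_eq_square)
  then have K: "K = x + y" using rs unfolding K_def d by simp
  have "- (s * a + r * b) = (y - x) * (r\<^sup>2 - s\<^sup>2)"
    unfolding ab by (simp add: algebra_simps power2_eq_square)
  then have G: "G = y - x" using rs unfolding G_def d by simp
  have "((a + b) / 2)\<^sup>2 / (r - s) = x\<^sup>2 * (r - s)"
    unfolding \<open>a + b = _\<close> using rs by (simp add: power2_eq_square)
  moreover have "((a - b) / 2)\<^sup>2 / (r + s) = y\<^sup>2 * (r + s)"
    unfolding \<open>a - b = _\<close> using rs by (simp add: power2_eq_square)
  moreover have "1/2 * s * (G\<^sup>2 + K\<^sup>2) - a * G + K * b + r * K * G = x\<^sup>2 * (r - s) - y\<^sup>2 * (r + s)"
  proof -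
    have GK: "G\<^sup>2 + K\<^sup>2 = 2 * (x\<^sup>2 + y\<^sup>2)" unfolding K G by (simp add: power2_eq_square algebra_simps)
    have "1/2 * s * (G\<^sup>2 + K\<^sup>2) = s * (x\<^sup>2 + y\<^sup>2)" unfolding GK by simp
    then show ?thesis unfolding ab unfolding K G by (simp add: power2_eq_square algebra_simps)
  qed
  ultimately show "1/2 * s * (G\<^sup>2 + K\<^sup>2) - a * G + K * b + r * K * G
      = ((a + b) / 2)\<^sup>2 / (r - s) - ((a - b) / 2)\<^sup>2 / (r + s)" by simp
  show "a - K * r - s * G = 0" unfolding K G ab by (simp add: algebra_simps)
qed

text \<open>
  Off the blocks, \<open>K\<close> and \<open>G\<close> are determined by making \<open>Hb\<close> vanish. Inside a block with positive value
  only \<open>K + G\<close> matters for symmetrising \<open>Hb\<close>; the choice \<open>K = G\<close> makes the contribution of the block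
  to \<open>W0\<close> independent of the remaining entries of \<open>Hb\<close>. On the zero block nothing is rotated.
\<close>

theorem block_rotation:
  fixes H :: "real mat" and s :: "nat \<Rightarrow> real"
  assumes mn: "m \<le> n" and s0: "\<And>i. 0 \<le> s i" and tail: "\<And>j. m \<le> j \<Longrightarrow> s j = 0" and H: "H \<in> carrier_mat m n"
    and D_def: "D = rect_diag m n s"
  obtains K G Hb where "K \<in> carrier_mat m m" "transpose_mat K = - K"
    "G \<in> carrier_mat n n" "transpose_mat G = - G" "Hb \<in> carrier_mat m n"
    "\<And>i j. i < m \<Longrightarrow> j < n \<Longrightarrow> s i \<noteq> s j \<Longrightarrow> Hb $$ (i,j) = 0"
    "\<And>i j. i < m \<Longrightarrow> j < m \<Longrightarrow> s i = s j \<Longrightarrow> s i > 0 \<Longrightarrow> Hb $$ (i,j) = Hb $$ (j,i)"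
    "H = Hb + K * D + D * G"
    "\<And>i. i < m \<Longrightarrow> (D * ((1/2) \<cdot>\<^sub>m (G * G)) + (Hb + K * D) * G + (K * Hb + (1/2) \<cdot>\<^sub>m (K * K) * D)) $$ (i,i)
      = Omega_diag m n s H i"
proof -
  let ?h = "\<lambda>i j. H $$ (i,j)"
  define \<kappa> where "\<kappa> i j = (if s i \<noteq> s j then (s j * ?h i j + s i * ?h j i) / ((s j)\<^sup>2 - (s i)\<^sup>2)
      else if s i > 0 then (?h i j - ?h j i) / (4 * s i) else 0)" for i j
  define \<gamma> where "\<gamma> i j = (if i < m \<and> j < m then
      (if s i \<noteq> s j then - (s i * ?h i j + s j * ?h j i) / ((s j)\<^sup>2 - (s i)\<^sup>2)
       else if s i > 0 then (?h i j - ?h j i) / (4 * s i) else 0)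
      else if i < m then ?h i j / s i else if j < m then - ?h j i / s j else 0)" for i j
  have div_flip: "x / (a - b) = - (x / (b - a))" for x a b :: real
    by (metis minus_diff_eq minus_divide_right)
  have num_flip: "(a - b) / c = - ((b - a) / c)" for a b c :: real
    by (metis minus_diff_eq minus_divide_left)
  have \<kappa>_skew: "\<kappa> j i = - \<kappa> i j" for i j
  proof (cases "s i = s j")
    case True
    then show ?thesis by (simp add: \<kappa>_def num_flip[of "?h j i"])
  next
    case False
    then show ?thesis by (simp add: \<kappa>_def div_flip[of _ "(s i)\<^sup>2"] add.commute)
  qed
  have \<gamma>_skew: "\<gamma> j i = - \<gamma> i j" for i j
  proof (cases "i < m \<and> j < m")
    case True
    show ?thesis
    proof (cases "s i = s j")
      case eq: True
      then show ?thesis using True by (simp add: \<gamma>_def num_flip[of "?h j i"])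
    next
      case False
      then have "\<gamma> j i = - (s j * ?h j i + s i * ?h i j) / ((s i)\<^sup>2 - (s j)\<^sup>2)"
        "\<gamma> i j = - (s i * ?h i j + s j * ?h j i) / ((s j)\<^sup>2 - (s i)\<^sup>2)"
        using True by (auto simp: \<gamma>_def)
      then show ?thesis unfolding div_flip[of _ "(s i)\<^sup>2"] by (simp only: add.commute)
    qed
  next
    case False
    then show ?thesis by (auto simp: \<gamma>_def)
  qed
  define K where "K = mat m m (\<lambda>(i,j). \<kappa> i j)"
  define G where "G = mat n n (\<lambda>(i,j). \<gamma> i j)"
  define Hb where "Hb = mat m n (\<lambda>(i,j). ?h i j - (if j < m then \<kappa> i j * s j else 0) - s i * \<gamma> i j)"
  have D: "D \<in> carrier_mat m n" by (simp add: D_def)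
  have K: "K \<in> carrier_mat m m" and G: "G \<in> carrier_mat n n" and Hb: "Hb \<in> carrier_mat m n"
    by (simp_all add: K_def G_def Hb_def)
  note KD = mult_carrier_mat[OF K D] and DG = mult_carrier_mat[OF D G]
  have Kt: "transpose_mat K = - K"
  proof (rule eq_matI)
    fix i j assume "i < dim_row (- K)" "j < dim_col (- K)"
    then show "transpose_mat K $$ (i,j) = (- K) $$ (i,j)" using \<kappa>_skew[of j i] by (simp add: K_def)
  qed (simp_all add: K_def)
  have Gt: "transpose_mat G = - G"
  proof (rule eq_matI)
    fix i j assume "i < dim_row (- G)" "j < dim_col (- G)"
    then show "transpose_mat G $$ (i,j) = (- G) $$ (i,j)" using \<gamma>_skew[of j i] by (simp add: G_def)
  qed (simp_all add: G_def)
  have KDi: "(K * D) $$ (i,j) = (if j < m then \<kappa> i j * s j else 0)" if "i < m" "j < n" for i j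
    unfolding D_def mult_rect_diag_index[OF K that] using that by (simp add: K_def)
  have DGi: "(D * A) $$ (i,j) = s i * A $$ (i,j)" if "A \<in> carrier_mat n n" "i < m" "j < n" for A :: "real mat" and i j
    unfolding D_def by (rule rect_diag_mult_index[OF that mn])
  have HH: "H = Hb + K * D + D * G"
  proof (rule eq_matI)
    fix i j assume "i < dim_row (Hb + K * D + D * G)" "j < dim_col (Hb + K * D + D * G)"
    then have ij: "i < m" "j < n" using carrier_matD[OF DG] by auto
    have "(Hb + K * D + D * G) $$ (i,j) = Hb $$ (i,j) + (K * D) $$ (i,j) + (D * G) $$ (i,j)"
      using ij carrier_matD[OF DG] carrier_matD[OF KD] by (simp del: index_mult_mat(1))
    also have "\<dots> = H $$ (i,j)"
      unfolding KDi[OF ij] DGi[OF G ij] using ij mn by (simp add: Hb_def G_def)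
    finally show "H $$ (i,j) = (Hb + K * D + D * G) $$ (i,j)" by simp
  qed (use H carrier_matD[OF DG] in auto)
  have block: "Hb $$ (i,j) = 0" if ij: "i < m" "j < n" "s i \<noteq> s j" for i j
  proof (cases "j < m")
    case True
    then show ?thesis
      using rotation_pair_contribution(2)[OF ij(3) s0 s0, of "?h i j" "?h j i"] ij
      by (simp add: Hb_def \<kappa>_def \<gamma>_def)
  next
    case False
    then have "s i \<noteq> 0" using tail[of j] ij by simp
    then show ?thesis using False ij by (simp add: Hb_def \<gamma>_def)
  qed
  have symH: "Hb $$ (i,j) = Hb $$ (j,i)" if ij: "i < m" "j < m" "s i = s j" "s i > 0" for i j
    using ij mn by (simp add: Hb_def \<kappa>_def \<gamma>_def field_simps)
  have diag: "(D * ((1/2) \<cdot>\<^sub>m (G * G)) + (Hb + K * D) * G + (K * Hb + (1/2) \<cdot>\<^sub>m (K * K) * D)) $$ (i,i)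
      = Omega_diag m n s H i" if i: "i < m" for i
  proof -
    have i': "i < n" using i mn by simp
    have G2: "(G * G) \<in> carrier_mat n n" and K2: "K * K \<in> carrier_mat m m" using G K by auto
    have HKD: "Hb + K * D \<in> carrier_mat m n" using KD by (rule add_carrier_mat)
    have c: "D * ((1/2) \<cdot>\<^sub>m (G * G)) \<in> carrier_mat m n" "(Hb + K * D) * G \<in> carrier_mat m n"
      "K * Hb \<in> carrier_mat m n" "(1/2) \<cdot>\<^sub>m (K * K) * D \<in> carrier_mat m n"
      using D G2 G HKD K Hb K2 by (meson mult_carrier_mat smult_carrier_mat)+
    let ?g = "\<lambda>j. \<gamma> i j" and ?k = "\<lambda>j. \<kappa> i j" and ?t = "\<lambda>j. ?h i j - (if j < m then \<kappa> i j * s j else 0) - s i * \<gamma> i j"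
    have e1: "(D * ((1/2) \<cdot>\<^sub>m (G * G))) $$ (i,i) = - (\<Sum>j<n. 1/2 * s i * (?g j)\<^sup>2)"
    proof -
      have "(G * G) $$ (i,i) = (\<Sum>j<n. \<gamma> i j * \<gamma> j i)"
        unfolding mat_mult_sum[OF G G i' i'] using i' by (simp add: G_def)
      also have "\<dots> = - (\<Sum>j<n. (?g j)\<^sup>2)"
        unfolding \<gamma>_skew[of _ i] by (simp add: sum_negf power2_eq_square)
      finally show ?thesis
        unfolding DGi[OF smult_carrier_mat[OF G2] i i'] using i' G2 carrier_matD[OF G]
        by (simp add: sum_distrib_left sum_negf algebra_simps del: index_mult_mat(1))
    qed
    have e2: "((Hb + K * D) * G) $$ (i,i) = - (\<Sum>j<n. (?t j + (if j < m then \<kappa> i j * s j else 0)) * ?g j)"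
    proof -
      have "((Hb + K * D) * G) $$ (i,i) = (\<Sum>j<n. (?t j + (if j < m then \<kappa> i j * s j else 0)) * \<gamma> j i)"
        unfolding mat_mult_sum[OF HKD G i i']
      proof (intro sum.cong refl)
        fix j assume "j \<in> {..<n}"
        then have j: "j < n" by simp
        have "(Hb + K * D) $$ (i,j) = Hb $$ (i,j) + (K * D) $$ (i,j)"
          using i j carrier_matD[OF KD] by simp
        then show "(Hb + K * D) $$ (i,j) * G $$ (j,i) = (?t j + (if j < m then \<kappa> i j * s j else 0)) * \<gamma> j i"
          unfolding KDi[OF i j] using i i' j by (simp add: Hb_def G_def)
      qed
      then show ?thesis unfolding \<gamma>_skew[of _ i] by (simp add: sum_negf)
    qed
    have e3: "(K * Hb) $$ (i,i) = (\<Sum>j<m. ?k j * (?h j i + \<kappa> i j * s i + s j * \<gamma> i j))"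
      unfolding mat_mult_sum[OF K Hb i i'] 
    proof (intro sum.cong refl)
      fix j assume "j \<in> {..<m}"
      then show "K $$ (i,j) * Hb $$ (j,i) = ?k j * (?h j i + \<kappa> i j * s i + s j * \<gamma> i j)"
        using i i' \<kappa>_skew[of i j] \<gamma>_skew[of i j] by (simp add: K_def Hb_def)
    qed
    have e4: "((1/2) \<cdot>\<^sub>m (K * K) * D) $$ (i,i) = - (\<Sum>j<m. 1/2 * s i * (?k j)\<^sup>2)"
    proof -
      have "(K * K) $$ (i,i) = (\<Sum>j<m. \<kappa> i j * \<kappa> j i)"
        unfolding mat_mult_sum[OF K K i i] using i by (simp add: K_def)
      also have "\<dots> = - (\<Sum>j<m. (?k j)\<^sup>2)"
        unfolding \<kappa>_skew[of _ i] by (simp add: sum_negf power2_eq_square)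
      finally show ?thesis
        unfolding D_def mult_rect_diag_index[OF smult_carrier_mat[OF K2] i i'] using i K2 carrier_matD[OF K]
        by (simp add: sum_distrib_left sum_negf algebra_simps del: index_mult_mat(1))
    qed
    have split: "(\<Sum>j<n. f j) = (\<Sum>j<m. f j) + (\<Sum>j=m..<n. f j)" for f :: "nat \<Rightarrow> real"
      using mn by (metis lessThan_atLeast0 le0 sum.atLeastLessThan_concat)
    have pair: "- (1/2 * s i * (?g j)\<^sup>2) - (?t j + (if j < m then \<kappa> i j * s j else 0)) * ?g j
        + ?k j * (?h j i + \<kappa> i j * s i + s j * \<gamma> i j) - 1/2 * s i * (?k j)\<^sup>2
      = ((?h i j + ?h j i) / 2)\<^sup>2 / (s j - s i) - ((?h i j - ?h j i) / 2)\<^sup>2 / (s j + s i)" if j: "j < m" for j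
    proof -
      have "- (1/2 * s i * (?g j)\<^sup>2) - (?t j + (if j < m then \<kappa> i j * s j else 0)) * ?g j
          + ?k j * (?h j i + \<kappa> i j * s i + s j * \<gamma> i j) - 1/2 * s i * (?k j)\<^sup>2
        = 1/2 * s i * ((?g j)\<^sup>2 + (?k j)\<^sup>2) - ?h i j * ?g j + ?k j * ?h j i + s j * ?k j * ?g j"
        using j by (simp add: power2_eq_square algebra_simps)
      also have "\<dots> = ((?h i j + ?h j i) / 2)\<^sup>2 / (s j - s i) - ((?h i j - ?h j i) / 2)\<^sup>2 / (s j + s i)"
      proof (cases "s i = s j")
        case False
        then show ?thesis
          using rotation_pair_contribution(1)[OF False s0 s0, of "?h i j" "?h j i"] i j
          by (simp add: \<kappa>_def \<gamma>_def)
      next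
        case True
        show ?thesis
        proof (cases "s i > 0")
          case pos: True
          define x where "x = ?h i j - ?h j i"
          have kg: "?k j = x / (4 * s i)" "?g j = x / (4 * s i)" using True pos i j by (simp_all add: \<kappa>_def \<gamma>_def x_def)
          have "1/2 * s i * ((x / (4 * s i))\<^sup>2 + (x / (4 * s i))\<^sup>2) + s i * (x / (4 * s i)) * (x / (4 * s i)) - x / (4 * s i) * x
             = - (x / 2)\<^sup>2 / (s i + s i)"
            using pos by (simp add: field_simps power2_eq_square)
          moreover have "1/2 * s i * ((x / (4 * s i))\<^sup>2 + (x / (4 * s i))\<^sup>2) - ?h i j * (x / (4 * s i)) + x / (4 * s i) * ?h j i + s i * (x / (4 * s i)) * (x / (4 * s i))
            = 1/2 * s i * ((x / (4 * s i))\<^sup>2 + (x / (4 * s i))\<^sup>2) + s i * (x / (4 * s i)) * (x / (4 * s i)) - x / (4 * s i) * x"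
            by (simp add: x_def algebra_simps diff_divide_distrib)
          ultimately show ?thesis unfolding kg True[symmetric] by (simp add: x_def)
        next
          case False
          then have "s i = 0" using s0[of i] by simp
          then show ?thesis using True i j by (simp add: \<kappa>_def \<gamma>_def)
        qed
      qed
      finally show ?thesis .
    qed
    have tailterm: "- (1/2 * s i * (?g j)\<^sup>2) - (?t j + (if j < m then \<kappa> i j * s j else 0)) * ?g j
        = - ((?h i j)\<^sup>2 / (2 * s i))" if j: "j \<in> {m..<n}" for j
    proof -
      have g: "?g j = ?h i j / s i" using i j by (simp add: \<gamma>_def)
      show ?thesis
      proof (cases "s i = 0")
        case False
        then show ?thesis using j unfolding g by (simp add: field_simps power2_eq_square)
      qed (use j in \<open>simp add: g\<close>)
    qed
    have "(D * ((1/2) \<cdot>\<^sub>m (G * G)) + (Hb + K * D) * G + (K * Hb + (1/2) \<cdot>\<^sub>m (K * K) * D)) $$ (i,i)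
      = (D * ((1/2) \<cdot>\<^sub>m (G * G))) $$ (i,i) + ((Hb + K * D) * G) $$ (i,i) + ((K * Hb) $$ (i,i) + ((1/2) \<cdot>\<^sub>m (K * K) * D) $$ (i,i))"
      using i i' carrier_matD[OF c(1)] carrier_matD[OF c(2)] carrier_matD[OF c(3)] carrier_matD[OF c(4)]
      by (simp only: index_add_mat)
    also have "\<dots> = (\<Sum>j<n. - (1/2 * s i * (?g j)\<^sup>2) - (?t j + (if j < m then \<kappa> i j * s j else 0)) * ?g j)
        + (\<Sum>j<m. ?k j * (?h j i + \<kappa> i j * s i + s j * \<gamma> i j) - 1/2 * s i * (?k j)\<^sup>2)"
      unfolding e1 e2 e3 e4 by (simp only: sum_subtractf sum_negf)
    also have "\<dots> = (\<Sum>j<m. - (1/2 * s i * (?g j)\<^sup>2) - (?t j + (if j < m then \<kappa> i j * s j else 0)) * ?g j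
        + ?k j * (?h j i + \<kappa> i j * s i + s j * \<gamma> i j) - 1/2 * s i * (?k j)\<^sup>2)
        + (\<Sum>j=m..<n. - (1/2 * s i * (?g j)\<^sup>2) - (?t j + (if j < m then \<kappa> i j * s j else 0)) * ?g j)"
      unfolding split by (simp only: sum_subtractf sum.distrib)
    also have "\<dots> = (\<Sum>j<m. ((?h i j + ?h j i) / 2)\<^sup>2 / (s j - s i) - ((?h i j - ?h j i) / 2)\<^sup>2 / (s j + s i))
        + (\<Sum>j=m..<n. - ((?h i j)\<^sup>2 / (2 * s i)))"
      by (intro arg_cong2[of _ _ _ _ "(+)"] sum.cong refl pair tailterm) auto
    finally show ?thesis by (simp add: Omega_diag_def sum_negf sum_divide_distrib)
  qed
  show ?thesis by (rule that[OF K Kt G Gt Hb block symH HH diag])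
qed

section \<open>The support function in rotated coordinates\<close>

lemma orth_conj_inverse:
  assumes "P \<in> orth_group m" "R \<in> orth_group n" "A \<in> carrier_mat m n"
  shows "transpose_mat P * (P * A * transpose_mat R) * R = A" "P * (transpose_mat P * A * R) * transpose_mat R = A"
proof -
  note P = orth_groupD[OF assms(1)] and R = orth_groupD[OF assms(2)]
  have AR: "A * transpose_mat R \<in> carrier_mat m n" "A * R \<in> carrier_mat m n" using R assms by auto
  have "P * A * transpose_mat R = P * (A * transpose_mat R)" using P R assms by (intro assoc_mult_mat) auto
  then show "transpose_mat P * (P * A * transpose_mat R) * R = A"
    using orth_cancel(1)[OF assms(1) AR(1)] orth_cancel_right(1)[OF assms(2,3)] by simp
  have "transpose_mat P * A * R = transpose_mat P * (A * R)" using P R assms by (intro assoc_mult_mat) auto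
  then show "P * (transpose_mat P * A * R) * transpose_mat R = A"
    using orth_cancel(2)[OF assms(1) AR(2)] orth_cancel_right(2)[OF assms(2,3)] by simp
qed

lemma conj_add:
  assumes "P \<in> carrier_mat m m" "R \<in> carrier_mat n n" "A \<in> carrier_mat m n" "B \<in> carrier_mat m n"
  shows "P * (A + B) * R = P * A * R + P * B * (R :: real mat)"
  using assms by (simp add: mult_add_distrib_mat[of P m m A n B]
    add_mult_distrib_mat[OF mult_carrier_mat[OF assms(1,3)] mult_carrier_mat[OF assms(1,4)] assms(2)])

lemma conj_smult:
  assumes "P \<in> carrier_mat m m" "R \<in> carrier_mat n n" "A \<in> carrier_mat m n"
  shows "P * (c \<cdot>\<^sub>m A) * R = c \<cdot>\<^sub>m (P * A * (R :: real mat))"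
  using assms by (simp add: mult_smult_distrib[OF assms(1,3)]
    mult_smult_assoc_mat[OF mult_carrier_mat[OF assms(1,3)] assms(2)])

lemma dir_deriv_orth_invariant:
  assumes P: "P \<in> orth_group m" and R: "R \<in> orth_group n"
    and A: "A \<in> carrier_mat m n" and H: "H \<in> carrier_mat m n" and W: "W \<in> carrier_mat m n"
    and inv: "\<And>Z. Z \<in> carrier_mat m n \<Longrightarrow> f (P * Z * transpose_mat R) = f Z"
  shows "dir_deriv f (P * A * transpose_mat R) (P * H * transpose_mat R) = dir_deriv f A H"
    and "dir_deriv2 f (P * A * transpose_mat R) (P * H * transpose_mat R) (P * W * transpose_mat R) = dir_deriv2 f A H W"
proof -
  have Pc: "P \<in> carrier_mat m m" and Rc: "transpose_mat R \<in> carrier_mat n n"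
    using orth_groupD(1)[OF P] orth_groupD(1)[OF R] by auto
  have 1: "f (P * A * transpose_mat R + t \<cdot>\<^sub>m (P * H * transpose_mat R)) = f (A + t \<cdot>\<^sub>m H)" for t
  proof -
    have "P * (A + t \<cdot>\<^sub>m H) * transpose_mat R = P * A * transpose_mat R + t \<cdot>\<^sub>m (P * H * transpose_mat R)"
      using A H by (simp add: conj_add[OF Pc Rc] conj_smult[OF Pc Rc])
    then show ?thesis using inv[of "A + t \<cdot>\<^sub>m H"] A H by simp
  qed
  have 2: "f (P * A * transpose_mat R + t \<cdot>\<^sub>m (P * H * transpose_mat R) + c \<cdot>\<^sub>m (P * W * transpose_mat R))
      = f (A + t \<cdot>\<^sub>m H + c \<cdot>\<^sub>m W)" for t c
  proof -
    have "P * (A + t \<cdot>\<^sub>m H + c \<cdot>\<^sub>m W) * transpose_mat R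
        = P * A * transpose_mat R + t \<cdot>\<^sub>m (P * H * transpose_mat R) + c \<cdot>\<^sub>m (P * W * transpose_mat R)"
    proof -
      have c: "t \<cdot>\<^sub>m H \<in> carrier_mat m n" "c \<cdot>\<^sub>m W \<in> carrier_mat m n" "A + t \<cdot>\<^sub>m H \<in> carrier_mat m n"
        using A H W by auto
      show ?thesis
        by (simp only: conj_add[OF Pc Rc c(3,2)] conj_add[OF Pc Rc A c(1)] conj_smult[OF Pc Rc H] conj_smult[OF Pc Rc W])
    qed
    then show ?thesis using inv[of "A + t \<cdot>\<^sub>m H + c \<cdot>\<^sub>m W"] A H W by simp
  qed
  show d: "dir_deriv f (P * A * transpose_mat R) (P * H * transpose_mat R) = dir_deriv f A H"
    by (simp only: dir_deriv_def 1 inv[OF A])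
  show "dir_deriv2 f (P * A * transpose_mat R) (P * H * transpose_mat R) (P * W * transpose_mat R) = dir_deriv2 f A H W"
    by (simp only: dir_deriv2_def 2 d inv[OF A])
qed

text \<open>
  The rotation that diagonalises \<open>Xb + Sb\<close> carries \<open>Sb\<close> to a subgradient at the rotated \<open>Xb\<close>, to which
  \<open>subgradient_of_diagonal_sum\<close> applies.
\<close>

theorem simultaneous_svd:
  assumes mn: "m \<le> n" and k: "k \<le> m" and Xb: "Xb \<in> carrier_mat m n"
    and S: "Sb \<in> subdifferential (ky_fan k) Xb" and svd: "is_svd U (Xb + Sb) V"
  shows "U \<in> orth_group m" "V \<in> orth_group n"
    "Xb = U * rect_diag m n (sing_val Xb) * transpose_mat V" "Sb = U * rect_diag m n (sing_val Sb) * transpose_mat V"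
    "decreasing_nonneg m (sing_val Xb)" "decreasing_nonneg m (sing_val Sb)"
    "\<And>i. i < m \<Longrightarrow> sing_val (Xb + Sb) i = sing_val Xb i + sing_val Sb i"
proof -
  have Sc: "Sb \<in> carrier_mat m n" using S Xb by (auto simp: subdifferential_def)
  let ?X = "Xb + Sb"
  have Xc: "?X \<in> carrier_mat m n" using Sc by (rule add_carrier_mat)
  define y where "y = sing_val ?X"
  have "Sigma_zero_mat ?X = rect_diag m n y"
    unfolding Sigma_zero_mat_def rect_diag_def y_def carrier_matD[OF Xc] by simp
  then show U: "U \<in> orth_group m" and V: "V \<in> orth_group n"
    using svd unfolding is_svd_def carrier_matD[OF Xc] by blast+
  have XD: "?X = U * rect_diag m n y * transpose_mat V"
    using svd \<open>Sigma_zero_mat ?X = _\<close> by (simp add: is_svd_def)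
  have Uc: "transpose_mat U \<in> carrier_mat m m" and Vc: "V \<in> carrier_mat n n"
    using orth_groupD(1)[OF U] orth_groupD(1)[OF V] by auto
  have y: "decreasing_nonneg m y" using svd_exists[OF mn Xc] unfolding y_def by blast
  let ?A = "transpose_mat U * Xb * V" and ?B = "transpose_mat U * Sb * V"
  have A: "?A \<in> carrier_mat m n" using Uc Vc Xb by auto
  have sub: "?B \<in> subdifferential (ky_fan k) ?A"
    using subdifferential_orth_invariant[OF mn k orth_group_transpose[OF U] orth_group_transpose[OF V] Xb S] by simp
  have "?A + ?B = transpose_mat U * ?X * V" by (rule conj_add[OF Uc Vc Xb Sc, symmetric])
  also have "\<dots> = rect_diag m n y"
    unfolding XD using orth_conj_inverse(1)[OF U V, of "rect_diag m n y"] by simp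
  finally obtain x s where xs: "?A = rect_diag m n x" "?B = rect_diag m n s" "decreasing_nonneg m x"
    "decreasing_nonneg m s" "\<And>i. i < m \<Longrightarrow> y i = x i + s i"
    using subgradient_of_diagonal_sum[OF mn k A sub _ y] by blast
  have X: "Xb = U * rect_diag m n x * transpose_mat V" and S': "Sb = U * rect_diag m n s * transpose_mat V"
    using orth_conj_inverse(2)[OF U V Xb] orth_conj_inverse(2)[OF U V Sc] unfolding xs by simp_all
  have sx: "sing_val Xb i = x i" "sing_val Sb i = s i" if "i < m" for i
    using sing_val_unique[OF mn U V xs(3) that] sing_val_unique[OF mn U V xs(4) that] X S' by simp_all
  then have "rect_diag m n (sing_val Xb) = rect_diag m n x" "rect_diag m n (sing_val Sb) = rect_diag m n s"
    by (intro eq_matI; simp)+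
  then show "Xb = U * rect_diag m n (sing_val Xb) * transpose_mat V" "Sb = U * rect_diag m n (sing_val Sb) * transpose_mat V"
    using X S' by simp_all
  show "decreasing_nonneg m (sing_val Xb)" "decreasing_nonneg m (sing_val Sb)"
    using xs(3,4) sx by (auto simp: decreasing_nonneg_def)
  show "sing_val (Xb + Sb) i = sing_val Xb i + sing_val Sb i" if "i < m" for i
    using xs(5)[OF that] sx[OF that] by (simp add: y_def)
qed

text \<open>
  Orthogonal invariance moves the problem to \<open>D\<close>; there the upper bound and its attainment at
  \<open>(W0, 0)\<close> are the two parts of \<open>ky_fan_second_derivative_bounds\<close>. The value \<open>s j = 0\<close> for \<open>j \<ge> m\<close>
  lets the columns beyond \<open>m\<close> join the zero block.
\<close>

theorem support_value:
  fixes H :: "real mat"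
  assumes mn: "m \<le> n" and k: "1 \<le> k" "k \<le> m" and Xb: "Xb \<in> carrier_mat m n"
    and S: "Sb \<in> subdifferential (ky_fan k) Xb" and svd: "is_svd U (Xb + Sb) V"
    and crit: "H \<in> critical_cone (ky_fan k) Xb Sb"
    and s_def: "s = (\<lambda>i. if i < m then sing_val Xb i else 0)"
  shows "support_fun (T2 k Xb H) (Sb, -1)
      = ereal (2 * (\<Sum>i<m. sing_val Sb i * Omega_diag m n s (transpose_mat U * H * V) i))"
proof -
  note sv = simultaneous_svd[OF mn k(2) Xb S svd]
  note U = sv(1) and V = sv(2)
  have Uc: "U \<in> carrier_mat m m" "transpose_mat U \<in> carrier_mat m m" and Vc: "V \<in> carrier_mat n n" "transpose_mat V \<in> carrier_mat n n"
    using orth_groupD(1)[OF U] orth_groupD(1)[OF V] by auto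
  have Sc: "Sb \<in> carrier_mat m n" using S Xb by (auto simp: subdifferential_def)
  have Hc: "H \<in> carrier_mat m n" and cr: "dir_deriv (ky_fan k) Xb H \<le> mat_inner Sb H"
    using crit Xb by (auto simp: critical_cone_def)
  define u where "u = sing_val Sb"
  define D where "D = rect_diag m n s"
  define h where "h = transpose_mat U * H * V"
  have D: "D \<in> carrier_mat m n" by (simp add: D_def)
  have h: "h \<in> carrier_mat m n" using Uc Vc Hc by (auto simp: h_def)
  have Suc: "rect_diag m n u \<in> carrier_mat m n" by simp
  have "rect_diag m n (sing_val Xb) = D" by (rule eq_matI) (auto simp: D_def s_def)
  then have XD: "Xb = U * D * transpose_mat V" using sv(3) by simp
  have SD: "Sb = U * rect_diag m n u * transpose_mat V" using sv(4) by (simp add: u_def)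
  have HD: "H = U * h * transpose_mat V" unfolding h_def by (rule orth_conj_inverse(2)[OF U V Hc, symmetric])
  have s: "decreasing_nonneg m s" using sv(5) by (auto simp: decreasing_nonneg_def s_def)
  have s0: "0 \<le> s i" for i using s by (cases "i < m") (auto simp: decreasing_nonneg_def s_def)
  have tail: "s j = 0" if "m \<le> j" for j using that by (simp add: s_def)
  have sub: "rect_diag m n u \<in> subdifferential (ky_fan k) D"
    using subdifferential_orth_invariant[OF mn k(2) orth_group_transpose[OF U] orth_group_transpose[OF V] Xb S]
      orth_conj_inverse(1)[OF U V D] orth_conj_inverse(1)[OF U V Suc] by (simp add: XD[symmetric] SD[symmetric])
  have pair: "mat_inner (rect_diag m n u) D = ky_fan k D"
    and dual: "\<And>Z. Z \<in> carrier_mat m n \<Longrightarrow> mat_inner (rect_diag m n u) Z \<le> ky_fan k Z"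
    by (rule subgradient_ky_fan_pairing[OF mn k(2) D sub], rule subgradient_ky_fan_pairing(2)[OF mn k(2) D sub])
  have crit': "dir_deriv (ky_fan k) D h \<le> mat_inner (rect_diag m n u) h"
  proof -
    have "dir_deriv (ky_fan k) Xb H = dir_deriv (ky_fan k) D h"
      unfolding XD HD by (rule dir_deriv_orth_invariant(1)[OF U V D h h]) (rule ky_fan_orth_invariant[OF mn U V _ k(2)])
    moreover have "mat_inner Sb H = mat_inner (rect_diag m n u) h"
      unfolding SD HD by (rule mat_inner_orth_invariant[OF U V Suc h])
    ultimately show ?thesis using cr by simp
  qed
  have dd: "(\<Sum>i<k. dir_deriv2 (\<lambda>Z. sing_val Z i) Xb H (U * W * transpose_mat V))
      = (\<Sum>i<k. dir_deriv2 (\<lambda>Z. sing_val Z i) D h W)" if W: "W \<in> carrier_mat m n" for W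
  proof (intro sum.cong refl)
    fix i assume "i \<in> {..<k}"
    then have i: "i < m" using k by simp
    show "dir_deriv2 (\<lambda>Z. sing_val Z i) Xb H (U * W * transpose_mat V) = dir_deriv2 (\<lambda>Z. sing_val Z i) D h W"
      unfolding XD HD by (rule dir_deriv_orth_invariant(2)[OF U V D h W]) (rule sing_val_orth_invariant[OF mn U V _ i])
  qed
  obtain K G Hb where KG: "K \<in> carrier_mat m m" "transpose_mat K = - K"
    "G \<in> carrier_mat n n" "transpose_mat G = - G" "Hb \<in> carrier_mat m n"
    "\<And>i j. i < m \<Longrightarrow> j < n \<Longrightarrow> s i \<noteq> s j \<Longrightarrow> Hb $$ (i,j) = 0"
    "\<And>i j. i < m \<Longrightarrow> j < m \<Longrightarrow> s i = s j \<Longrightarrow> s i > 0 \<Longrightarrow> Hb $$ (i,j) = Hb $$ (j,i)"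
    "h = Hb + K * D + D * G"
    "\<And>i. i < m \<Longrightarrow> (D * ((1/2) \<cdot>\<^sub>m (G * G)) + (Hb + K * D) * G + (K * Hb + (1/2) \<cdot>\<^sub>m (K * K) * D)) $$ (i,i)
      = Omega_diag m n s h i"
    using block_rotation[OF mn s0 tail h D_def] by metis
  define A2 where "A2 = D * ((1/2) \<cdot>\<^sub>m (G * G)) + (Hb + K * D) * G + (K * Hb + (1/2) \<cdot>\<^sub>m (K * K) * D)"
  define W0 where "W0 = 2 \<cdot>\<^sub>m A2"
  have A2: "A2 \<in> carrier_mat m n"
    unfolding A2_def using D KG(1,3,5) by (intro add_carrier_mat mult_carrier_mat smult_carrier_mat) auto
  have W0: "W0 \<in> carrier_mat m n" using A2 by (simp add: W0_def)
  note bounds = ky_fan_second_derivative_bounds[OF mn k(2) s tail KG(1-7) KG(8)[unfolded D_def]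
      pair[unfolded D_def] dual crit'[unfolded D_def] D_def W0_def[unfolded A2_def]]
  have zero: "(\<Sum>i<k. dir_deriv2 (\<lambda>Z. sing_val Z i) D h W0) = 0"
    by (rule bounds(2)) assumption+
  let ?v = "2 * (\<Sum>i<m. u i * Omega_diag m n s h i)"
  have inner0: "mat_inner (rect_diag m n u) W0 = ?v"
  proof -
    have "mat_inner (rect_diag m n u) W0 = (\<Sum>i<m. u i * W0 $$ (i,i))" by (rule rect_diag_inner[OF W0 mn])
    also have "\<dots> = (\<Sum>i<m. 2 * (u i * Omega_diag m n s h i))"
    proof (intro sum.cong refl)
      fix i assume "i \<in> {..<m}"
      then have i: "i < m" by simp
      have "W0 $$ (i,i) = 2 * A2 $$ (i,i)" unfolding W0_def using i mn A2 by simp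
      then show "u i * W0 $$ (i,i) = 2 * (u i * Omega_diag m n s h i)"
        using KG(9)[OF i] by (simp add: A2_def)
    qed
    finally show ?thesis by (simp add: sum_distrib_left)
  qed
  have "support_fun (T2 k Xb H) (Sb, -1) = ereal ?v"
    unfolding support_fun_def
  proof (rule antisym)
    show "(SUP q\<in>T2 k Xb H. ereal (mat_inner (fst (Sb, - 1)) (fst q) + snd (Sb, - 1) * snd q)) \<le> ereal ?v"
    proof (rule SUP_least)
      fix q assume q: "q \<in> T2 k Xb H"
      obtain W \<eta> where q': "q = (W, \<eta>)" by (cases q)
      have W: "W \<in> carrier_mat m n" and eta: "(\<Sum>i<k. dir_deriv2 (\<lambda>Z. sing_val Z i) Xb H W) \<le> \<eta>"
        using q Xb by (auto simp: T2_def q')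
      let ?W = "transpose_mat U * W * V"
      have Wc: "?W \<in> carrier_mat m n" using Uc Vc W by auto
      have WD: "W = U * ?W * transpose_mat V" by (rule orth_conj_inverse(2)[OF U V W, symmetric])
      have "mat_inner Sb W = mat_inner (rect_diag m n u) ?W"
        by (subst WD, subst SD) (rule mat_inner_orth_invariant[OF U V Suc Wc])
      moreover have "(\<Sum>i<k. dir_deriv2 (\<lambda>Z. sing_val Z i) Xb H W) = (\<Sum>i<k. dir_deriv2 (\<lambda>Z. sing_val Z i) D h ?W)"
        by (subst WD) (rule dd[OF Wc])
      moreover have "mat_inner (rect_diag m n u) ?W - mat_inner (rect_diag m n u) W0
          \<le> (\<Sum>i<k. dir_deriv2 (\<lambda>Z. sing_val Z i) D h ?W)"
        by (rule bounds(1)) (assumption | rule Wc)+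
      ultimately have "mat_inner Sb W - \<eta> \<le> ?v" using eta inner0 by linarith
      then show "ereal (mat_inner (fst (Sb, - 1)) (fst q) + snd (Sb, - 1) * snd q) \<le> ereal ?v" by (simp add: q')
    qed
    show "ereal ?v \<le> (SUP q\<in>T2 k Xb H. ereal (mat_inner (fst (Sb, - 1)) (fst q) + snd (Sb, - 1) * snd q))"
    proof (rule SUP_upper2[of "(U * W0 * transpose_mat V, 0)"])
      have "U * W0 * transpose_mat V \<in> carrier_mat m n" using Uc Vc W0 by auto
      then show "(U * W0 * transpose_mat V, 0) \<in> T2 k Xb H"
        using Xb dd[OF W0] zero by (simp add: T2_def)
      have "mat_inner Sb (U * W0 * transpose_mat V) = ?v"
        unfolding inner0[symmetric] by (subst SD) (rule mat_inner_orth_invariant[OF U V Suc W0])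
      then show "ereal ?v \<le> ereal (mat_inner (fst (Sb, - 1)) (fst (U * W0 * transpose_mat V, 0::real)) + snd (Sb, - 1) * snd (U * W0 * transpose_mat V, 0::real))"
        by simp
    qed
  qed
  then show ?thesis by (simp add: u_def h_def)
qed

section \<open>Pseudoinverses, column selections and the matrices \<Omega>\<close>

text \<open>
  Uniqueness of the Moore-Penrose inverse: \<open>A * B\<close> and \<open>A * C\<close> are symmetric and absorb each other.
\<close>

lemma pinv_eqI:
  fixes A B :: "real mat"
  assumes A: "A \<in> carrier_mat p q" and B: "B \<in> carrier_mat q p"
    and "A * B * A = A" "B * A * B = B" "transpose_mat (A * B) = A * B" "transpose_mat (B * A) = B * A"
  shows "pinv A = B"
  unfolding pinv_def
proof (rule the_equality)
  show "B \<in> carrier_mat (dim_col A) (dim_row A) \<and> A * B * A = A \<and> B * A * B = B \<and>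
      transpose_mat (A * B) = A * B \<and> transpose_mat (B * A) = B * A"
    using assms by auto
next
  fix C assume "C \<in> carrier_mat (dim_col A) (dim_row A) \<and> A * C * A = A \<and> C * A * C = C \<and>
      transpose_mat (A * C) = A * C \<and> transpose_mat (C * A) = C * A"
  then have C: "C \<in> carrier_mat q p" "A * C * A = A" "C * A * C = C" "transpose_mat (A * C) = A * C"
    "transpose_mat (C * A) = C * A" using A by auto
  note AB = mult_carrier_mat[OF A B] and AC = mult_carrier_mat[OF A C(1)]
    and BA = mult_carrier_mat[OF B A] and CA = mult_carrier_mat[OF C(1) A]
  have "A * B = A * C * (A * B)"
    using C(2) assoc_mult_mat[OF AC A B] by simp
  also have "\<dots> = transpose_mat (A * B * (A * C))"
    by (simp only: transpose_mult[OF AB AC] assms(5) C(4))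
  also have "A * B * (A * C) = A * C"
    using assms(3) assoc_mult_mat[OF AB A C(1)] by simp
  also have "transpose_mat (A * C) = A * C" by (rule C(4))
  finally have 1: "A * B = A * C" .
  have "B * A = B * (A * C * A)" by (simp only: C(2))
  also have "\<dots> = B * A * (C * A)"
    by (simp only: assoc_mult_mat[OF A C(1) A] assoc_mult_mat[OF B A CA])
  also have "\<dots> = transpose_mat (C * A * (B * A))"
    by (simp only: transpose_mult[OF CA BA] assms(6) C(5))
  also have "C * A * (B * A) = C * A"
    by (simp only: assoc_mult_mat[OF C(1) A BA] assoc_mult_mat[OF A B A, symmetric] assms(3))
  also have "transpose_mat (C * A) = C * A" by (rule C(5))
  finally have 2: "B * A = C * A" .
  have "C = C * A * C" by (simp only: C(3))
  also have "\<dots> = B * A * C" by (simp only: 2)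
  also have "\<dots> = B * (A * C)" by (rule assoc_mult_mat[OF B A C(1)])
  also have "\<dots> = B * (A * B)" by (simp only: 1)
  also have "\<dots> = B * A * B" by (rule assoc_mult_mat[OF B A B, symmetric])
  also have "\<dots> = B" by (rule assms(4))
  finally show "C = B" .
qed

lemma pinv_mat_diag:
  fixes e :: "nat \<Rightarrow> real"
  shows "pinv (mat_diag m e) = mat_diag m (\<lambda>i. 1 / e i)"
  by (rule pinv_eqI[of _ m m]) (auto simp: transpose_mat_diag mult.assoc intro!: arg_cong[of _ _ "mat_diag m"])

lemma rect_diag_mat_diag_mult:
  assumes "m \<le> n"
  shows "mat_diag m e * rect_diag m n a = rect_diag m n (\<lambda>i. e i * a i)"
    "rect_diag m n a * mat_diag n e = rect_diag m n (\<lambda>i. a i * e i)"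
  by (rule eq_matI; simp add: mat_diag_mult_left[of _ m n])
    (rule eq_matI; simp add: mat_diag_mult_right[of _ m n])

lemma pinv_svd:
  assumes mn: "m \<le> n" and U: "U \<in> orth_group m" and V: "V \<in> orth_group n"
  shows "pinv (U * rect_diag m n s * transpose_mat V)
     = V * transpose_mat (rect_diag m n (\<lambda>i. 1 / s i)) * transpose_mat U"
proof -
  let ?D = "rect_diag m n s" and ?E = "rect_diag m n (\<lambda>i. 1 / s i)"
  let ?A = "U * ?D * transpose_mat V" and ?B = "V * transpose_mat ?E * transpose_mat U"
  note U' = orth_groupD[OF U] and V' = orth_groupD[OF V]
  have Ec: "transpose_mat ?E \<in> carrier_mat n m" and Dc: "?D \<in> carrier_mat m n" by auto
  have A: "?A \<in> carrier_mat m n" and B: "?B \<in> carrier_mat n m" using U' V' by auto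
  have key: "P * M * transpose_mat Q * (Q * N * transpose_mat R) = P * (M * N) * transpose_mat R"
    if "P \<in> carrier_mat a a" "M \<in> carrier_mat a b" "Q \<in> orth_group b" "N \<in> carrier_mat b c" "R \<in> carrier_mat c c"
    for P M Q N R :: "real mat" and a b c
  proof -
    have Q: "Q \<in> carrier_mat b b" using orth_groupD(1)[OF that(3)] .
    have Rt: "transpose_mat R \<in> carrier_mat c c" and Qt: "transpose_mat Q \<in> carrier_mat b b" using that Q by auto
    have NR: "N * transpose_mat R \<in> carrier_mat b c" and PM: "P * M \<in> carrier_mat a b"
      using that Rt by auto
    have "P * M * transpose_mat Q * (Q * N * transpose_mat R) = P * M * (transpose_mat Q * (Q * (N * transpose_mat R)))"
      using assoc_mult_mat[OF PM Qt, of "Q * (N * transpose_mat R)" c] assoc_mult_mat[OF Q that(4) Rt] NR Q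
      by simp
    also have "\<dots> = P * M * (N * transpose_mat R)" using orth_cancel(1)[OF that(3) NR] by simp
    also have "\<dots> = P * M * N * transpose_mat R" using assoc_mult_mat[OF PM that(4) Rt] by simp
    also have "P * M * N = P * (M * N)" using assoc_mult_mat[OF that(1,2,4)] by simp
    finally show ?thesis .
  qed
  have AB: "?A * ?B = U * mat_diag m (\<lambda>i. s i * (1 / s i)) * transpose_mat U"
    unfolding key[OF U'(1) Dc V Ec U'(1)] rect_diag_transpose_mult(1)[OF mn] by (rule refl)
  have BA: "?B * ?A = V * mat_diag n (\<lambda>i. if i < m then s i * (1 / s i) else 0) * transpose_mat V"
    unfolding key[OF V'(1) Ec U Dc V'(1)] rect_diag_transpose_mult(2)[OF mn] by (rule refl)
  have symm: "transpose_mat (Q * mat_diag p e * transpose_mat Q) = Q * mat_diag p e * transpose_mat Q"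
    if "Q \<in> carrier_mat p p" for Q :: "real mat" and p e
  proof -
    have Qt: "transpose_mat Q \<in> carrier_mat p p" using that by simp
    show ?thesis
      unfolding transpose_mult[OF mult_carrier_mat[OF that mat_diag_dim] Qt] transpose_mult[OF that mat_diag_dim]
        transpose_mat_diag transpose_transpose
      by (rule assoc_mult_mat[OF that mat_diag_dim Qt, symmetric])
  qed
  have ABA: "?A * ?B * ?A = ?A"
  proof -
    have "?A * ?B * ?A = U * (mat_diag m (\<lambda>i. s i * (1 / s i)) * ?D) * transpose_mat V"
      unfolding AB by (rule key[OF U'(1) mat_diag_dim U Dc V'(1)])
    also have "mat_diag m (\<lambda>i. s i * (1 / s i)) * ?D = ?D"
      unfolding rect_diag_mat_diag_mult(1)[OF mn] by (rule eq_matI) auto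
    finally show ?thesis .
  qed
  have BAB: "?B * ?A * ?B = ?B"
  proof -
    have "?B * ?A * ?B = V * (mat_diag n (\<lambda>i. if i < m then s i * (1 / s i) else 0) * transpose_mat ?E) * transpose_mat U"
      unfolding BA by (rule key[OF V'(1) mat_diag_dim V Ec U'(1)])
    also have "mat_diag n (\<lambda>i. if i < m then s i * (1 / s i) else 0) * transpose_mat ?E
        = transpose_mat (?E * mat_diag n (\<lambda>i. if i < m then s i * (1 / s i) else 0))"
      by (simp add: transpose_mult[of _ m n _ n] transpose_mat_diag)
    also have "?E * mat_diag n (\<lambda>i. if i < m then s i * (1 / s i) else 0) = ?E"
      unfolding rect_diag_mat_diag_mult(2)[OF mn] by (rule eq_matI) auto
    finally show ?thesis .
  qed
  show ?thesis
    by (rule pinv_eqI[OF A B ABA BAB]) (simp_all only: AB BA symm[OF U'(1)] symm[OF V'(1)])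
qed

lemma cols_sub_carrier:
  assumes "A \<in> carrier_mat p q" "J \<subseteq> {..<q}"
  shows "cols_sub A J \<in> carrier_mat p (card J)"
    and "i < p \<Longrightarrow> c < card J \<Longrightarrow> cols_sub A J $$ (i,c) = A $$ (i, pick J c)"
proof -
  have J: "{j. j < dim_col A \<and> j \<in> J} = J" and I: "{i. i < dim_row A \<and> i \<in> (UNIV :: nat set)} = {..<p}"
    using assms by auto
  show "cols_sub A J \<in> carrier_mat p (card J)"
    unfolding cols_sub_def by (rule carrier_matI) (simp_all only: dim_submatrix I J card_lessThan)
  show "cols_sub A J $$ (i,c) = A $$ (i, pick J c)" if "i < p" "c < card J"
    unfolding cols_sub_def using that by (subst submatrix_index) (simp_all only: I J card_lessThan pick_UNIV)
qed

lemma bij_betw_pick: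
  assumes "finite J"
  shows "bij_betw (pick J) {..<card J} J"
proof -
  have "J \<subseteq> pick J ` {..<card J}"
  proof
    fix i assume i: "i \<in> J"
    have "{a \<in> J. a < i} \<subset> J" using i by blast
    then have "card {a \<in> J. a < i} < card J" by (rule psubset_card_mono[OF assms])
    then show "i \<in> pick J ` {..<card J}"
      by (intro image_eqI[of _ _ "card {a \<in> J. a < i}"]) (simp_all only: pick_card_in_set[OF i] lessThan_iff)
  qed
  moreover have "pick J ` {..<card J} \<subseteq> J" using pick_in_set_le[of _ J] by auto
  ultimately have im: "pick J ` {..<card J} = J" by blast
  then have "inj_on (pick J) {..<card J}" by (intro eq_card_imp_inj_on) auto
  then show ?thesis using im by (simp add: bij_betw_def)
qed

lemma pick_interval:
  assumes "c < b - a"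
  shows "pick {a..<b} c = a + c"
proof -
  have "{x \<in> {a..<b}. x < a + c} = {a..<a + c}" using assms by auto
  then have "card {x \<in> {a..<b}. x < a + c} = c" by simp
  then show ?thesis using pick_card_in_set[of "a + c" "{a..<b}"] assms by auto
qed

lemma gram_diagonal:
  fixes A :: "real mat"
  assumes "A \<in> carrier_mat p q" "i < p"
  shows "(A * transpose_mat A) $$ (i,i) = (\<Sum>j<q. (A $$ (i,j))\<^sup>2)"
  using assms by (simp add: scalar_prod_def lessThan_atLeast0 power2_eq_square)

lemma mult_cols_sub_index:
  fixes A V :: "real mat"
  assumes "A \<in> carrier_mat p q" "V \<in> carrier_mat q r" "J \<subseteq> {..<r}" "i < p" "c < card J"
  shows "(A * cols_sub V J) $$ (i,c) = (A * V) $$ (i, pick J c)"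
proof -
  have "finite J" using assms(3) finite_subset by blast
  then have "pick J c < r" using pick_in_set_le[of c J] assms by auto
  then show ?thesis
    using assms cols_sub_carrier[OF assms(2,3)] by (simp add: scalar_prod_def)
qed

lemma sym_skew_part_index:
  assumes "M \<in> carrier_mat m m" "i < m" "j < m"
  shows "sym_part M $$ (i,j) = (M $$ (i,j) + M $$ (j,i)) / 2" "skew_part M $$ (i,j) = (M $$ (i,j) - M $$ (j,i)) / 2"
  using assms by (simp_all add: sym_part_def skew_part_def)

text \<open>
  In the basis \<open>U\<close>, \<open>V\<close> each of the three summands of \<open>\<Omega>\<close> has a diagonal that is a weighted sum of
  squares of entries of \<open>h\<close>; the negative sign of the skew part disappears in the square.
\<close>

theorem Omega_diagonal_entry:
  assumes mn: "m \<le> n" and Xb: "Xb \<in> carrier_mat m n" and H: "H \<in> carrier_mat m n"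
    and U: "U \<in> carrier_mat m m" and V: "V \<in> carrier_mat n n" and a: "a \<subseteq> {..<m}"
    and c: "c < card a" and nu: "sing_val Xb (pick a c) = \<nu>"
  shows "Omega U V Xb H a \<nu> \<in> carrier_mat (card a) (card a)"
    and "Omega U V Xb H a \<nu> $$ (c,c)
      = Omega_diag m n (\<lambda>i. if i < m then sing_val Xb i else 0) (transpose_mat U * H * V) (pick a c)"
proof -
  let ?h = "transpose_mat U * H * V" and ?r = "card a" and ?i = "pick a c"
  let ?V1 = "cols_sub V {..<m}" and ?V2 = "cols_sub V {m..<n}" and ?Ua = "cols_sub U a"
  have UH: "transpose_mat U * H \<in> carrier_mat m n" and h: "?h \<in> carrier_mat m n" using U H V by auto
  have fin: "finite a" using a finite_subset by blast
  have i: "?i < m" using pick_in_set_le[OF c] a by auto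
  have J1: "{..<m} \<subseteq> {..<n}" and J2: "{m..<n} \<subseteq> {..<n}" using mn by auto
  have V1: "?V1 \<in> carrier_mat n m" using cols_sub_carrier(1)[OF V J1] by simp
  have V2: "?V2 \<in> carrier_mat n (n - m)" using cols_sub_carrier(1)[OF V J2] by simp
  have Ua: "?Ua \<in> carrier_mat m ?r" by (rule cols_sub_carrier(1)[OF U a])
  let ?M = "transpose_mat U * H * ?V1"
  have M: "?M \<in> carrier_mat m m" using UH V1 by auto
  have Me: "?M $$ (p,q) = ?h $$ (p,q)" if "p < m" "q < m" for p q
    using mult_cols_sub_index[OF UH V J1 that(1), of q] pick_interval[of q m 0] that by (simp add: lessThan_atLeast0)
  have symM: "sym_part ?M \<in> carrier_mat m m" and skewM: "skew_part ?M \<in> carrier_mat m m"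
    unfolding sym_part_def skew_part_def
    by (intro smult_carrier_mat add_carrier_mat minus_carrier_mat, use M in simp)+
  let ?P = "cols_sub (sym_part ?M) a" and ?Q = "cols_sub (skew_part ?M) a"
  have P: "?P \<in> carrier_mat m ?r" and Q: "?Q \<in> carrier_mat m ?r"
    using cols_sub_carrier(1)[OF symM a] cols_sub_carrier(1)[OF skewM a] by auto
  have Pe: "?P $$ (j,c) = (?h $$ (?i,j) + ?h $$ (j,?i)) / 2" and Qe: "?Q $$ (j,c) = - ((?h $$ (?i,j) - ?h $$ (j,?i)) / 2)"
    if j: "j < m" for j
    unfolding cols_sub_carrier(2)[OF symM a j c] cols_sub_carrier(2)[OF skewM a j c] sym_skew_part_index[OF M j i]
      Me[OF j i] Me[OF i j]
    by (simp_all add: add.commute diff_divide_distrib del: index_mult_mat(1))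
  let ?s = "sing_val Xb"
  have L1: "pinv (Sigma_mat Xb - \<nu> \<cdot>\<^sub>m 1\<^sub>m m) = mat_diag m (\<lambda>j. 1 / (?s j - \<nu>))"
  proof -
    have "Sigma_mat Xb - \<nu> \<cdot>\<^sub>m 1\<^sub>m m = mat_diag m (\<lambda>j. ?s j - \<nu>)"
      using Xb by (intro eq_matI) (auto simp: Sigma_mat_def mat_diag_def)
    then show ?thesis by (simp add: pinv_mat_diag)
  qed
  have L2: "pinv (- Sigma_mat Xb - \<nu> \<cdot>\<^sub>m 1\<^sub>m m) = mat_diag m (\<lambda>j. 1 / (- ?s j - \<nu>))"
  proof -
    have "- Sigma_mat Xb - \<nu> \<cdot>\<^sub>m 1\<^sub>m m = mat_diag m (\<lambda>j. - ?s j - \<nu>)"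
      using Xb by (intro eq_matI) (auto simp: Sigma_mat_def mat_diag_def)
    then show ?thesis by (simp add: pinv_mat_diag)
  qed
  have quad: "(transpose_mat A * mat_diag m e * A) $$ (c,c) = (\<Sum>j<m. e j * (A $$ (j,c))\<^sup>2)"
    if "A \<in> carrier_mat m ?r" for A :: "real mat" and e
    using that c by (simp add: mat_diag_mult_right[of _ ?r m] scalar_prod_def lessThan_atLeast0 power2_eq_square mult_ac)
  let ?T = "transpose_mat ?Ua * H * ?V2"
  have T: "?T \<in> carrier_mat ?r (n - m)" using Ua H V2 by auto
  have TT: "transpose_mat ?Ua * H * ?V2 * transpose_mat ?V2 * transpose_mat H * ?Ua = ?T * transpose_mat ?T"
  proof -
    have c: "transpose_mat ?Ua \<in> carrier_mat ?r m" "transpose_mat ?V2 \<in> carrier_mat (n - m) n"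
      "transpose_mat H \<in> carrier_mat n m" using Ua V2 H by auto
    have "transpose_mat ?T = transpose_mat ?V2 * (transpose_mat H * ?Ua)"
      by (simp only: transpose_mult[OF mult_carrier_mat[OF c(1) H] V2] transpose_mult[OF c(1) H] transpose_transpose)
    moreover have "?T * transpose_mat ?V2 * transpose_mat H * ?Ua = ?T * transpose_mat ?V2 * (transpose_mat H * ?Ua)"
      by (rule assoc_mult_mat[OF mult_carrier_mat[OF T c(2)] c(3) Ua])
    moreover have "\<dots> = ?T * (transpose_mat ?V2 * (transpose_mat H * ?Ua))"
      by (rule assoc_mult_mat[OF T c(2) mult_carrier_mat[OF c(3) Ua]])
    ultimately show ?thesis by simp
  qed
  have Te: "?T $$ (c,j) = ?h $$ (?i, m + j)" if j: "j < n - m" for j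
  proof -
    have UaH: "transpose_mat ?Ua * H \<in> carrier_mat ?r n" using Ua H by auto
    have pj: "pick {m..<n} j = m + j" by (rule pick_interval[OF j])
    have rowUa: "(transpose_mat ?Ua * H) $$ (c,l) = (transpose_mat U * H) $$ (?i,l)" if "l < n" for l
    proof -
      have "row (transpose_mat ?Ua) c = row (transpose_mat U) ?i"
        using Ua U c i cols_sub_carrier(2)[OF U a _ c] by (intro eq_vecI) auto
      then show ?thesis using Ua U H c i that by simp
    qed
    have "?T $$ (c,j) = (transpose_mat ?Ua * H * V) $$ (c, m + j)"
      using mult_cols_sub_index[OF UaH V J2 c, of j] j pj by simp
    also have "\<dots> = ?h $$ (?i, m + j)"
    proof -
      have mj: "m + j < n" using j by simp
      show ?thesis
        unfolding mat_mult_sum[OF UaH V c mj] mat_mult_sum[OF UH V i mj]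
        by (intro sum.cong refl) (simp only: rowUa lessThan_iff)
    qed
    finally show ?thesis .
  qed
  have Om: "Omega U V Xb H a \<nu> = transpose_mat ?P * mat_diag m (\<lambda>j. 1 / (?s j - \<nu>)) * ?P
      + transpose_mat ?Q * mat_diag m (\<lambda>j. 1 / (- ?s j - \<nu>)) * ?Q - (1 / (2 * \<nu>)) \<cdot>\<^sub>m (?T * transpose_mat ?T)"
    unfolding Omega_def Let_def carrier_matD[OF Xb] L1 L2 TT by (rule refl)
  have cc: "transpose_mat ?P * mat_diag m e * ?P \<in> carrier_mat ?r ?r" "transpose_mat ?Q * mat_diag m e * ?Q \<in> carrier_mat ?r ?r"
    "(1 / (2 * \<nu>)) \<cdot>\<^sub>m (?T * transpose_mat ?T) \<in> carrier_mat ?r ?r" for e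
    using P Q T by (auto simp: mat_diag_def)
  show "Omega U V Xb H a \<nu> \<in> carrier_mat ?r ?r"
    unfolding Om by (intro minus_carrier_mat add_carrier_mat cc)
  have tail: "(?T * transpose_mat ?T) $$ (c,c) = (\<Sum>j=m..<n. (?h $$ (?i,j))\<^sup>2)"
  proof -
    have "(?T * transpose_mat ?T) $$ (c,c) = (\<Sum>j<n - m. (?T $$ (c,j))\<^sup>2)"
      by (rule gram_diagonal[OF T c])
    also have "\<dots> = (\<Sum>j<n - m. (?h $$ (?i, m + j))\<^sup>2)" by (intro sum.cong refl) (simp add: Te del: index_mult_mat(1))
    also have "\<dots> = (\<Sum>j=m..<n. (?h $$ (?i,j))\<^sup>2)"
      using sum.atLeastLessThan_shift_0[of "\<lambda>j. (?h $$ (?i,j))\<^sup>2" m n] by (simp add: lessThan_atLeast0 o_def)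
    finally show ?thesis .
  qed
  have "Omega U V Xb H a \<nu> $$ (c,c) = (\<Sum>j<m. 1 / (?s j - \<nu>) * (?P $$ (j,c))\<^sup>2)
      + (\<Sum>j<m. 1 / (- ?s j - \<nu>) * (?Q $$ (j,c))\<^sup>2) - (1 / (2 * \<nu>)) * (\<Sum>j=m..<n. (?h $$ (?i,j))\<^sup>2)"
  proof -
    have "Omega U V Xb H a \<nu> $$ (c,c) = (transpose_mat ?P * mat_diag m (\<lambda>j. 1 / (?s j - \<nu>)) * ?P) $$ (c,c)
      + (transpose_mat ?Q * mat_diag m (\<lambda>j. 1 / (- ?s j - \<nu>)) * ?Q) $$ (c,c) - (1 / (2 * \<nu>)) * (?T * transpose_mat ?T) $$ (c,c)"
      unfolding Om using carrier_matD[OF cc(1)] carrier_matD[OF cc(2)] carrier_matD[OF cc(3)] carrier_matD[OF T] c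
      by (simp del: index_mult_mat(1))
    then show ?thesis by (simp only: quad[OF P] quad[OF Q] tail)
  qed
  also have "\<dots> = (\<Sum>j<m. 1 / (?s j - \<nu>) * (?P $$ (j,c))\<^sup>2 + 1 / (- ?s j - \<nu>) * (?Q $$ (j,c))\<^sup>2)
      - (1 / (2 * \<nu>)) * (\<Sum>j=m..<n. (?h $$ (?i,j))\<^sup>2)" by (simp only: sum.distrib)
  also have "(\<Sum>j<m. 1 / (?s j - \<nu>) * (?P $$ (j,c))\<^sup>2 + 1 / (- ?s j - \<nu>) * (?Q $$ (j,c))\<^sup>2)
      = (\<Sum>j<m. ((?h $$ (?i,j) + ?h $$ (j,?i)) / 2)\<^sup>2 / (?s j - ?s ?i) - ((?h $$ (?i,j) - ?h $$ (j,?i)) / 2)\<^sup>2 / (?s j + ?s ?i))"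
  proof (intro sum.cong refl)
    fix j assume "j \<in> {..<m}"
    then have j: "j < m" by simp
    have neg: "1 / (- ?s j - \<nu>) = - (1 / (?s j + \<nu>))"
      by (metis minus_add_distrib minus_divide_right uminus_add_conv_diff add.commute)
    show "1 / (?s j - \<nu>) * (?P $$ (j,c))\<^sup>2 + 1 / (- ?s j - \<nu>) * (?Q $$ (j,c))\<^sup>2
      = ((?h $$ (?i,j) + ?h $$ (j,?i)) / 2)\<^sup>2 / (?s j - ?s ?i) - ((?h $$ (?i,j) - ?h $$ (j,?i)) / 2)\<^sup>2 / (?s j + ?s ?i)"
      unfolding Pe[OF j] Qe[OF j] neg nu power2_minus by (simp del: index_mult_mat(1))
  qed
  finally show "Omega U V Xb H a \<nu> $$ (c,c)
      = Omega_diag m n (\<lambda>i. if i < m then ?s i else 0) ?h ?i"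
    using i nu by (simp add: Omega_diag_def del: index_mult_mat(1))
qed

section \<open>Index sets and the final formulas\<close>

lemma mat_diag_inner:
  assumes M: "M \<in> carrier_mat p p"
  shows "mat_inner (mat_diag p e) M = (\<Sum>c<p. e c * M $$ (c,c))"
proof -
  have "mat_inner (mat_diag p e) M = (\<Sum>i<p. \<Sum>j<p. mat_diag p e $$ (i,j) * M $$ (i,j))"
    by (rule mat_inner_entries[OF mat_diag_dim M])
  also have "\<dots> = (\<Sum>i<p. \<Sum>j<p. if i = j then e i * M $$ (i,j) else 0)"
    by (intro sum.cong refl) (auto simp: mat_diag_def)
  finally show ?thesis by simp
qed

lemma mat_tr_Omega:
  assumes mn: "m \<le> n" and Xb: "Xb \<in> carrier_mat m n" and H: "H \<in> carrier_mat m n"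
    and U: "U \<in> carrier_mat m m" and V: "V \<in> carrier_mat n n" and a: "a \<subseteq> {..<m}" "a \<noteq> {}"
    and nu: "\<And>i. i \<in> a \<Longrightarrow> sing_val Xb i = \<nu>"
  shows "mat_tr (2 \<cdot>\<^sub>m Omega U V Xb H a \<nu>)
    = 2 * (\<Sum>i\<in>a. Omega_diag m n (\<lambda>i. if i < m then sing_val Xb i else 0) (transpose_mat U * H * V) i)"
proof -
  let ?w = "Omega_diag m n (\<lambda>i. if i < m then sing_val Xb i else 0) (transpose_mat U * H * V)"
  let ?O = "Omega U V Xb H a \<nu>"
  have fin: "finite a" using a finite_subset by blast
  then have "0 < card a" using a by (simp add: card_gt_0_iff)
  have nu': "sing_val Xb (pick a c) = \<nu>" if "c < card a" for c using nu[OF pick_in_set_le[OF that]] .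
  have O: "?O \<in> carrier_mat (card a) (card a)"
    by (rule Omega_diagonal_entry(1)[OF mn Xb H U V a(1) \<open>0 < card a\<close> nu'[OF \<open>0 < card a\<close>]])
  have "mat_tr (2 \<cdot>\<^sub>m ?O) = (\<Sum>c<card a. 2 * ?w (pick a c))"
    unfolding mat_tr_def using O Omega_diagonal_entry(2)[OF mn Xb H U V a(1) _ nu'] by (intro sum.cong) auto
  also have "\<dots> = (\<Sum>i\<in>a. 2 * ?w i)"
    by (rule sum.reindex_bij_betw[OF bij_betw_pick[OF fin]])
  finally show ?thesis by (simp add: sum_distrib_left)
qed

text \<open>
  The values above \<open>\<sigma>\<^sub>k\<^sub>0(X)\<close> (counting from 0) form an initial segment of the decreasing list of
  distinct nonzero values, and the indices on which they are taken are exactly those below \<open>k0\<close>.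
\<close>

lemma leading_blocks:
  assumes m: "dim_row X = m" and y: "decreasing_nonneg m (sing_val X)" and k0: "k0 < m"
    and drop: "0 < k0 \<longrightarrow> sing_val X k0 < sing_val X (k0 - 1)"
  shows "{0..<k0} = (\<Union>l<block_count X {0..<k0}. sv_block X l)"
    and "l < block_count X {0..<k0} \<Longrightarrow> sv_block X l \<noteq> {}"
    and "l < block_count X {0..<k0} \<Longrightarrow> l' < block_count X {0..<k0} \<Longrightarrow> l \<noteq> l' \<Longrightarrow> sv_block X l \<inter> sv_block X l' = {}"
proof -
  define y' where "y' = sing_val X"
  define nv where "nv = nonzero_values X"
  let ?A = "y' ` {..<m} - {0}"
  have dec: "y' j \<le> y' i" if "i \<le> j" "j < m" for i j using y that by (simp add: y'_def decreasing_nonneg_def)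
  have nn: "0 \<le> y' i" if "i < m" for i using y that by (simp add: y'_def decreasing_nonneg_def)
  have nv: "set nv = ?A" "sorted_wrt (>) nv"
    by (simp_all add: nv_def nonzero_values_def m y'_def sorted_wrt_rev)
  have less: "nv ! l' < nv ! l" if "l < l'" "l' < length nv" for l l'
    using sorted_wrt_nth_less[OF nv(2) that] .
  have inj: "l = l'" if "nv ! l = nv ! l'" "l < length nv" "l' < length nv" for l l'
    using less[of l l'] less[of l' l] that by (metis less_irrefl linorder_neqE_nat)
  have blk: "sv_block X l = {i. i < m \<and> y' i = nv ! l}" for l by (simp add: sv_block_def m y'_def nv_def)
  have ne: "sv_block X l \<noteq> {}" if "l < length nv" for l
  proof -
    have "nv ! l \<in> ?A" using nth_mem[OF that] nv(1) by simp
    then show ?thesis unfolding blk by auto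
  qed
  have disj: "sv_block X l \<inter> sv_block X l' = {}" if "l < length nv" "l' < length nv" "l \<noteq> l'" for l l'
    unfolding blk using inj that by auto
  define r where "r = card {l. l < length nv \<and> y' k0 < nv ! l}"
  have r: "l < r \<longleftrightarrow> y' k0 < nv ! l" if "l < length nv" for l
  proof
    assume "y' k0 < nv ! l"
    have "{..l} \<subseteq> {l. l < length nv \<and> y' k0 < nv ! l}"
    proof
      fix j assume "j \<in> {..l}"
      then show "j \<in> {l. l < length nv \<and> y' k0 < nv ! l}"
        using that \<open>y' k0 < nv ! l\<close> less[of j l] by (cases "j = l") auto
    qed
    then have "card {..l} \<le> r" unfolding r_def by (intro card_mono) auto
    then show "l < r" by simp
  next
    assume "l < r"
    show "y' k0 < nv ! l"
    proof (rule ccontr)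
      assume nl: "\<not> y' k0 < nv ! l"
      have "{l. l < length nv \<and> y' k0 < nv ! l} \<subseteq> {..<l}"
      proof
        fix j assume "j \<in> {l. l < length nv \<and> y' k0 < nv ! l}"
        then show "j \<in> {..<l}" using less[of l j] nl by (cases "l < j"; cases "l = j") auto
      qed
      then have "r \<le> card {..<l}" unfolding r_def by (intro card_mono) auto
      with \<open>l < r\<close> show False by simp
    qed
  qed
  have rL: "r \<le> length nv"
    unfolding r_def using card_mono[of "{..<length nv}" "{l. l < length nv \<and> y' k0 < nv ! l}"] by auto
  have union: "{0..<k0} = (\<Union>l<r. sv_block X l)"
  proof (intro subset_antisym subsetI)
    fix i assume "i \<in> {0..<k0}"
    then have i: "i < k0" "i < m" using k0 by auto
    then have gt: "y' k0 < y' i" using drop dec[of i "k0 - 1"] k0 by (auto simp: y'_def intro: less_le_trans)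
    then have "y' i \<in> set nv" using nn[OF k0] i unfolding nv(1) by auto
    then obtain l where l: "l < length nv" "nv ! l = y' i" by (auto simp: in_set_conv_nth)
    then have "l < r" using r gt by simp
    then show "i \<in> (\<Union>l<r. sv_block X l)"
      using l i by (intro UN_I[of l]) (simp_all add: blk)
  next
    fix i assume "i \<in> (\<Union>l<r. sv_block X l)"
    then obtain l where l: "l < r" "i < m" "y' i = nv ! l" by (auto simp: blk)
    then have "y' k0 < y' i" using r[of l] rL by simp
    then have "i < k0" using dec[of k0 i] l by (cases "k0 \<le> i") auto
    then show "i \<in> {0..<k0}" by simp
  qed
  have mono: "False" if ab: "a < b" "b \<le> length nv" "(\<Union>l<a. sv_block X l) = (\<Union>l<b. sv_block X l)" for a b
  proof -
    have "sv_block X a \<noteq> {}" using ne[of a] ab by simp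
    then obtain i where i: "i \<in> sv_block X a" by blast
    then have "i \<in> (\<Union>l<b. sv_block X l)" using ab(1) by blast
    then have "i \<in> (\<Union>l<a. sv_block X l)" using ab(3) by simp
    then obtain l where l: "l < a" "i \<in> sv_block X l" by blast
    then have "sv_block X l \<inter> sv_block X a = {}" using ab by (intro disj) auto
    then show False using i l by blast
  qed
  have bc: "block_count X {0..<k0} = r"
    unfolding block_count_def nv_def[symmetric]
  proof (rule the_equality)
    show "r \<le> length nv \<and> {0..<k0} = (\<Union>l<r. sv_block X l)" using rL union by simp
    show "r' = r" if "r' \<le> length nv \<and> {0..<k0} = (\<Union>l<r'. sv_block X l)" for r'
      using mono[of r r'] mono[of r' r] that rL union by (metis linorder_neqE_nat)
  qed
  show "{0..<k0} = (\<Union>l<block_count X {0..<k0}. sv_block X l)" unfolding bc by (rule union)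
  show "l < block_count X {0..<k0} \<Longrightarrow> sv_block X l \<noteq> {}" unfolding bc using ne[of l] rL by simp
  show "l < block_count X {0..<k0} \<Longrightarrow> l' < block_count X {0..<k0} \<Longrightarrow> l \<noteq> l' \<Longrightarrow> sv_block X l \<inter> sv_block X l' = {}"
    unfolding bc using disj[of l l'] rL by simp
qed

text \<open>
  The hypothesis on \<open>shift\<close> reflects that the weights are 1 on these indices; it makes \<open>\<sigma>(Xb)\<close>
  constant on each block of \<open>X\<close>.
\<close>

lemma Omega_trace_sum_eq:
  assumes mn: "m \<le> n" and Xb: "Xb \<in> carrier_mat m n" and H: "H \<in> carrier_mat m n" and X: "X \<in> carrier_mat m n"
    and U: "U \<in> carrier_mat m m" and V: "V \<in> carrier_mat n n"
    and y: "decreasing_nonneg m (sing_val X)" and k0: "k0 < m"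
    and drop: "0 < k0 \<longrightarrow> sing_val X k0 < sing_val X (k0 - 1)"
    and shift: "\<And>i. i < k0 \<Longrightarrow> sing_val X i = sing_val Xb i + 1"
  shows "Omega_trace_sum X U V Xb H {0..<k0}
    = 2 * (\<Sum>i<k0. Omega_diag m n (\<lambda>i. if i < m then sing_val Xb i else 0) (transpose_mat U * H * V) i)"
proof -
  let ?w = "Omega_diag m n (\<lambda>i. if i < m then sing_val Xb i else 0) (transpose_mat U * H * V)"
  note blocks = leading_blocks[OF carrier_matD(1)[OF X] y k0 drop]
  let ?r = "block_count X {0..<k0}"
  have tr: "mat_tr (2 \<cdot>\<^sub>m Omega U V Xb H (sv_block X l) (common_value Xb (sv_block X l))) = 2 * (\<Sum>i\<in>sv_block X l. ?w i)"
    if l: "l < ?r" for l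
  proof -
    have sub: "sv_block X l \<subseteq> {0..<k0}" using blocks(1) l by blast
    obtain i0 where i0: "i0 \<in> sv_block X l" using blocks(2)[OF l] by blast
    have const: "sing_val Xb i = sing_val Xb i0" if "i \<in> sv_block X l" for i
    proof -
      have "i < k0" "i0 < k0" using sub that i0 by auto
      moreover have "sing_val X i = sing_val X i0" using that i0 by (simp add: sv_block_def)
      ultimately show ?thesis using shift[of i] shift[of i0] by simp
    qed
    have "common_value Xb (sv_block X l) = sing_val Xb i0"
      unfolding common_value_def using i0 by (intro the_equality ballI) (blast intro: const, metis)
    then have nu: "sing_val Xb i = common_value Xb (sv_block X l)" if "i \<in> sv_block X l" for i
      by (simp only: const[OF that])
    show ?thesis
      by (rule mat_tr_Omega[OF mn Xb H U V _ blocks(2)[OF l] nu]) (use sub k0 in auto)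
  qed
  have "Omega_trace_sum X U V Xb H {0..<k0} = (\<Sum>l<?r. 2 * (\<Sum>i\<in>sv_block X l. ?w i))"
    unfolding Omega_trace_sum_def by (intro sum.cong refl) (simp only: tr lessThan_iff)
  also have "\<dots> = 2 * (\<Sum>l<?r. \<Sum>i\<in>sv_block X l. ?w i)" by (simp add: sum_distrib_left)
  also have "(\<Sum>l<?r. \<Sum>i\<in>sv_block X l. ?w i) = (\<Sum>i\<in>(\<Union>l<?r. sv_block X l). ?w i)"
    using blocks(3) by (intro sum.UNION_disjoint[symmetric]) (auto simp: sv_block_def)
  also have "(\<Union>l<?r. sv_block X l) = {..<k0}" using blocks(1) by (simp add: lessThan_atLeast0)
  finally show ?thesis .
qed

lemma Omega_block_inner:
  assumes mn: "m \<le> n" and Xb: "Xb \<in> carrier_mat m n" and H: "H \<in> carrier_mat m n"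
    and U: "U \<in> carrier_mat m m" and V: "V \<in> carrier_mat n n" and k01: "k0 < k1" "k1 \<le> m"
    and nu: "\<And>i. i \<in> {k0..<k1} \<Longrightarrow> sing_val Xb i = \<nu>"
  shows "mat_inner (mat_diag (k1 - k0) (\<lambda>i. u (k0 + i))) (2 \<cdot>\<^sub>m Omega U V Xb H {k0..<k1} \<nu>)
    = 2 * (\<Sum>i=k0..<k1. u i * Omega_diag m n (\<lambda>i. if i < m then sing_val Xb i else 0) (transpose_mat U * H * V) i)"
proof -
  let ?w = "Omega_diag m n (\<lambda>i. if i < m then sing_val Xb i else 0) (transpose_mat U * H * V)"
  let ?O = "Omega U V Xb H {k0..<k1} \<nu>"
  have a: "{k0..<k1} \<subseteq> {..<m}" using k01 by auto
  have c0: "0 < card {k0..<k1}" using k01 by simp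
  have nu': "sing_val Xb (pick {k0..<k1} c) = \<nu>" if "c < card {k0..<k1}" for c
    using nu[OF pick_in_set_le[OF that]] by simp
  have O: "?O \<in> carrier_mat (k1 - k0) (k1 - k0)"
    using Omega_diagonal_entry(1)[OF mn Xb H U V a c0 nu'[OF c0]] by simp
  have "mat_inner (mat_diag (k1 - k0) (\<lambda>i. u (k0 + i))) (2 \<cdot>\<^sub>m ?O)
      = (\<Sum>c<k1 - k0. u (k0 + c) * (2 \<cdot>\<^sub>m ?O) $$ (c,c))"
    by (rule mat_diag_inner) (use O in simp)
  also have "\<dots> = (\<Sum>c<k1 - k0. 2 * (u (k0 + c) * ?w (k0 + c)))"
  proof (intro sum.cong refl)
    fix c assume "c \<in> {..<k1 - k0}"
    then have c: "c < k1 - k0" "c < card {k0..<k1}" by auto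
    show "u (k0 + c) * (2 \<cdot>\<^sub>m ?O) $$ (c,c) = 2 * (u (k0 + c) * ?w (k0 + c))"
      using Omega_diagonal_entry(2)[OF mn Xb H U V a c(2) nu'[OF c(2)]] O c pick_interval[OF c(1)] by simp
  qed
  also have "\<dots> = 2 * (\<Sum>i=k0..<k1. u i * ?w i)"
    using sum.atLeastLessThan_shift_0[of "\<lambda>i. u i * ?w i" k0 k1]
    by (simp add: lessThan_atLeast0 o_def sum_distrib_left)
  finally show ?thesis .
qed

text \<open>
  On the zero block \<open>\<sigma>\<^sub>i = 0\<close>, and \<open>((a + b) / 2)\<^sup>2 - ((a - b) / 2)\<^sup>2 = a * b\<close> turns \<open>Omega_diag\<close> into the
  diagonal of the product through the pseudoinverse.
\<close>

lemma pinv_block_inner: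
  assumes mn: "m \<le> n" and H: "H \<in> carrier_mat m n" and U: "U \<in> orth_group m" and V: "V \<in> orth_group n"
    and Xb: "Xb = U * rect_diag m n (sing_val Xb) * transpose_mat V" and k0: "k0 \<le> m"
    and zero: "\<And>i. i \<in> {k0..<m} \<Longrightarrow> sing_val Xb i = 0"
  shows "mat_inner (mat_diag (m - k0) (\<lambda>i. u (k0 + i)))
      (2 \<cdot>\<^sub>m (transpose_mat (cols_sub U {k0..<m}) * H * pinv Xb * H * cols_sub V {k0..<m}))
    = 2 * (\<Sum>i=k0..<m. u i * Omega_diag m n (\<lambda>i. if i < m then sing_val Xb i else 0) (transpose_mat U * H * V) i)"
proof -
  let ?s = "sing_val Xb" and ?h = "transpose_mat U * H * V"
  let ?w = "Omega_diag m n (\<lambda>i. if i < m then ?s i else 0) ?h"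
  let ?E = "transpose_mat (rect_diag m n (\<lambda>i. 1 / ?s i))"
  let ?Ub = "cols_sub U {k0..<m}" and ?Vb = "cols_sub V {k0..<m}"
  have Uc: "U \<in> carrier_mat m m" and Vc: "V \<in> carrier_mat n n" using orth_groupD(1)[OF U] orth_groupD(1)[OF V] .
  have E: "?E \<in> carrier_mat n m" by simp
  have J: "{k0..<m} \<subseteq> {..<m}" "{k0..<m} \<subseteq> {..<n}" using mn by auto
  have Ub: "?Ub \<in> carrier_mat m (m - k0)" and Vb: "?Vb \<in> carrier_mat n (m - k0)"
    using cols_sub_carrier(1)[OF Uc J(1)] cols_sub_carrier(1)[OF Vc J(2)] by auto
  have pinv: "pinv Xb = V * ?E * transpose_mat U"
    by (subst Xb) (rule pinv_svd[OF mn U V])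
  have Ubt: "transpose_mat ?Ub \<in> carrier_mat (m - k0) m" and Ut: "transpose_mat U \<in> carrier_mat m m"
    using Ub Uc by auto
  have h: "?h \<in> carrier_mat m n" using Ut H Vc by auto
  let ?L = "transpose_mat ?Ub * H * V" and ?R = "transpose_mat U * H * ?Vb"
  have UbH: "transpose_mat ?Ub * H \<in> carrier_mat (m - k0) n" and UH: "transpose_mat U * H \<in> carrier_mat m n"
    using Ubt Ut H by auto
  have L: "?L \<in> carrier_mat (m - k0) n" and R: "?R \<in> carrier_mat m (m - k0)" using UbH UH Vc Vb by auto
  let ?M = "transpose_mat ?Ub * H * pinv Xb * H * ?Vb"
  have M: "?M = ?L * (?E * ?R)"
  proof -
    have VE: "V * ?E \<in> carrier_mat n m" using Vc E by (rule mult_carrier_mat)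
    have LE: "?L * ?E \<in> carrier_mat (m - k0) m" using L E by (rule mult_carrier_mat)
    have "transpose_mat ?Ub * H * (V * ?E * transpose_mat U) = ?L * ?E * transpose_mat U"
      by (simp only: assoc_mult_mat[OF UbH VE Ut, symmetric] assoc_mult_mat[OF UbH Vc E, symmetric])
    then have "?M = ?L * ?E * transpose_mat U * H * ?Vb" by (simp only: pinv)
    also have "\<dots> = ?L * ?E * ?R"
      by (simp only: assoc_mult_mat[OF LE Ut H] assoc_mult_mat[OF LE UH Vb])
    also have "\<dots> = ?L * (?E * ?R)" by (rule assoc_mult_mat[OF L E R])
    finally show ?thesis .
  qed
  have ER: "?E * ?R \<in> carrier_mat n (m - k0)" using E R by (rule mult_carrier_mat)
  have Mc: "?M \<in> carrier_mat (m - k0) (m - k0)" unfolding M by (rule mult_carrier_mat[OF L ER])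
  have entry: "?M $$ (c,c) = ?w (k0 + c)" if c: "c < m - k0" for c
  proof -
    let ?i = "k0 + c"
    have i: "?i < m" using c by simp
    have cc: "c < card {k0..<m}" using c by simp
    have pk: "pick {k0..<m} c = ?i" by (rule pick_interval[OF c])
    have Le: "?L $$ (c,l) = ?h $$ (?i,l)" if l: "l < n" for l
    proof -
      have rows: "(transpose_mat ?Ub * H) $$ (c,q) = (transpose_mat U * H) $$ (?i,q)" if q: "q < n" for q
        unfolding mat_mult_sum[OF Ubt H c q] mat_mult_sum[OF Ut H i q]
      proof (intro sum.cong refl)
        fix x assume "x \<in> {..<m}"
        then show "transpose_mat ?Ub $$ (c,x) * H $$ (x,q) = transpose_mat U $$ (?i,x) * H $$ (x,q)"
          using Ub Uc c i cols_sub_carrier(2)[OF Uc J(1) _ cc, of x] pk by simp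
      qed
      show ?thesis
        unfolding mat_mult_sum[OF UbH Vc c l] mat_mult_sum[OF UH Vc i l]
        by (intro sum.cong refl) (simp only: rows lessThan_iff)
    qed
    have Re: "?R $$ (l,c) = ?h $$ (l,?i)" if l: "l < m" for l
      using mult_cols_sub_index[OF UH Vc J(2) l cc] pk by simp
    have ERe: "(?E * ?R) $$ (l,c) = (if l < m then 1 / ?s l * ?h $$ (l,?i) else 0)" if l: "l < n" for l
    proof -
      have "(?E * ?R) $$ (l,c) = (\<Sum>q<m. ?E $$ (l,q) * ?R $$ (q,c))" by (rule mat_mult_sum[OF E R l c])
      also have "\<dots> = (\<Sum>q<m. if q = l then 1 / ?s l * ?h $$ (l,?i) else 0)"
      proof (intro sum.cong refl)
        fix q assume "q \<in> {..<m}"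
        then have q: "q < m" "q < n" using mn by auto
        then have "?E $$ (l,q) = (if q = l then 1 / ?s l else 0)" using l by auto
        then show "?E $$ (l,q) * ?R $$ (q,c) = (if q = l then 1 / ?s l * ?h $$ (l,?i) else 0)"
          using Re[OF q(1)] by (simp del: index_mult_mat(1))
      qed
      also have "\<dots> = (if l < m then 1 / ?s l * ?h $$ (l,?i) else 0)" by (simp del: index_mult_mat(1))
      finally show ?thesis .
    qed
    have "?M $$ (c,c) = (\<Sum>l<n. ?L $$ (c,l) * (?E * ?R) $$ (l,c))"
      unfolding M by (rule mat_mult_sum[OF L ER c c])
    also have "\<dots> = (\<Sum>l<n. if l < m then ?h $$ (?i,l) * ?h $$ (l,?i) / ?s l else 0)"
    proof (intro sum.cong refl)
      fix l assume "l \<in> {..<n}"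
      then have l: "l < n" by simp
      show "?L $$ (c,l) * (?E * ?R) $$ (l,c) = (if l < m then ?h $$ (?i,l) * ?h $$ (l,?i) / ?s l else 0)"
        unfolding Le[OF l] ERe[OF l] by (simp del: index_mult_mat(1))
    qed
    also have "\<dots> = (\<Sum>l\<in>{..<n} \<inter> {l. l < m}. ?h $$ (?i,l) * ?h $$ (l,?i) / ?s l)"
      by (simp add: sum.inter_restrict del: index_mult_mat(1))
    also have "{..<n} \<inter> {l. l < m} = {..<m}" using mn by auto
    also have "(\<Sum>l<m. ?h $$ (?i,l) * ?h $$ (l,?i) / ?s l) = ?w ?i"
    proof -
      have si: "?s ?i = 0" using zero[of ?i] i by simp
      have "((a + b) / 2)\<^sup>2 - ((a - b) / 2)\<^sup>2 = a * b" for a b :: real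
        by (simp add: power2_eq_square field_simps)
      then have polar: "((a + b) / 2)\<^sup>2 / t - ((a - b) / 2)\<^sup>2 / t = a * b / t" for a b t :: real
        by (simp only: diff_divide_distrib[symmetric])
      have "?w ?i = (\<Sum>l<m. ((?h $$ (?i,l) + ?h $$ (l,?i)) / 2)\<^sup>2 / ?s l - ((?h $$ (?i,l) - ?h $$ (l,?i)) / 2)\<^sup>2 / ?s l)"
        unfolding Omega_diag_def using i si by (simp del: index_mult_mat(1))
      then show ?thesis by (simp only: polar)
    qed
    finally show ?thesis .
  qed
  have "mat_inner (mat_diag (m - k0) (\<lambda>i. u (k0 + i))) (2 \<cdot>\<^sub>m ?M) = (\<Sum>c<m - k0. u (k0 + c) * (2 \<cdot>\<^sub>m ?M) $$ (c,c))"
    by (rule mat_diag_inner) (use Mc in simp)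
  also have "\<dots> = (\<Sum>c<m - k0. 2 * (u (k0 + c) * ?w (k0 + c)))"
  proof (intro sum.cong refl)
    fix c assume "c \<in> {..<m - k0}"
    then have c: "c < m - k0" by simp
    have "(2 \<cdot>\<^sub>m ?M) $$ (c,c) = 2 * ?M $$ (c,c)"
      using c carrier_matD[OF Mc] by (intro index_smult_mat(1)) auto
    then show "u (k0 + c) * (2 \<cdot>\<^sub>m ?M) $$ (c,c) = 2 * (u (k0 + c) * ?w (k0 + c))"
      unfolding entry[OF c] by simp
  qed
  also have "\<dots> = 2 * (\<Sum>i=k0..<m. u i * ?w i)"
    using sum.atLeastLessThan_shift_0[of "\<lambda>i. u i * ?w i" k0 m]
    by (simp add: lessThan_atLeast0 o_def sum_distrib_left)
  finally show ?thesis .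
qed

theorem proposition6p1:
  fixes k m n :: nat and Xb Sb X U V H :: "real mat"
  assumes "1 \<le> k" and "k \<le> m" and "m \<le> n"
    and "Xb \<in> carrier_mat m n"
    and "Sb \<in> carrier_mat m n"
    and "Sb \<in> subdifferential (ky_fan k) Xb"
    and "X = Xb + Sb"
    and "is_svd U X V"
    and "H \<in> critical_cone (ky_fan k) Xb Sb"
  shows
    "(sing_val Xb (k - 1) > 0 \<longrightarrow>
       (\<forall>k0 k1. index_bounds_pos (sing_val Xb) m k k0 k1 \<longrightarrow>
          support_fun (T2 k Xb H) (Sb, -1) =
            ereal (Omega_trace_sum X U V Xb H {0..<k0}
              + mat_inner (mat_diag (k1 - k0) (\<lambda>i. sing_val Sb (k0 + i)))
                  (2 \<cdot>\<^sub>m Omega U V Xb H {k0..<k1} (sing_val Xb (k - 1))))))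
     \<and>
     (sing_val Xb (k - 1) = 0 \<longrightarrow>
       (\<forall>k0. index_bounds_zero (sing_val Xb) m k k0 \<longrightarrow>
          support_fun (T2 k Xb H) (Sb, -1) =
            ereal (Omega_trace_sum X U V Xb H {0..<k0}
              + mat_inner (mat_diag (m - k0) (\<lambda>i. sing_val Sb (k0 + i)))
                  (2 \<cdot>\<^sub>m (transpose_mat (cols_sub U {k0..<m}) * H * pinv Xb * H
                          * cols_sub V {k0..<m})))))"
proof -
  note k = assms(1,2) and mn = assms(3) and Xb = assms(4) and Sc = assms(5) and S = assms(6)
  have svd: "is_svd U (Xb + Sb) V" using assms(7,8) by simp
  note sv = simultaneous_svd[OF mn k(2) Xb S svd]
  have Uc: "U \<in> carrier_mat m m" and Vc: "V \<in> carrier_mat n n"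
    using orth_groupD(1)[OF sv(1)] orth_groupD(1)[OF sv(2)] .
  have H: "H \<in> carrier_mat m n" using assms(9) Xb by (auto simp: critical_cone_def)
  have Xc: "X \<in> carrier_mat m n" unfolding assms(7) by (rule add_carrier_mat[OF Sc])
  let ?s = "sing_val Xb" and ?u = "sing_val Sb"
  let ?w = "Omega_diag m n (\<lambda>i. if i < m then ?s i else 0) (transpose_mat U * H * V)"
  have support: "support_fun (T2 k Xb H) (Sb, -1) = ereal (2 * (\<Sum>i<m. ?u i * ?w i))"
    by (rule support_value[OF mn k Xb S svd assms(9) refl])
  have y: "decreasing_nonneg m (sing_val X)" using svd_exists[OF mn Xc] by blast
  have sum: "sing_val X i = ?s i + ?u i" if "i < m" for i using sv(7)[OF that] assms(7) by simp
  have dec: "?s j \<le> ?s i" "?u j \<le> ?u i" if "i \<le> j" "j < m" for i j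
    using sv(5,6) that by (auto simp: decreasing_nonneg_def)
  have Ssub: "rect_diag m n ?u \<in> subdifferential (ky_fan k) (rect_diag m n ?s)"
  proof -
    have "transpose_mat U * Xb * V = rect_diag m n ?s" "transpose_mat U * Sb * V = rect_diag m n ?u"
      using orth_conj_inverse(1)[OF sv(1,2), of "rect_diag m n ?s"] orth_conj_inverse(1)[OF sv(1,2), of "rect_diag m n ?u"]
        sv(3,4) by simp_all
    then show ?thesis
      using subdifferential_orth_invariant[OF mn k(2) orth_group_transpose[OF sv(1)] orth_group_transpose[OF sv(2)] Xb S]
      by simp
  qed
  note pairing = subgradient_ky_fan_pairing[OF mn k(2) rect_diag_carrier(1) Ssub]
  note weights = subgradient_weights[OF mn k sv(5,6) pairing]
  have trace: "Omega_trace_sum X U V Xb H {0..<k0} = 2 * (\<Sum>i<k0. ?w i)" "(\<Sum>i<k0. ?u i * ?w i) = (\<Sum>i<k0. ?w i)"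
    if k0: "k0 \<le> k - 1" "0 < k0 \<longrightarrow> ?s k0 < ?s (k0 - 1)" "?s k0 = ?s (k - 1)" for k0
  proof -
    have k0m: "k0 < m" using k0 k by simp
    have u1: "?u i = 1" if "i < k0" for i
    proof (rule weights(1))
      have "?s (k - 1) < ?s (k0 - 1)" using k0 that by auto
      also have "\<dots> \<le> ?s i" using that k0m by (intro dec) auto
      finally show "?s (k - 1) < ?s i" .
    qed (use that k0m in auto)
    have "sing_val X k0 < sing_val X (k0 - 1)" if "0 < k0"
      using k0(2) that sum[OF k0m] sum[of "k0 - 1"] dec(2)[of "k0 - 1" k0] k0m by auto
    then show "Omega_trace_sum X U V Xb H {0..<k0} = 2 * (\<Sum>i<k0. ?w i)"
      using Omega_trace_sum_eq[OF mn Xb H Xc Uc Vc y k0m] sum u1 k0m by auto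
    show "(\<Sum>i<k0. ?u i * ?w i) = (\<Sum>i<k0. ?w i)" by (intro sum.cong refl) (simp add: u1)
  qed
  have split: "(\<Sum>i<m. f i) = (\<Sum>i<a. f i) + (\<Sum>i=a..<m. f i)" if "a \<le> m" for f :: "nat \<Rightarrow> real" and a
    using that by (metis lessThan_atLeast0 le0 sum.atLeastLessThan_concat)
  show ?thesis
  proof (intro conjI impI allI)
    fix k0 k1 assume "index_bounds_pos ?s m k k0 k1"
    then have b: "k0 \<le> k - 1" "k \<le> k1" "k1 \<le> m" "0 < k0 \<longrightarrow> ?s k0 < ?s (k0 - 1)"
      "\<And>i. i \<in> {k0..<k1} \<Longrightarrow> ?s i = ?s (k - 1)" "k1 < m \<longrightarrow> ?s k1 < ?s (k1 - 1)"
      by (auto simp: index_bounds_pos_def)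
    have k01: "k0 < k1" using b(1,2) k by simp
    have u0: "?u i = 0" if "k1 \<le> i" "i < m" for i
    proof (rule weights(2))
      have "?s i \<le> ?s k1" using that by (intro dec) auto
      also have "\<dots> < ?s (k1 - 1)" using b(6) that by auto
      also have "?s (k1 - 1) = ?s (k - 1)" using b(5)[of "k1 - 1"] k01 by auto
      finally show "?s i < ?s (k - 1)" .
    qed (use that in auto)
    have "(\<Sum>i<m. ?u i * ?w i) = (\<Sum>i<k0. ?u i * ?w i) + (\<Sum>i=k0..<k1. ?u i * ?w i) + (\<Sum>i=k1..<m. ?u i * ?w i)"
      using split[of k0 "\<lambda>i. ?u i * ?w i"] sum.atLeastLessThan_concat[of k0 k1 m "\<lambda>i. ?u i * ?w i"] k01 b(3) by simp
    also have "(\<Sum>i=k1..<m. ?u i * ?w i) = 0" by (intro sum.neutral) (auto simp: u0)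
    finally have "2 * (\<Sum>i<m. ?u i * ?w i) = Omega_trace_sum X U V Xb H {0..<k0} + 2 * (\<Sum>i=k0..<k1. ?u i * ?w i)"
      using trace[OF b(1,4) b(5)[of k0]] k01 by simp
    also have "2 * (\<Sum>i=k0..<k1. ?u i * ?w i)
        = mat_inner (mat_diag (k1 - k0) (\<lambda>i. ?u (k0 + i))) (2 \<cdot>\<^sub>m Omega U V Xb H {k0..<k1} (?s (k - 1)))"
      by (rule Omega_block_inner[OF mn Xb H Uc Vc k01 b(3) b(5), symmetric])
    finally show "support_fun (T2 k Xb H) (Sb, -1) =
        ereal (Omega_trace_sum X U V Xb H {0..<k0}
          + mat_inner (mat_diag (k1 - k0) (\<lambda>i. ?u (k0 + i))) (2 \<cdot>\<^sub>m Omega U V Xb H {k0..<k1} (?s (k - 1))))"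
      using support by simp
  next
    fix k0 assume z: "?s (k - 1) = 0" and "index_bounds_zero ?s m k k0"
    then have b: "k0 \<le> k - 1" "0 < k0 \<longrightarrow> ?s k0 < ?s (k0 - 1)" "\<And>i. i \<in> {k0..<m} \<Longrightarrow> ?s i = 0"
      by (auto simp: index_bounds_zero_def)
    have k0m: "k0 < m" using b(1) k by simp
    have "?s k0 = ?s (k - 1)" using b(3)[of k0] k0m z by simp
    then have "2 * (\<Sum>i<m. ?u i * ?w i) = Omega_trace_sum X U V Xb H {0..<k0} + 2 * (\<Sum>i=k0..<m. ?u i * ?w i)"
      using trace[OF b(1,2)] split[of k0 "\<lambda>i. ?u i * ?w i"] k0m by simp
    also have "2 * (\<Sum>i=k0..<m. ?u i * ?w i) = mat_inner (mat_diag (m - k0) (\<lambda>i. ?u (k0 + i)))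
        (2 \<cdot>\<^sub>m (transpose_mat (cols_sub U {k0..<m}) * H * pinv Xb * H * cols_sub V {k0..<m}))"
      using k0m by (intro pinv_block_inner[OF mn H sv(1,2,3) _ b(3), symmetric]) auto
    finally show "support_fun (T2 k Xb H) (Sb, -1) =
        ereal (Omega_trace_sum X U V Xb H {0..<k0} + mat_inner (mat_diag (m - k0) (\<lambda>i. ?u (k0 + i)))
          (2 \<cdot>\<^sub>m (transpose_mat (cols_sub U {k0..<m}) * H * pinv Xb * H * cols_sub V {k0..<m})))"
      using support by simp
  qed
qed

end
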